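(* Assume Hypothesis A$'$. Let $T>0$ and let $\{f(t,x,v)\}_{t\in[0,T]}$ be a collection of probability densities which is a strong solution of the Boltzmann equation on $[0,T]$, with $f\in C([0,T]\times\mathbb{R}^6)$ and satisfying (B2) (with $\gamma=1$). Suppose there exist a stochastic basis $(\Omega,\mathscr F,(\mathscr F_t)_{t\in[0,T]},P)$, an adapted Poisson random measure $N$ with compensator $m(s,v)\,dv\,Q(d\theta)\,d\phi\,dr\,ds$, and an adapted c\`adl\`ag process $(X_t,Z_t)_{t\in[0,T]}$ satisfying a.s. the system (S), and that $\sup_{t\in[0,T]}\int|z|^2\mu_t(dx,dz)<\infty$, where $\mu_t$ is the law of $(X_t,Z_t)$. Then $\{\mu_t\}_{t\in[0,T]}$ is a weak solution of the bilinear Boltzmann equation related to $f$ on $[0,T]$ (in the measure sense).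
   Context: Collision geometry: for $w\in\mathbb{R}^3\setminus\{0\}$ fix measurable $I(w),J(w)$ such that $w/|w|,I(w)/|w|,J(w)/|w|$ is an orthonormal basis, and set $\Gamma(w,\phi)=I(w)\cos\phi+J(w)\sin\phi$. For $z,v\in\mathbb{R}^3$, $\theta\in(0,\pi]$, $\phi\in[0,2\pi)$ let $\alpha(z,v,\theta,\phi)=\sin^2(\theta/2)(v-z)+\frac{\sin\theta}{2}\Gamma(v-z,\phi)$, $z^\star=z+\alpha$, $v^\star=v-\alpha$. $\Xi=(0,\pi]\times[0,2\pi)$. Hypothesis A$'$ (hard spheres, non-cutoff): $Q$ is a $\sigma$-finite measure on $(0,\pi]$, finite outside every neighbourhood of $0$, with $\int_0^\epsilon\theta Q(d\theta)<\infty$ for all $\epsilon>0$; $\sigma(r)=c\,r$ with $c>0$. Boltzmann equation: $\partial_tf+z\cdot\nabla_xf=Q(f,f)$, $Q(f,f)(t,x,z)=\int_{\mathbb{R}^3\times\Xi}\{f(t,x,z^\star)f(t,x,v^\star)-f(t,x,z)f(t,x,v)\}\sigma(|z-v|)\,dv\,Q(d\theta)\,d\phi$; strong solution on $[0,T]$ means probability densities satisfying it pointwise for each $t\in[0,T]$. (B2): $t\mapsto\sup_{x}\int_{\mathbb{R}^3}|z|^{1+\gamma}f(t,x,z)\,dz\in C([0,T])$. $m(t,v)=\int f(t,x,v)\,dx$, $f(t,x|v)=f(t,x,v)/m(t,v)$. System (S): a.s. for all $t\in[0,T]$, $X_t=X_0+\int_0^tZ_s\,ds$ and $Z_t=Z_0+\int_0^t\int_{\mathbb{R}^3\times\Xi\times[0,\infty)}\alpha(Z_{s-},v,\theta,\phi)\mathbf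 1_{[0,\sigma(|Z_{s-}-v|)f(s,X_s|v)]}(r)\,N(dv,d\theta,d\phi,dr,ds)$. $L_{f(t)}\psi(x,z)=\int_{\mathbb{R}^3\times\Xi}\{\psi(x,z^\star)-\psi(x,z)\}f(t,x,v)\sigma(|z-v|)\,dv\,Q(d\theta)\,d\phi$. Weak (measure) solution of the bilinear Boltzmann equation related to $f$ on $[0,T]$: probability measures $\{\mu_t\}_{t\in[0,T]}$ on $\mathbb{R}^6$ such that for all $t\in[0,T]$ and all $\psi\in C^2_0(\mathbb{R}^6)$: $\int\psi\,d\mu_t=\int\psi\,d\mu_0+\int_0^t\int(z\cdot\nabla_x\psi(x,z))\,\mu_s(dx,dz)\,ds+\int_0^t\int L_{f(s)}\psi(x,z)\,\mu_s(dx,dz)\,ds$. *)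

theory Defs
  imports "HOL-Probability.Probability"
begin

type_synonym vec3 = "real^3"

text \<open>I, J are the fixed measurable maps; only their values on w \<noteq> 0 matter.\<close>
definition admissible_IJ :: "(vec3 \<Rightarrow> vec3) \<Rightarrow> (vec3 \<Rightarrow> vec3) \<Rightarrow> bool" where
  "admissible_IJ I J \<longleftrightarrow> I \<in> borel_measurable borel \<and> J \<in> borel_measurable borel \<and>
     (\<forall>w. w \<noteq> 0 \<longrightarrow> norm (I w) = norm w \<and> norm (J w) = norm w \<and>
        w \<bullet> I w = 0 \<and> w \<bullet> J w = 0 \<and> I w \<bullet> J w = 0)"

definition Gam :: "(vec3 \<Rightarrow> vec3) \<Rightarrow> (vec3 \<Rightarrow> vec3) \<Rightarrow> vec3 \<Rightarrow> real \<Rightarrow> vec3" where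
  "Gam I J w \<phi> = cos \<phi> *\<^sub>R I w + sin \<phi> *\<^sub>R J w"

definition alpha :: "(vec3 \<Rightarrow> vec3) \<Rightarrow> (vec3 \<Rightarrow> vec3) \<Rightarrow> vec3 \<Rightarrow> vec3 \<Rightarrow> real \<Rightarrow> real \<Rightarrow> vec3" where
  "alpha I J z v \<theta> \<phi> = (sin (\<theta>/2))\<^sup>2 *\<^sub>R (v - z) + (sin \<theta> / 2) *\<^sub>R Gam I J (v - z) \<phi>"

definition zstar where "zstar I J z v \<theta> \<phi> = z + alpha I J z v \<theta> \<phi>"
definition vstar where "vstar I J z v \<theta> \<phi> = v - alpha I J z v \<theta> \<phi>"

text \<open>Lebesgue measure on [0, 2 pi) for phi, kept with space UNIV.\<close>
definition phi_measure :: "real measure" where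
  "phi_measure = density lborel (indicator {0..<2*pi})"

definition hypA' :: "real measure \<Rightarrow> (real \<Rightarrow> real) \<Rightarrow> bool" where
  "hypA' Q \<sigma> \<longleftrightarrow>
     sets Q = sets borel \<and> sigma_finite_measure Q \<and>
     emeasure Q (UNIV - {0<..pi}) = 0 \<and>
     (\<forall>\<epsilon>>0. emeasure Q ({\<epsilon>..pi}) < \<infinity>) \<and>
     (\<forall>\<epsilon>>0. (\<integral>\<^sup>+ \<theta>. ennreal \<theta> * indicator {0<..\<epsilon>} \<theta> \<partial>Q) < \<infinity>) \<and>
     (\<exists>c>0. \<forall>r. \<sigma> r = c * r)"

definition coll_measure :: "real measure \<Rightarrow> (vec3 \<times> real \<times> real) measure" where
  "coll_measure Q = lborel \<Otimes>\<^sub>M (Q \<Otimes>\<^sub>M phi_measure)"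

definition coll_integrand where
  "coll_integrand I J Q \<sigma> f t x z =
     (\<lambda>(v,\<theta>,\<phi>). (f t x (zstar I J z v \<theta> \<phi>) * f t x (vstar I J z v \<theta> \<phi>) - f t x z * f t x v)
                 * \<sigma> (norm (z - v)))"

definition Qcoll where
  "Qcoll I J Q \<sigma> f t x z = (\<integral>p. coll_integrand I J Q \<sigma> f t x z p \<partial>coll_measure Q)"

definition prob_density6 :: "(vec3 \<Rightarrow> vec3 \<Rightarrow> real) \<Rightarrow> bool" where
  "prob_density6 g \<longleftrightarrow> (\<forall>x z. 0 \<le> g x z) \<and> (\<lambda>(x,z). g x z) \<in> borel_measurable borel \<and>
     (\<integral>\<^sup>+ p. ennreal (g (fst p) (snd p)) \<partial>(lborel :: (vec3 \<times> vec3) measure)) = 1"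

definition strong_solution where
  "strong_solution I J Q \<sigma> T f \<longleftrightarrow>
     (\<forall>t\<in>{0..T}. prob_density6 (f t)) \<and>
     (\<forall>t\<in>{0..T}. \<forall>x z. \<exists>Dt Dx.
        ((\<lambda>s. f s x z) has_real_derivative Dt) (at t within {0..T}) \<and>
        ((\<lambda>y. f t y z) has_derivative Dx) (at x) \<and>
        integrable (coll_measure Q) (coll_integrand I J Q \<sigma> f t x z) \<and>
        Dt + Dx z = Qcoll I J Q \<sigma> f t x z)"

definition moment_B2 where
  "moment_B2 T f =
     (\<lambda>t. \<Squnion>x. \<integral>\<^sup>+ z. ennreal ((norm z)\<^sup>2 * f t x z) \<partial>(lborel :: vec3 measure))"

definition hypB2 where
  "hypB2 T f \<longleftrightarrow> (\<forall>t\<in>{0..T}. moment_B2 T f t < \<infinity>) \<and>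
     continuous_on {0..T} (\<lambda>t. enn2real (moment_B2 T f t))"

definition marg :: "(real \<Rightarrow> vec3 \<Rightarrow> vec3 \<Rightarrow> real) \<Rightarrow> real \<Rightarrow> vec3 \<Rightarrow> real" where
  "marg f t v = (\<integral>x. f t x v \<partial>lborel)"

definition cond_dens where
  "cond_dens f t x v = f t x v / marg f t v"

definition stochastic_basis :: "'w measure \<Rightarrow> (real \<Rightarrow> 'w measure) \<Rightarrow> real \<Rightarrow> bool" where
  "stochastic_basis M F T \<longleftrightarrow> prob_space M \<and> (\<forall>t\<in>{0..T}. subalgebra M (F t)) \<and>
     (\<forall>s t. 0 \<le> s \<longrightarrow> s \<le> t \<longrightarrow> t \<le> T \<longrightarrow> sets (F s) \<subseteq> sets (F t))"

type_synonym noise_pt = "vec3 \<times> real \<times> real \<times> real \<times> real"  (* (v, theta, phi, r, s) *)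

definition intensity :: "real measure \<Rightarrow> real \<Rightarrow> (real \<Rightarrow> vec3 \<Rightarrow> real) \<Rightarrow> noise_pt measure" where
  "intensity Q T m = density (lborel \<Otimes>\<^sub>M (Q \<Otimes>\<^sub>M (phi_measure \<Otimes>\<^sub>M
        (density lborel (indicator {0..}) \<Otimes>\<^sub>M density lborel (indicator {0..T})))))
     (\<lambda>(v,\<theta>,\<phi>,r,s). ennreal (m s v))"

definition time_slab :: "(vec3 \<times> real \<times> real \<times> real) set \<Rightarrow> real set \<Rightarrow> noise_pt set" where
  "time_slab A S = {(v,\<theta>,\<phi>,r,s). (v,\<theta>,\<phi>,r) \<in> A \<and> s \<in> S}"

definition adapted_PRM :: "'w measure \<Rightarrow> (real \<Rightarrow> 'w measure) \<Rightarrow> real \<Rightarrow> noise_pt measure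
     \<Rightarrow> ('w \<Rightarrow> noise_pt measure) \<Rightarrow> bool" where
  "adapted_PRM M F T \<nu> N \<longleftrightarrow>
     (\<forall>\<omega>\<in>space M. sets (N \<omega>) = sets \<nu>) \<and>
     (\<forall>B\<in>sets \<nu>. (\<lambda>\<omega>. N \<omega> B) \<in> borel_measurable M) \<and>
     (\<forall>B\<in>sets \<nu>. emeasure \<nu> B < \<infinity> \<longrightarrow> (\<forall>k::nat.
         measure M {\<omega>\<in>space M. N \<omega> B = of_nat k}
           = exp (- enn2real (emeasure \<nu> B)) * enn2real (emeasure \<nu> B) ^ k / fact k)) \<and>
     (\<forall>(K::nat set) B. finite K \<longrightarrow> (\<forall>i\<in>K. B i \<in> sets \<nu>) \<longrightarrow> disjoint_family_on B K \<longrightarrow>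
         prob_space.indep_vars M (\<lambda>_. borel) (\<lambda>i \<omega>. N \<omega> (B i)) K) \<and>
     (\<forall>A t. time_slab A {0..t} \<in> sets \<nu> \<longrightarrow> t \<in> {0..T} \<longrightarrow>
         (\<lambda>\<omega>. N \<omega> (time_slab A {0..t})) \<in> borel_measurable (F t)) \<and>
     (\<forall>A s t. time_slab A {s<..t} \<in> sets \<nu> \<longrightarrow> 0 \<le> s \<longrightarrow> s \<le> t \<longrightarrow> t \<le> T \<longrightarrow>
         (\<forall>E\<in>sets (F s). \<forall>C\<in>sets (borel :: ennreal measure).
            measure M (E \<inter> {\<omega>\<in>space M. N \<omega> (time_slab A {s<..t}) \<in> C})
              = measure M E * measure M {\<omega>\<in>space M. N \<omega> (time_slab A {s<..t}) \<in> C}))"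

definition cadlag_on :: "real \<Rightarrow> (real \<Rightarrow> 'b::topological_space) \<Rightarrow> bool" where
  "cadlag_on T p \<longleftrightarrow> (\<forall>t\<in>{0..<T}. (p \<longlongrightarrow> p t) (at_right t)) \<and>
     (\<forall>t\<in>{0<..T}. \<exists>l. (p \<longlongrightarrow> l) (at_left t))"

definition leftlim :: "(real \<Rightarrow> 'b::t2_space) \<Rightarrow> real \<Rightarrow> 'b" where
  "leftlim p s = (if s \<le> 0 then p 0 else Lim (at_left s) p)"

definition sde_integrand where
  "sde_integrand I J \<sigma> f X Z t =
     (\<lambda>(v,\<theta>,\<phi>,r,s). indicator {0..t} s *
        indicator {0..\<sigma> (norm (leftlim Z s - v)) * cond_dens f s (X s) v} r
        *\<^sub>R alpha I J (leftlim Z s) v \<theta> \<phi>)"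

text \<open>System (S) for one sample path (the N-integral is the pathwise Lebesgue integral).\<close>
definition system_S where
  "system_S I J \<sigma> f T Nw X Z \<longleftrightarrow>
     (\<forall>t\<in>{0..T}. (\<lambda>s. Z s) integrable_on {0..t} \<and> X t = X 0 + integral {0..t} Z \<and>
        integrable Nw (sde_integrand I J \<sigma> f X Z t) \<and>
        Z t = Z 0 + (\<integral>p. sde_integrand I J \<sigma> f X Z t p \<partial>Nw))"

definition C2 :: "(vec3 \<times> vec3 \<Rightarrow> real) \<Rightarrow> bool" where
  "C2 \<psi> \<longleftrightarrow> (\<exists>D D2. (\<forall>p. (\<psi> has_derivative blinfun_apply (D p)) (at p)) \<and>
                 (\<forall>p. (D has_derivative blinfun_apply (D2 p)) (at p)) \<and> continuous_on UNIV D2)"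

definition C2_0 :: "(vec3 \<times> vec3 \<Rightarrow> real) \<Rightarrow> bool" where
  "C2_0 \<psi> \<longleftrightarrow> C2 \<psi> \<and> compact (closure {p. \<psi> p \<noteq> 0})"

definition Lop where
  "Lop I J Q \<sigma> f t \<psi> = (\<lambda>(x,z). \<integral>(v,\<theta>,\<phi>). (\<psi> (x, zstar I J z v \<theta> \<phi>) - \<psi> (x,z)) * f t x v * \<sigma> (norm (z - v))
                                  \<partial>coll_measure Q)"

definition weak_bilinear_solution where
  "weak_bilinear_solution I J Q \<sigma> f T \<mu> \<longleftrightarrow>
     (\<forall>t\<in>{0..T}. prob_space (\<mu> t) \<and> sets (\<mu> t) = sets borel) \<and>
     (\<forall>\<psi> D\<psi>. C2_0 \<psi> \<longrightarrow> (\<forall>p. (\<psi> has_derivative D\<psi> p) (at p)) \<longrightarrow>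
        (\<forall>t\<in>{0..T}.
           (\<integral>p. \<psi> p \<partial>\<mu> t) = (\<integral>p. \<psi> p \<partial>\<mu> 0)
             + (LINT s:{0..t}|lborel. (\<integral>(x,z). D\<psi> (x,z) (z, 0) \<partial>\<mu> s))
             + (LINT s:{0..t}|lborel. (\<integral>p. Lop I J Q \<sigma> f s \<psi> p \<partial>\<mu> s))))"

end

theory Submission
  imports Defs
begin

text \<open>Restricted to the marks with \<open>1/(k+1) \<le> \<theta>\<close> and \<open>r \<le> k+1\<close>, the noise almost surely has finitely
  many atoms, at distinct times. The path \<open>Z\<^sup>k\<close> driven by these atoms is a step function and its
  integral \<open>X\<^sup>k\<close> is piecewise affine, so the change of variables formula for \<open>\<psi>(X\<^sup>k, Z\<^sup>k)\<close> is
  elementary; dominated convergence lets \<open>k \<rightarrow> \<infinity>\<close>. In the limit the noise integral has a predictable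
  integrand, because only the left limits of \<open>X\<close> and \<open>Z\<close> enter, and therefore in expectation \<open>N\<close> may
  be replaced by its intensity. Integrating out \<open>r\<close> turns \<open>m(s,v)\<close> times the indicator of
  \<open>r \<le> \<sigma>(|Z-v|) f(s,X|v)\<close> into \<open>\<sigma>(|Z-v|) f(s,X,v)\<close>, which produces \<open>L\<^bsub>f(s)\<^esub>\<psi>\<close>. All integrals are
  finite since \<open>\<psi>\<close> has compact support in \<open>x\<close>, so that \<open>f\<close> is only needed on a set where its mass
  is bounded by continuity and (B2), and \<open>Z\<close> has a bounded second moment.\<close>

section \<open>Change of variables along a jump path\<close>

text \<open>\<open>adapted_PRM\<close> describes \<open>N\<close> only through masses of sets:
  Poisson laws, and independence of the past for one slab at a time. That \<open>N \<omega>\<close>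
  consists of atoms must be derived. Masses are almost surely integers on countably many sets at
  once, and a unit mass that takes only the values 0 and 1 on a countable basis is a point mass. The
  replacement of \<open>N\<close> by its intensity also rests on means alone: on a rectangle, an
  event of \<open>F s\<close> times a slab over \<open>(s,t]\<close>, it is independence, and a
  Dynkin argument carries it to all predictable sets. The filtration is taken as it is, without
  completion, so predictability is established for every sample point. Therefore the noise integrand
  is built from left limits, which are everywhere limits of step functions sampled at earlier times;
  the solution property, which holds only almost surely, is used to compare them with
  \<open>X\<close> and \<open>Z\<close>. The integrability budget is exact: a collision moves
  \<open>z\<close> by a multiple of \<theta>|z-v| and hard spheres contribute another |z-v|, so one
  moment of \<open>Q\<close> and two moments of the velocities are consumed.\<close>

text \<open>Discard all basis sets of mass 0 inside \<open>S\<close>. Something remains because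
  \<open>S\<close> has mass 1, and two distinct remaining points would have disjoint basic
  neighbourhoods of mass 1 each.\<close>

lemma zero_one_measure_atom:
  fixes N :: "'p::t2_space measure"
  assumes sets: "sets N = sets borel" and S: "S \<in> sets N"
    and \<U>: "topological_basis \<U>" "countable \<U>" and one: "emeasure N S = 1"
    and zo: "\<And>U. U \<in> \<U> \<Longrightarrow> emeasure N (S \<inter> U) \<in> {0, 1}"
  obtains p where "p \<in> S" "AE x in N. x \<in> S \<longrightarrow> x = p"
proof -
  have U_meas: "U \<in> sets N" if "U \<in> \<U>" for U
    using topological_basis_open[OF \<U>(1) that] sets by auto
  define V where "V = (\<Union>U\<in>{U\<in>\<U>. emeasure N (S \<inter> U) = 0}. S \<inter> U)"
  have V: "V \<in> null_sets N"
    unfolding V_def using \<U>(2) U_meas S by (intro null_sets_UN') auto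
  have "S - V \<noteq> {}"
  proof
    assume "S - V = {}"
    then have "emeasure N S \<le> emeasure N V"
      using V by (intro emeasure_mono) auto
    then show False using one V by auto
  qed
  then obtain p where p: "p \<in> S" "p \<notin> V" by auto
  have "x = p" if x: "x \<in> S" "x \<notin> V" for x
  proof (rule ccontr)
    assume "x \<noteq> p"
    then obtain A C where AC: "open A" "open C" "x \<in> A" "p \<in> C" "A \<inter> C = {}"
      using hausdorff[OF \<open>x \<noteq> p\<close>] by auto
    obtain U where U: "U \<in> \<U>" "x \<in> U" "U \<subseteq> A"
      by (rule topological_basisE[OF \<U>(1) AC(1,3)])
    obtain W where W: "W \<in> \<U>" "p \<in> W" "W \<subseteq> C"
      by (rule topological_basisE[OF \<U>(1) AC(2,4)])
    note UW = U(1) W(1) U(2,3) W(2,3)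
    have "emeasure N (S \<inter> U) = 1" "emeasure N (S \<inter> W) = 1"
      using zo[OF UW(1)] zo[OF UW(2)] x p UW unfolding V_def by auto
    moreover have "emeasure N ((S \<inter> U) \<union> (S \<inter> W)) = emeasure N (S \<inter> U) + emeasure N (S \<inter> W)"
      using UW AC S U_meas by (intro plus_emeasure[symmetric]) auto
    moreover have "emeasure N ((S \<inter> U) \<union> (S \<inter> W)) \<le> emeasure N S"
      using S by (intro emeasure_mono) auto
    ultimately have "(1::ennreal) + 1 \<le> 1" using one by simp
    then show False by simp
  qed
  then have "AE x in N. x \<in> S \<longrightarrow> x = p"
    using V by (intro AE_I'[OF V]) auto
  then show ?thesis using that p by blast
qed

text \<open>\<open>N\<close> restricted to \<open>S\<close> is zero or a unit point mass.
  Concentration at \<open>p\<close> is expressed almost everywhere because \<open>{p}\<close> need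
  not be measurable in a general mark space.\<close>

definition one_atom :: "'p measure \<Rightarrow> 'p set \<Rightarrow> bool" where
  "one_atom N S \<longleftrightarrow> emeasure N S = 0 \<or> (\<exists>p\<in>S. emeasure N S = 1 \<and> (AE x in N. x \<in> S \<longrightarrow> x = p))"

section \<open>Paths driven by a finite measure: drift along segments, jumps at atoms\<close>

locale finite_jump_path = finite_measure N for N :: "'p measure" +
  fixes \<tau> :: "'p \<Rightarrow> real" and g :: "'p \<Rightarrow> 'a::euclidean_space" and x0 z0 :: 'a
    and \<psi> :: "'a \<times> 'a \<Rightarrow> real" and D :: "'a \<times> 'a \<Rightarrow> ('a \<times> 'a) \<Rightarrow>\<^sub>L real"
  assumes \<tau> [measurable]: "\<tau> \<in> borel_measurable N"
    and g: "integrable N g"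
    and pos: "AE p in N. 0 < \<tau> p"
    and deriv: "\<And>q. (\<psi> has_derivative blinfun_apply (D q)) (at q)"
    and D_cont: "continuous_on UNIV D"
begin

lemma g_meas [measurable]: "g \<in> borel_measurable N"
  using g by auto

lemma \<psi>_cont: "continuous_on UNIV \<psi>"
  by (intro continuous_at_imp_continuous_on ballI has_derivative_continuous[OF deriv])

lemma \<psi>_meas [measurable]: "\<psi> \<in> borel_measurable borel"
  using \<psi>_cont by (rule borel_measurable_continuous_onI)

definition "Zp u = z0 + (\<integral>p. indicator {..u} (\<tau> p) *\<^sub>R g p \<partial>N)"
text \<open>The left limit of \<open>Zp\<close>, obtained without a limit by leaving out the atoms
  at time \<open>u\<close>.\<close>

definition "Zm u = z0 + (\<integral>p. indicator {..<u} (\<tau> p) *\<^sub>R g p \<partial>N)"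
definition "Xp u = x0 + (\<integral>s. indicator {0..u} s *\<^sub>R Zp s \<partial>lborel)"
definition "jump p = \<psi> (Xp (\<tau> p), Zm (\<tau> p) + g p) - \<psi> (Xp (\<tau> p), Zm (\<tau> p))"

lemma int_ind: "A \<in> sets borel \<Longrightarrow> integrable N (\<lambda>p. indicator A (\<tau> p) *\<^sub>R g p)"
  by (rule Bochner_Integration.integrable_bound[OF g]) (auto simp: indicator_def)

text \<open>Compares the path at two times whose sets of events differ by \<open>S\<close>. In use
  \<open>c\<close> is the jump of the only atom, or 0 when no atom intervenes.\<close>

lemma integral_ind_cong:
  assumes "A \<in> sets borel" "B \<in> sets borel" "S \<in> sets N"
    and "AE p in N. indicator A (\<tau> p) *\<^sub>R g p = indicator B (\<tau> p) *\<^sub>R g p + indicator S p *\<^sub>R c"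
  shows "z0 + (\<integral>p. indicator A (\<tau> p) *\<^sub>R g p \<partial>N)
    = z0 + (\<integral>p. indicator B (\<tau> p) *\<^sub>R g p \<partial>N) + measure N S *\<^sub>R c"
proof -
  have "(\<integral>p. indicator A (\<tau> p) *\<^sub>R g p \<partial>N) = (\<integral>p. indicator B (\<tau> p) *\<^sub>R g p + indicator S p *\<^sub>R c \<partial>N)"
    using assms by (intro integral_cong_AE) auto
  also have "\<dots> = (\<integral>p. indicator B (\<tau> p) *\<^sub>R g p \<partial>N) + (\<integral>p. indicator S p *\<^sub>R c \<partial>N)"
    using assms int_ind[of B] by (intro Bochner_Integration.integral_add) (auto simp: emeasure_eq_measure)
  also have "(\<integral>p. indicator S p *\<^sub>R c \<partial>N) = measure N S *\<^sub>R c"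
    using assms(3) by (subst integral_scaleR_left) (auto simp: emeasure_eq_measure)
  finally show ?thesis by simp
qed

lemma Zp_meas [measurable]: "Zp \<in> borel_measurable borel"
proof -
  have *: "indicator {..u} (\<tau> p) = (if \<tau> p \<le> u then 1 else (0::real))" for u p by auto
  show ?thesis unfolding Zp_def * by measurable
qed

lemma Zm_meas [measurable]: "Zm \<in> borel_measurable borel"
proof -
  have *: "indicator {..<u} (\<tau> p) = (if \<tau> p < u then 1 else (0::real))" for u p by auto
  show ?thesis unfolding Zm_def * by measurable
qed

lemma Xp_meas [measurable]: "Xp \<in> borel_measurable borel"
proof -
  have *: "indicator {0..u} s = (if 0 \<le> s \<and> s \<le> u then 1 else (0::real))" for u s by auto
  show ?thesis unfolding Xp_def * by measurable
qed

lemma jump_meas [measurable]: "jump \<in> borel_measurable N"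
  unfolding jump_def by measurable

lemma Zp_bound: "norm (Zp u) \<le> norm z0 + (\<integral>p. norm (g p) \<partial>N)"
proof -
  have "norm (\<integral>p. indicator {..u} (\<tau> p) *\<^sub>R g p \<partial>N) \<le> (\<integral>p. norm (g p) \<partial>N)"
    using g int_ind[of "{..u}"]
    by (intro order_trans[OF integral_norm_bound] integral_mono integrable_norm) (auto simp: indicator_def)
  then show ?thesis unfolding Zp_def by (intro order_trans[OF norm_triangle_ineq] add_left_mono)
qed

lemma Zp_set_integrable: "set_integrable lborel {a..b} Zp"
  unfolding set_integrable_def
  by (rule integrableI_bounded_set_indicator[where B="norm z0 + (\<integral>p. norm (g p) \<partial>N)"])
     (auto simp: Zp_bound emeasure_lborel_Icc_eq)

lemma Zp_int: "Zp integrable_on {a..b}"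
  using Zp_set_integrable set_borel_integral_eq_integral(1) by blast

lemma Xp_eq: "Xp u = x0 + integral {0..u} Zp"
  using set_borel_integral_eq_integral(2)[OF Zp_set_integrable]
  unfolding Xp_def set_lebesgue_integral_def by simp

lemma Xp_affine:
  assumes "0 \<le> u" "u \<le> w" "\<And>s. u \<le> s \<Longrightarrow> s < w \<Longrightarrow> Zp s = a"
  shows "Xp w = Xp u + (w - u) *\<^sub>R a"
proof -
  have "integral {0..w} Zp = integral {0..u} Zp + integral {u..w} Zp"
    using assms Zp_int by (intro Henstock_Kurzweil_Integration.integral_combine[symmetric]) auto
  \<comment> \<open>\<open>Zp\<close> may jump at the right endpoint \<open>w\<close>; one point
    does not affect the integral.\<close>
  moreover have "integral {u..w} Zp = integral {u..w} (\<lambda>_. a)"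
    using assms by (intro integral_spike[where S="{w}"]) auto
  ultimately show ?thesis using assms unfolding Xp_eq by simp
qed

text \<open>Without jumps the path is a segment with constant velocity \<open>a\<close>, so this is
  the fundamental theorem of calculus along a line. The conditions on \<open>Zp\<close> and
  \<open>Zm\<close> leave opposite endpoints free, which lets such intervals be joined at a
  jump.\<close>

lemma drift_integral:
  assumes "0 \<le> u" "u \<le> w" and p: "\<And>s. u \<le> s \<Longrightarrow> s < w \<Longrightarrow> Zp s = a"
    and m: "\<And>s. u < s \<Longrightarrow> s \<le> w \<Longrightarrow> Zm s = a"
  shows "((\<lambda>s. D (Xp s, Zm s) (Zm s, 0)) has_integral (\<psi> (Xp w, a) - \<psi> (Xp u, a))) {u..w}"
proof -
  define h where "h s = \<psi> (Xp u + (s - u) *\<^sub>R a, a)" for s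
  have "((\<lambda>s. D (Xp u + (s - u) *\<^sub>R a, a) (a, 0)) has_integral (h w - h u)) {u..w}"
  proof (rule fundamental_theorem_of_calculus[OF \<open>u \<le> w\<close>])
    fix s assume "s \<in> {u..w}"
    have "((\<lambda>s. (Xp u + (s - u) *\<^sub>R a, a)) has_derivative (\<lambda>d. (d *\<^sub>R a, 0))) (at s within {u..w})"
      by (auto intro!: derivative_eq_intros)
    from has_derivative_compose[OF this deriv]
    have "(h has_derivative (\<lambda>d. D (Xp u + (s - u) *\<^sub>R a, a) (d *\<^sub>R a, 0))) (at s within {u..w})"
      unfolding h_def .
    moreover have "(\<lambda>d. D (Xp u + (s - u) *\<^sub>R a, a) (d *\<^sub>R a, 0))
        = (\<lambda>d. d *\<^sub>R D (Xp u + (s - u) *\<^sub>R a, a) (a, 0))"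
      by (rule ext, subst blinfun.scaleR_right[symmetric]) simp
    ultimately show "(h has_vector_derivative D (Xp u + (s - u) *\<^sub>R a, a) (a, 0)) (at s within {u..w})"
      unfolding has_vector_derivative_def by simp
  qed
  moreover have X: "Xp u + (s - u) *\<^sub>R a = Xp s" if "s \<in> {u..w}" for s
    using that assms by (intro Xp_affine[symmetric]) auto
  moreover have "h w = \<psi> (Xp w, a)" "h u = \<psi> (Xp u, a)"
    unfolding h_def using X[of w] \<open>u \<le> w\<close> by auto
  \<comment> \<open>\<open>Zm u\<close> may still be the velocity before a jump at \<open>u\<close>,
    hence the exceptional point.\<close>
  ultimately show ?thesis
    using m by - (rule has_integral_spike_finite[where S="{u}" and T="{u..w}"
          and f="\<lambda>s. D (Xp u + (s - u) *\<^sub>R a, a) (a, 0)"], auto)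
qed

text \<open>Without an atom there is only drift. With one atom, at time \<rho>, the interval splits
  into two drift pieces, and what is missing between them is the value of \<open>jump\<close> at the
  atom.\<close>

lemma increment:
  assumes uw: "0 \<le> u" "u \<le> w" and one: "one_atom N {p\<in>space N. u < \<tau> p \<and> \<tau> p \<le> w}"
  shows "integrable N (\<lambda>p. indicator {u<..w} (\<tau> p) * jump p)" (is ?A)
    and "((\<lambda>s. D (Xp s, Zm s) (Zm s, 0)) has_integral
       (\<psi> (Xp w, Zp w) - \<psi> (Xp u, Zp u) - (\<integral>p. indicator {u<..w} (\<tau> p) * jump p \<partial>N))) {u..w}" (is ?B)
proof -
  define S where "S = {p\<in>space N. u < \<tau> p \<and> \<tau> p \<le> w}"
  have S [measurable]: "S \<in> sets N" unfolding S_def by measurable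
  have "?A \<and> ?B"
    using one[folded S_def, unfolded one_atom_def]
  proof
    assume "emeasure N S = 0"
    then have "S \<in> null_sets N" using S by auto
    then have AE: "AE p in N. p \<notin> S" by (rule AE_not_in)
    have z: "Zp s = Zp u" if "u \<le> s" "s \<le> w" for s
    proof -
      have "AE p in N. indicator {..s} (\<tau> p) *\<^sub>R g p = indicator {..u} (\<tau> p) *\<^sub>R g p + indicator S p *\<^sub>R 0"
        using AE AE_space by eventually_elim (use that in \<open>auto simp: S_def indicator_def\<close>)
      from integral_ind_cong[OF _ _ S this] show ?thesis unfolding Zp_def by simp
    qed
    have m: "Zm s = Zp u" if "u < s" "s \<le> w" for s
    proof -
      have "AE p in N. indicator {..<s} (\<tau> p) *\<^sub>R g p = indicator {..u} (\<tau> p) *\<^sub>R g p + indicator S p *\<^sub>R 0"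
        using AE AE_space by eventually_elim (use that in \<open>auto simp: S_def indicator_def\<close>)
      from integral_ind_cong[OF _ _ S this] show ?thesis unfolding Zp_def Zm_def by simp
    qed
    have j: "AE p in N. indicator {u<..w} (\<tau> p) * jump p = 0"
      using AE AE_space by eventually_elim (auto simp: S_def indicator_def)
    have "integrable N (\<lambda>p. indicator {u<..w} (\<tau> p) * jump p)"
      using j by (subst integrable_cong_AE[where g="\<lambda>_. 0"]) auto
    moreover have "(\<integral>p. indicator {u<..w} (\<tau> p) * jump p \<partial>N) = 0"
      using j by (subst integral_cong_AE[where g="\<lambda>_. 0"]) auto
    moreover have "((\<lambda>s. D (Xp s, Zm s) (Zm s, 0)) has_integral (\<psi> (Xp w, Zp u) - \<psi> (Xp u, Zp u))) {u..w}"
      by (rule drift_integral[OF uw]) (rule z m; simp)+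
    ultimately show ?thesis using z[OF uw(2) order_refl] by (simp only: diff_0_right simp_thms)
  next
    assume "\<exists>p\<in>S. emeasure N S = 1 \<and> (AE x in N. x \<in> S \<longrightarrow> x = p)"
    then obtain q where q: "q \<in> S" "emeasure N S = 1" and AE: "AE x in N. x \<in> S \<longrightarrow> x = q" by auto
    have S1: "measure N S = 1" using q(2) by (simp add: measure_def)
    define \<rho> where "\<rho> = \<tau> q"
    have \<rho>: "u < \<rho>" "\<rho> \<le> w" "0 \<le> \<rho>" using q(1) uw unfolding S_def \<rho>_def by auto
    \<comment> \<open>Before \<rho> the atom is not counted, so the correction set is empty; from
      \<rho> on it is all of \<open>S\<close>, which contributes the single jump
      \<open>g q\<close>.\<close>
    have z1: "Zp s = Zp u" if "u \<le> s" "s < \<rho>" for s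
    proof -
      have "AE p in N. indicator {..s} (\<tau> p) *\<^sub>R g p = indicator {..u} (\<tau> p) *\<^sub>R g p + indicator {} p *\<^sub>R 0"
        using AE AE_space by eventually_elim (use that \<rho> in \<open>auto simp: S_def indicator_def \<rho>_def\<close>)
      from integral_ind_cong[OF _ _ _ this] show ?thesis unfolding Zp_def using S S1 by simp
    qed
    \<comment> \<open>At \<rho> itself the left limit still has the old velocity, hence
      \<open>s \<le> \<rho>\<close> here and \<open>s < \<rho>\<close> in \<open>z1\<close>.\<close>
    have m1: "Zm s = Zp u" if "u < s" "s \<le> \<rho>" for s
    proof -
      have "AE p in N. indicator {..<s} (\<tau> p) *\<^sub>R g p = indicator {..u} (\<tau> p) *\<^sub>R g p + indicator {} p *\<^sub>R 0"
        using AE AE_space by eventually_elim (use that \<rho> in \<open>auto simp: S_def indicator_def \<rho>_def\<close>)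
      from integral_ind_cong[OF _ _ _ this] show ?thesis unfolding Zp_def Zm_def using S S1 by simp
    qed
    have z2: "Zp s = Zp u + g q" if "\<rho> \<le> s" "s \<le> w" for s
    proof -
      have "AE p in N. indicator {..s} (\<tau> p) *\<^sub>R g p = indicator {..u} (\<tau> p) *\<^sub>R g p + indicator S p *\<^sub>R g q"
        using AE AE_space by eventually_elim (use that \<rho> in \<open>auto simp: S_def indicator_def \<rho>_def\<close>)
      from integral_ind_cong[OF _ _ _ this] show ?thesis unfolding Zp_def using S S1 by simp
    qed
    have m2: "Zm s = Zp u + g q" if "\<rho> < s" "s \<le> w" for s
    proof -
      have "AE p in N. indicator {..<s} (\<tau> p) *\<^sub>R g p = indicator {..u} (\<tau> p) *\<^sub>R g p + indicator S p *\<^sub>R g q"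
        using AE AE_space by eventually_elim (use that \<rho> in \<open>auto simp: S_def indicator_def \<rho>_def\<close>)
      from integral_ind_cong[OF _ _ _ this] show ?thesis unfolding Zp_def Zm_def using S S1 by simp
    qed
    have j: "AE p in N. indicator {u<..w} (\<tau> p) * jump p = indicator S p * jump q"
      using AE AE_space by eventually_elim (auto simp: S_def indicator_def)
    have "integrable N (\<lambda>p. indicator {u<..w} (\<tau> p) * jump p)"
      using j S by (subst integrable_cong_AE[where g="\<lambda>p. indicator S p * jump q"])
        (auto simp: emeasure_eq_measure)
    moreover have "(\<integral>p. indicator {u<..w} (\<tau> p) * jump p \<partial>N) = jump q"
      using j S S1 by (subst integral_cong_AE[where g="\<lambda>p. indicator S p * jump q"]) auto
    moreover have "jump q = \<psi> (Xp \<rho>, Zp u + g q) - \<psi> (Xp \<rho>, Zp u)"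
      unfolding jump_def using m1[of \<rho>] \<rho> by (simp add: \<rho>_def)
    moreover have "((\<lambda>s. D (Xp s, Zm s) (Zm s, 0)) has_integral
        ((\<psi> (Xp \<rho>, Zp u) - \<psi> (Xp u, Zp u)) + (\<psi> (Xp w, Zp u + g q) - \<psi> (Xp \<rho>, Zp u + g q)))) {u..w}"
    proof (rule has_integral_combine)
      show "u \<le> \<rho>" "\<rho> \<le> w" using \<rho> by auto
      show "((\<lambda>s. D (Xp s, Zm s) (Zm s, 0)) has_integral (\<psi> (Xp \<rho>, Zp u) - \<psi> (Xp u, Zp u))) {u..\<rho>}"
        using uw \<rho> by - (rule drift_integral, linarith, linarith, (rule z1 m1; linarith)+)
      show "((\<lambda>s. D (Xp s, Zm s) (Zm s, 0)) has_integral
          (\<psi> (Xp w, Zp u + g q) - \<psi> (Xp \<rho>, Zp u + g q))) {\<rho>..w}"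
        using uw \<rho> by - (rule drift_integral, linarith, linarith, (rule z2 m2; linarith)+)
    qed
    moreover have "\<psi> (Xp w, Zp w) - \<psi> (Xp u, Zp u) - (\<psi> (Xp \<rho>, Zp u + g q) - \<psi> (Xp \<rho>, Zp u))
        = (\<psi> (Xp \<rho>, Zp u) - \<psi> (Xp u, Zp u)) + (\<psi> (Xp w, Zp u + g q) - \<psi> (Xp \<rho>, Zp u + g q))"
      using z2[of w] \<rho> by simp
    ultimately show ?thesis by (simp only: simp_thms)
  qed
  then show ?A ?B by auto
qed

lemma Zp_0: "Zp 0 = z0"
proof -
  have "(\<integral>p. indicator {..0} (\<tau> p) *\<^sub>R g p \<partial>N) = (\<integral>p. 0 \<partial>N)"
    using pos by (intro integral_cong_AE) (auto simp: indicator_def)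
  then show ?thesis unfolding Zp_def by simp
qed

lemma Xp_0: "Xp 0 = x0"
  unfolding Xp_eq by simp

text \<open>Telescopes \<open>increment\<close> over the grid. The induction also carries
  integrability of the jump part, without which the noise integrals of adjacent slabs could not be
  added.\<close>

lemma finite_ito:
  assumes t: "0 \<le> t" and n: "0 < n"
    and one: "\<And>i. i < n \<Longrightarrow> one_atom N {p\<in>space N. t * real i / n < \<tau> p \<and> \<tau> p \<le> t * real (Suc i) / n}"
  shows "((\<lambda>s. D (Xp s, Zm s) (Zm s, 0)) has_integral
       (\<psi> (Xp t, Zp t) - \<psi> (x0, z0) - (\<integral>p. indicator {0<..t} (\<tau> p) * jump p \<partial>N))) {0..t}"
proof -
  define u where "u i = t * real i / n" for i
  have u0: "u 0 = 0" and un: "u n = t" using n unfolding u_def by auto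
  have mono: "u i \<le> u (Suc i)" "0 \<le> u i" for i
    using n t unfolding u_def by (auto intro!: divide_right_mono mult_left_mono)
  have "integrable N (\<lambda>p. indicator {0<..u i} (\<tau> p) * jump p) \<and>
    ((\<lambda>s. D (Xp s, Zm s) (Zm s, 0)) has_integral
       (\<psi> (Xp (u i), Zp (u i)) - \<psi> (x0, z0) - (\<integral>p. indicator {0<..u i} (\<tau> p) * jump p \<partial>N))) {0..u i}"
    if "i \<le> n" for i
    using that
  proof (induction i)
    case 0
    then show ?case using u0 by (auto simp: Zp_0 Xp_0)
  next
    case (Suc i)
    then have IH: "integrable N (\<lambda>p. indicator {0<..u i} (\<tau> p) * jump p)"
      "((\<lambda>s. D (Xp s, Zm s) (Zm s, 0)) has_integral
       (\<psi> (Xp (u i), Zp (u i)) - \<psi> (x0, z0) - (\<integral>p. indicator {0<..u i} (\<tau> p) * jump p \<partial>N))) {0..u i}"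
      by auto
    have "one_atom N {p\<in>space N. u i < \<tau> p \<and> \<tau> p \<le> u (Suc i)}"
      unfolding u_def using one[of i] Suc by auto
    note inc = increment[OF mono(2)[of i] mono(1)[of i] this]
    have *: "(\<lambda>p. indicator {0<..u (Suc i)} (\<tau> p) * jump p)
      = (\<lambda>p. indicator {0<..u i} (\<tau> p) * jump p + indicator {u i<..u (Suc i)} (\<tau> p) * jump p)"
      using mono[of i] by (auto simp: indicator_def)
    have "integrable N (\<lambda>p. indicator {0<..u (Suc i)} (\<tau> p) * jump p)"
      unfolding * using IH inc by auto
    moreover have "(\<integral>p. indicator {0<..u (Suc i)} (\<tau> p) * jump p \<partial>N)
      = (\<integral>p. indicator {0<..u i} (\<tau> p) * jump p \<partial>N) + (\<integral>p. indicator {u i<..u (Suc i)} (\<tau> p) * jump p \<partial>N)"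
      unfolding * using IH inc by auto
    ultimately show ?case
      using has_integral_combine[OF mono(2) mono(1) IH(2) inc(2)] by (simp add: algebra_simps)
  qed
  from this[of n] show ?thesis unfolding un by auto
qed

end

section \<open>Passage to infinitely many atoms\<close>

lemma one_atom_density:
  assumes "B \<in> sets N" "S \<in> sets N" "one_atom N (B \<inter> S)"
  shows "one_atom (density N (\<lambda>p. ennreal (indicator B p))) S"
proof -
  have e: "emeasure (density N (\<lambda>p. ennreal (indicator B p))) S = emeasure N (B \<inter> S)"
    using assms by (simp add: emeasure_density ennreal_indicator indicator_inter_arith[symmetric])
  have "AE x in density N (\<lambda>p. ennreal (indicator B p)). x \<in> S \<longrightarrow> x = p"
    if "AE x in N. x \<in> B \<inter> S \<longrightarrow> x = p" for p
    using that assms(1) by (subst AE_density) (auto simp: indicator_def)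
  then show ?thesis using assms(3) unfolding one_atom_def e by blast
qed

lemma bounded_derivative_lipschitz:
  fixes \<psi> :: "'a::real_normed_vector \<Rightarrow> 'b::real_normed_vector"
  assumes "\<And>q. (\<psi> has_derivative blinfun_apply (D q)) (at q)" "\<And>q. norm (D q) \<le> L"
  shows "norm (\<psi> a - \<psi> b) \<le> L * norm (a - b)"
  by (rule differentiable_bound[of UNIV \<psi> "\<lambda>q. blinfun_apply (D q)"])
     (use assms in \<open>auto simp: norm_blinfun.rep_eq[symmetric] intro: has_derivative_at_withinI\<close>)

text \<open>The formula holds for the noise restricted to each \<open>B k\<close>, on a grid that
  may depend on \<open>k\<close>. The bounds for the limit are uniform in \<open>k\<close>: the
  paths stay below \<open>C\<close>, the jumps of \<psi> below \<open>L * norm (g p)\<close>, which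
  is integrable, and the drift below \<open>L * C\<close>.\<close>

lemma pathwise_ito:
  fixes N :: "'p measure" and \<tau> :: "'p \<Rightarrow> real" and g :: "'p \<Rightarrow> 'a::euclidean_space"
    and X Z Zm :: "real \<Rightarrow> 'a" and D :: "'a \<times> 'a \<Rightarrow> ('a \<times> 'a) \<Rightarrow>\<^sub>L real"
  defines "jump \<equiv> \<lambda>t \<psi> p. indicator {0<..t} (\<tau> p) * (\<psi> (X (\<tau> p), Zm (\<tau> p) + g p) - \<psi> (X (\<tau> p), Zm (\<tau> p)))"
  assumes \<tau> [measurable]: "\<tau> \<in> borel_measurable N"
    and g: "integrable N g"
    and pos: "AE p in N. 0 < \<tau> p"
    and t: "0 \<le> t"
    and B [measurable]: "\<And>k::nat. B k \<in> sets N" and Bfin: "\<And>k. emeasure N (B k) < \<infinity>"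
    and Binc: "incseq B" and Bcov: "AE p in N. p \<in> (\<Union>k. B k)"
    and one: "\<And>k. \<exists>n>0. \<forall>i<n. one_atom N (B k \<inter> {p\<in>space N. t * real i / real n < \<tau> p \<and> \<tau> p \<le> t * real (Suc i) / real n})"
    and Z: "\<And>u. 0 \<le> u \<Longrightarrow> u \<le> t \<Longrightarrow> Z u = z0 + (\<integral>p. indicator {..u} (\<tau> p) *\<^sub>R g p \<partial>N)"
    and Zm: "\<And>u. 0 < u \<Longrightarrow> u \<le> t \<Longrightarrow> Zm u = z0 + (\<integral>p. indicator {..<u} (\<tau> p) *\<^sub>R g p \<partial>N)"
    and X: "\<And>u. 0 \<le> u \<Longrightarrow> u \<le> t \<Longrightarrow> X u = x0 + integral {0..u} Z"
    and deriv: "\<And>q. (\<psi> has_derivative blinfun_apply (D q)) (at q)"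
    and D_cont: "continuous_on UNIV D" and D_bound: "\<And>q. norm (D q) \<le> L"
    and jump_meas: "jump t \<psi> \<in> borel_measurable N"
  shows "integrable N (jump t \<psi>)"
    and "((\<lambda>s. D (X s, Zm s) (Zm s, 0)) has_integral
       (\<psi> (X t, Z t) - \<psi> (x0, z0) - (\<integral>p. jump t \<psi> p \<partial>N))) {0..t}"
proof -
  have g_meas [measurable]: "g \<in> borel_measurable N" using g by auto
  define C where "C = norm z0 + (\<integral>p. norm (g p) \<partial>N)"
  define Nk where "Nk k = density N (\<lambda>p. ennreal (indicator (B k) p))" for k
  have L0: "0 \<le> L" using D_bound[of undefined] norm_ge_zero order_trans by blast
  have lip: "\<bar>\<psi> a - \<psi> b\<bar> \<le> L * norm (a - b)" for a b
    using bounded_derivative_lipschitz[OF deriv D_bound] by simp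
  have fjp: "finite_jump_path (Nk k) \<tau> g \<psi> D" for k
  proof (intro finite_jump_path.intro finite_measureI finite_jump_path_axioms.intro)
    show "emeasure (Nk k) (space (Nk k)) \<noteq> \<infinity>"
      using Bfin[of k] sets.sets_into_space[OF B[of k]]
      by (simp add: Nk_def emeasure_density ennreal_indicator indicator_inter_arith[symmetric] Int_absorb1 Int_absorb2)
    show "integrable (Nk k) g"
      unfolding Nk_def using integrable_mult_indicator[OF B g] by (subst integrable_density) auto
    show "AE p in Nk k. 0 < \<tau> p"
      unfolding Nk_def using pos by (subst AE_density) auto
  qed (use deriv D_cont in \<open>auto simp: Nk_def\<close>)
  have intN: "(\<integral>p. h p \<partial>Nk k) = (\<integral>p. indicator (B k) p *\<^sub>R h p \<partial>N)"
    if "h \<in> borel_measurable N" for h :: "'p \<Rightarrow> 'c::{banach, second_countable_topology}" and k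
    unfolding Nk_def using that by (subst integral_density) auto
  have ev: "eventually (\<lambda>k. p \<in> B k) sequentially" if "p \<in> (\<Union>k. B k)" for p
    using that Binc unfolding eventually_sequentially incseq_def by blast
  have lim_int: "(\<lambda>k. \<integral>p. indicator A (\<tau> p) *\<^sub>R g p \<partial>Nk k) \<longlonglongrightarrow> (\<integral>p. indicator A (\<tau> p) *\<^sub>R g p \<partial>N)"
    if [measurable]: "A \<in> sets borel" for A
  proof -
    have "(\<lambda>k. \<integral>p. indicator (B k) p *\<^sub>R (indicator A (\<tau> p) *\<^sub>R g p) \<partial>N) \<longlonglongrightarrow> (\<integral>p. indicator A (\<tau> p) *\<^sub>R g p \<partial>N)"
    proof (rule integral_dominated_convergence[where w="\<lambda>p. norm (g p)"])
      show "AE p in N. (\<lambda>k. indicator (B k) p *\<^sub>R indicator A (\<tau> p) *\<^sub>R g p) \<longlonglongrightarrow> indicator A (\<tau> p) *\<^sub>R g p"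
        using Bcov
      proof eventually_elim
        case (elim p)
        then show ?case
          by (intro tendsto_eventually) (use ev[OF elim] in \<open>auto elim: eventually_mono\<close>)
      qed
    qed (use g in \<open>auto simp: indicator_def\<close>)
    then show ?thesis by (subst intN) auto
  qed
  define Zpk where "Zpk k = finite_jump_path.Zp (Nk k) \<tau> g z0" for k
  define Zmk where "Zmk k = finite_jump_path.Zm (Nk k) \<tau> g z0" for k
  define Xk where "Xk k = finite_jump_path.Xp (Nk k) \<tau> g x0 z0" for k
  define Jk where "Jk k = finite_jump_path.jump (Nk k) \<tau> g x0 z0 \<psi>" for k
  have Cb: "norm (Zpk k u) \<le> C" "norm (Zmk k u) \<le> C" for k u
  proof -
    interpret K: finite_jump_path "Nk k" \<tau> g x0 z0 \<psi> D by (rule fjp)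
    have *: "norm (\<integral>p. indicator A (\<tau> p) *\<^sub>R g p \<partial>Nk k) \<le> (\<integral>p. norm (g p) \<partial>N)"
      if [measurable]: "A \<in> sets borel" for A
    proof -
      have "norm (\<integral>p. indicator (B k) p *\<^sub>R indicator A (\<tau> p) *\<^sub>R g p \<partial>N) \<le> (\<integral>p. norm (g p) \<partial>N)"
      proof (rule order_trans[OF integral_norm_bound], rule integral_mono)
        show "integrable N (\<lambda>p. norm (indicator (B k) p *\<^sub>R indicator A (\<tau> p) *\<^sub>R g p))"
          by (rule integrable_norm, rule Bochner_Integration.integrable_bound[OF g]) (auto simp: indicator_def)
      qed (use g in \<open>auto simp: indicator_def\<close>)
      then show ?thesis by (subst intN) auto
    qed
    show "norm (Zpk k u) \<le> C" "norm (Zmk k u) \<le> C"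
      unfolding Zpk_def Zmk_def K.Zp_def K.Zm_def C_def
      by (intro order_trans[OF norm_triangle_ineq] add_left_mono *; simp)+
  qed
  have Zpk: "(\<lambda>k. Zpk k u) \<longlonglongrightarrow> Z u" if "0 \<le> u" "u \<le> t" for u
    unfolding Zpk_def finite_jump_path.Zp_def[OF fjp] Z[OF that] by (intro tendsto_intros lim_int) auto
  have Zmk: "(\<lambda>k. Zmk k u) \<longlonglongrightarrow> Zm u" if "0 < u" "u \<le> t" for u
    unfolding Zmk_def finite_jump_path.Zm_def[OF fjp] Zm[OF that] by (intro tendsto_intros lim_int) auto
  have Xk: "(\<lambda>k. Xk k u) \<longlonglongrightarrow> X u" if u: "0 \<le> u" "u \<le> t" for u
  proof -
    have "(\<lambda>k. integral {0..u} (Zpk k)) \<longlonglongrightarrow> integral {0..u} Z"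
    proof (rule dominated_convergence(2)[where h="\<lambda>_. C"])
      show "Zpk k integrable_on {0..u}" for k
        unfolding Zpk_def by (rule finite_jump_path.Zp_int[OF fjp])
    qed (use Cb Zpk u in auto)
    then show ?thesis
      unfolding Xk_def finite_jump_path.Xp_eq[OF fjp] X[OF u] Zpk_def by (intro tendsto_intros)
  qed
  have ito: "((\<lambda>s. D (Xk k s, Zmk k s) (Zmk k s, 0)) has_integral
       (\<psi> (Xk k t, Zpk k t) - \<psi> (x0, z0) - (\<integral>p. indicator (B k) p *\<^sub>R (indicator {0<..t} (\<tau> p) * Jk k p) \<partial>N))) {0..t}" for k
  proof -
    interpret K: finite_jump_path "Nk k" \<tau> g x0 z0 \<psi> D by (rule fjp)
    have [measurable]: "Jk k \<in> borel_measurable N"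
      using K.jump_meas unfolding Jk_def by (simp add: Nk_def)
    obtain n where n: "n > 0" "\<And>i. i < n \<Longrightarrow> one_atom N (B k \<inter> {p\<in>space N. t * real i / real n < \<tau> p \<and> \<tau> p \<le> t * real (Suc i) / real n})"
      using one by blast
    have "one_atom (Nk k) {p\<in>space (Nk k). t * real i / real n < \<tau> p \<and> \<tau> p \<le> t * real (Suc i) / real n}"
      if "i < n" for i
      unfolding Nk_def space_density by (intro one_atom_density n(2) that) auto
    from K.finite_ito[OF t n(1) this] show ?thesis
      unfolding Xk_def Zpk_def Zmk_def Jk_def by (subst intN[symmetric]) (auto simp: Jk_def[symmetric])
  qed
  have \<psi>_cont: "continuous_on UNIV \<psi>"
    by (intro continuous_at_imp_continuous_on ballI has_derivative_continuous[OF deriv])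
  have JB: "\<bar>Jk k p\<bar> \<le> L * norm (g p)" for k p
  proof -
    interpret K: finite_jump_path "Nk k" \<tau> g x0 z0 \<psi> D by (rule fjp)
    show ?thesis unfolding Jk_def K.jump_def by (rule order_trans[OF lip]) (simp add: norm_Pair)
  qed
  have Jlim: "(\<lambda>k. indicator (B k) p *\<^sub>R (indicator {0<..t} (\<tau> p) * Jk k p)) \<longlonglongrightarrow> jump t \<psi> p"
    if p: "p \<in> (\<Union>k. B k)" for p
  proof (cases "0 < \<tau> p \<and> \<tau> p \<le> t")
    case True
    then have "(\<lambda>k. \<psi> (Xk k (\<tau> p), Zmk k (\<tau> p) + g p) - \<psi> (Xk k (\<tau> p), Zmk k (\<tau> p))) \<longlonglongrightarrow>
       \<psi> (X (\<tau> p), Zm (\<tau> p) + g p) - \<psi> (X (\<tau> p), Zm (\<tau> p))"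
      by (intro tendsto_diff continuous_on_tendsto_compose[OF \<psi>_cont] tendsto_Pair tendsto_add Xk Zmk) auto
    then have "(\<lambda>k. Jk k p) \<longlonglongrightarrow> jump t \<psi> p"
      using True unfolding Jk_def finite_jump_path.jump_def[OF fjp] jump_def Xk_def Zmk_def by simp
    then show ?thesis
      by (rule Lim_transform_eventually) (use ev[OF p] True in \<open>auto elim: eventually_mono\<close>)
  qed (auto simp: jump_def)
  have Jk_meas [measurable]: "Jk k \<in> borel_measurable N" for k
    using finite_jump_path.jump_meas[OF fjp[of k]] unfolding Jk_def by (simp add: Nk_def)
  have ALim: "AE p in N. (\<lambda>k. indicator (B k) p *\<^sub>R (indicator {0<..t} (\<tau> p) * Jk k p)) \<longlonglongrightarrow> jump t \<psi> p"
    using Bcov by eventually_elim (rule Jlim)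
  have JB': "AE p in N. norm (indicator (B k) p *\<^sub>R (indicator {0<..t} (\<tau> p) * Jk k p)) \<le> L * norm (g p)" for k
    using JB L0 by (auto simp: indicator_def)
  have gL: "integrable N (\<lambda>p. L * norm (g p))" using g by auto
  show "integrable N (jump t \<psi>)"
    using JB' by (intro integrable_dominated_convergence[OF jump_meas _ gL ALim]) auto
  have Jint: "(\<lambda>k. \<integral>p. indicator (B k) p *\<^sub>R (indicator {0<..t} (\<tau> p) * Jk k p) \<partial>N) \<longlonglongrightarrow> (\<integral>p. jump t \<psi> p \<partial>N)"
    using JB' by (intro integral_dominated_convergence[OF jump_meas _ gL ALim]) auto
  \<comment> \<open>The hypothesis on \<open>Zm\<close> says nothing at time 0, so the integrands
    need not converge there; both are set to 0 at this point.\<close>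
  define dr where "dr s = (if s = 0 then 0 else D (X s, Zm s) (Zm s, 0))" for s
  define drk where "drk k s = (if s = 0 then 0 else D (Xk k s, Zmk k s) (Zmk k s, 0))" for k s
  have drk: "(drk k has_integral (\<psi> (Xk k t, Zpk k t) - \<psi> (x0, z0) - (\<integral>p. indicator (B k) p *\<^sub>R (indicator {0<..t} (\<tau> p) * Jk k p) \<partial>N))) {0..t}" for k
    by (subst has_integral_spike_finite_eq[where S="{0}" and g="\<lambda>s. D (Xk k s, Zmk k s) (Zmk k s, 0)"])
       (use ito[of k] in \<open>auto simp: drk_def\<close>)
  have drk_bound: "norm (drk k s) \<le> L * C" for k s
  proof -
    have "norm (D (Xk k s, Zmk k s) (Zmk k s, 0)) \<le> norm (D (Xk k s, Zmk k s)) * norm (Zmk k s, 0::'a)"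
      by (rule norm_blinfun)
    also have "\<dots> \<le> L * C"
      using D_bound Cb L0 by (intro mult_mono) (auto simp: norm_Pair)
    finally show ?thesis using L0 order_trans[OF norm_ge_zero Cb(1)] unfolding drk_def by auto
  qed
  have drlim: "(\<lambda>k. drk k s) \<longlonglongrightarrow> dr s" if "s \<in> {0..t}" for s
  proof (cases "s = 0")
    case False
    with that have s: "0 < s" "s \<le> t" "0 \<le> s" by auto
    show ?thesis
      using False unfolding drk_def dr_def
      by (auto intro!: tendsto_intros continuous_on_tendsto_compose[OF D_cont] Xk Zmk s)
  qed (auto simp: drk_def dr_def)
  have i: "drk k integrable_on {0..t}" for k using drk by blast
  have DC: "dr integrable_on {0..t}" "(\<lambda>k. integral {0..t} (drk k)) \<longlonglongrightarrow> integral {0..t} dr"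
    using dominated_convergence[where f=drk and h="\<lambda>_. L * C" and S="{0..t}" and g=dr, OF i] drk_bound drlim by auto
  have "(\<lambda>k. integral {0..t} (drk k)) \<longlonglongrightarrow> \<psi> (X t, Z t) - \<psi> (x0, z0) - (\<integral>p. jump t \<psi> p \<partial>N)"
    unfolding integral_unique[OF drk] using t
    by (intro tendsto_diff Jint tendsto_const continuous_on_tendsto_compose[OF \<psi>_cont] tendsto_Pair Xk Zpk) auto
  with DC have "(dr has_integral (\<psi> (X t, Z t) - \<psi> (x0, z0) - (\<integral>p. jump t \<psi> p \<partial>N))) {0..t}"
    using LIMSEQ_unique by (metis has_integral_integral)
  then show "((\<lambda>s. D (X s, Zm s) (Zm s, 0)) has_integral
       (\<psi> (X t, Z t) - \<psi> (x0, z0) - (\<integral>p. jump t \<psi> p \<partial>N))) {0..t}"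
    by (subst has_integral_spike_finite_eq[where S="{0}" and g=dr]) (auto simp: dr_def)
qed

section \<open>Adapted Poisson random measures\<close>

lemma poisson_mean_sums:
  "(\<lambda>k. real k * (exp (- l) * l ^ k / fact k)) sums l"
proof -
  have "(\<lambda>k. l ^ k /\<^sub>R fact k) sums exp l" by (rule exp_converges)
  then have "(\<lambda>k. (l * exp (-l)) * (l ^ k /\<^sub>R fact k)) sums ((l * exp (-l)) * exp l)"
    by (rule sums_mult)
  moreover have "(l * exp (-l)) * exp l = l" by (simp add: exp_minus)
  moreover have "(l * exp (-l)) * (l ^ k /\<^sub>R fact k) = real (Suc k) * (exp (- l) * l ^ Suc k / fact (Suc k))" for k
    by (simp add: divide_simps)
  ultimately have "(\<lambda>k. real (Suc k) * (exp (- l) * l ^ Suc k / fact (Suc k))) sums l" by simp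
  \<comment> \<open>The term for \<open>k = 0\<close> vanishes, so shifting the index back leaves
    the sum unchanged.\<close>
  then show ?thesis by (subst (asm) sums_Suc_iff) simp
qed

lemma poisson_total_sums: "(\<lambda>k. exp (- l) * l ^ k / fact k) sums (1::real)"
proof -
  have "(\<lambda>k. exp (- l) * (l ^ k /\<^sub>R fact k)) sums (exp (- l) * exp l)"
    by (intro sums_mult exp_converges)
  moreover have "exp (- l) * exp l = 1" by (simp add: exp_minus)
  moreover have "exp (- l) * (l ^ k /\<^sub>R fact k) = exp (- l) * l ^ k / fact k" for k
    by (simp add: field_simps)
  ultimately show ?thesis by simp
qed

abbreviation "tm p \<equiv> snd (snd (snd (snd p)))" for p :: noise_pt

lemma measurable_time_slab:
  assumes "A \<in> sets borel" "S \<in> sets borel"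
  shows "time_slab A S \<in> sets borel"
proof -
  have "(\<lambda>p::noise_pt. (fst p, fst (snd p), fst (snd (snd p)), fst (snd (snd (snd p))))) \<in> borel_measurable borel"
    "(\<lambda>p::noise_pt. snd (snd (snd (snd p)))) \<in> borel_measurable borel"
    by (intro borel_measurable_continuous_onI continuous_intros)+
  note this[THEN measurable_sets]
  from this(1)[OF assms(1)] this(2)[OF assms(2)]
  have "((\<lambda>p::noise_pt. (fst p, fst (snd p), fst (snd (snd p)), fst (snd (snd (snd p))))) -` A \<inter> space borel)
     \<inter> ((\<lambda>p::noise_pt. snd (snd (snd (snd p)))) -` S \<inter> space borel) \<in> sets borel" by (rule sets.Int)
  moreover have "time_slab A S = ((\<lambda>p::noise_pt. (fst p, fst (snd p), fst (snd (snd p)), fst (snd (snd (snd p))))) -` A \<inter> space borel)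
     \<inter> ((\<lambda>p::noise_pt. snd (snd (snd (snd p)))) -` S \<inter> space borel)" by (auto simp: time_slab_def)
  ultimately show ?thesis by simp
qed

text \<open>The \<open>A k\<close> are sets of marks hit at a finite rate. Linearity of
  \<open>slab_bound\<close> in the length of the time interval makes two atoms in a short slab
  improbable to second order. \<open>A_cov\<close> uses times after 0, so almost no noise sits at
  time 0.\<close>

locale poisson_noise =
  fixes M :: "'w measure" and F :: "real \<Rightarrow> 'w measure" and T :: real
    and \<nu> :: "noise_pt measure" and N :: "'w \<Rightarrow> noise_pt measure"
    and A :: "nat \<Rightarrow> (vec3 \<times> real \<times> real \<times> real) set" and c :: "nat \<Rightarrow> real"
  assumes basis: "stochastic_basis M F T"
    and PRM: "adapted_PRM M F T \<nu> N"
    and sets_\<nu>: "sets \<nu> = sets borel"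
    and T: "0 < T"
    and A [measurable]: "\<And>k. A k \<in> sets borel" and A_inc: "incseq A"
    and slab_bound: "\<And>k s t. 0 \<le> s \<Longrightarrow> s \<le> t \<Longrightarrow> t \<le> T \<Longrightarrow>
        emeasure \<nu> (time_slab (A k) {s<..t}) \<le> ennreal (c k * (t - s))"
    and A_cov: "AE p in \<nu>. p \<in> (\<Union>k. time_slab (A k) {0<..T})"
begin

sublocale prob_space M using basis unfolding stochastic_basis_def by simp

definition "B k = time_slab (A k) {0<..T}"

lemma F_sub: "t \<in> {0..T} \<Longrightarrow> subalgebra M (F t)"
  using basis unfolding stochastic_basis_def by simp

lemma F_mono: "0 \<le> s \<Longrightarrow> s \<le> t \<Longrightarrow> t \<le> T \<Longrightarrow> sets (F s) \<subseteq> sets (F t)"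
  using basis unfolding stochastic_basis_def by simp

lemma F_sets: "E \<in> sets (F s) \<Longrightarrow> 0 \<le> s \<Longrightarrow> s \<le> T \<Longrightarrow> E \<in> sets M"
  using F_sub[of s] unfolding subalgebra_def by auto

lemma F_space: "0 \<le> s \<Longrightarrow> s \<le> T \<Longrightarrow> space (F s) = space M"
  using F_sub[of s] unfolding subalgebra_def by auto

lemma sets_N: "\<omega> \<in> space M \<Longrightarrow> sets (N \<omega>) = sets borel"
  using PRM sets_\<nu> unfolding adapted_PRM_def by simp

lemma N_meas [measurable]: "S \<in> sets borel \<Longrightarrow> (\<lambda>\<omega>. emeasure (N \<omega>) S) \<in> borel_measurable M"
  using PRM sets_\<nu> unfolding adapted_PRM_def by simp

lemma N_poisson:
  "S \<in> sets borel \<Longrightarrow> emeasure \<nu> S < \<infinity> \<Longrightarrow> prob {\<omega>\<in>space M. emeasure (N \<omega>) S = of_nat k}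
           = exp (- enn2real (emeasure \<nu> S)) * enn2real (emeasure \<nu> S) ^ k / fact k"
  using PRM sets_\<nu> unfolding adapted_PRM_def by simp

lemma N_indep:
  assumes "S \<in> sets borel" "0 \<le> s" "s \<le> t" "t \<le> T" "E \<in> sets (F s)" "C \<in> sets borel"
  shows "prob (E \<inter> {\<omega>\<in>space M. emeasure (N \<omega>) (time_slab S {s<..t}) \<in> C})
    = prob E * prob {\<omega>\<in>space M. emeasure (N \<omega>) (time_slab S {s<..t}) \<in> C}"
proof -
  have "time_slab S {s<..t} \<in> sets \<nu>" using assms sets_\<nu> measurable_time_slab by auto
  then show ?thesis
    using PRM assms unfolding adapted_PRM_def by blast
qed

text \<open>The Poisson weights add up to 1, so no probability is left for non-integer or infinite
  values.\<close>

lemma N_integer: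
  assumes S [measurable]: "S \<in> sets borel" and fin: "emeasure \<nu> S < \<infinity>"
  shows "AE \<omega> in M. \<exists>k::nat. emeasure (N \<omega>) S = of_nat k"
proof -
  define E where "E k = {\<omega>\<in>space M. emeasure (N \<omega>) S = of_nat k}" for k :: nat
  have E [measurable]: "E k \<in> sets M" for k unfolding E_def by measurable
  have "(\<lambda>k. prob (E k)) sums prob (\<Union>k. E k)"
    by (rule finite_measure_UNION) (auto simp: E_def disjoint_family_on_def)
  moreover have "(\<lambda>k. prob (E k)) sums 1"
    unfolding E_def N_poisson[OF S fin] by (rule poisson_total_sums)
  ultimately have "prob (\<Union>k. E k) = 1" by (rule sums_unique2)
  then have "AE \<omega> in M. \<omega> \<in> (\<Union>k. E k)" by (rule AE_prob_1)
  then show ?thesis by eventually_elim (auto simp: E_def)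
qed

text \<open>The mean is a sum over \<open>k\<close> of \<open>k\<close> times the probability of
  \<open>E\<close> together with the event that the mass of \<open>S\<close> is \<open>k\<close>.
  Independence splits off \<open>prob E\<close>, and the Poisson mean remains.\<close>

lemma mean_of_independent:
  assumes S [measurable]: "S \<in> sets borel" and fin: "emeasure \<nu> S < \<infinity>" and E [measurable]: "E \<in> sets M"
    and indep: "\<And>C. C \<in> sets borel \<Longrightarrow> prob (E \<inter> {\<omega>\<in>space M. emeasure (N \<omega>) S \<in> C})
       = prob E * prob {\<omega>\<in>space M. emeasure (N \<omega>) S \<in> C}"
  shows "(\<integral>\<^sup>+\<omega>. indicator E \<omega> * emeasure (N \<omega>) S \<partial>M) = emeasure M E * emeasure \<nu> S"
proof -
  define l where "l = enn2real (emeasure \<nu> S)"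
  have l: "emeasure \<nu> S = ennreal l" "0 \<le> l" using fin unfolding l_def by auto
  define Ek where "Ek k = E \<inter> {\<omega>\<in>space M. emeasure (N \<omega>) S = of_nat k}" for k :: nat
  have Ek [measurable]: "Ek k \<in> sets M" for k unfolding Ek_def by measurable
  have pk: "prob (Ek k) = prob E * (exp (- l) * l ^ k / fact k)" for k
    using indep[of "{of_nat k}"] N_poisson[OF S fin, of k] unfolding Ek_def l_def by simp
  have "(\<integral>\<^sup>+\<omega>. indicator E \<omega> * emeasure (N \<omega>) S \<partial>M) = (\<integral>\<^sup>+\<omega>. (\<Sum>k. of_nat k * indicator (Ek k) \<omega>) \<partial>M)"
  proof (rule nn_integral_cong_AE)
    show "AE \<omega> in M. indicator E \<omega> * emeasure (N \<omega>) S = (\<Sum>k. of_nat k * indicator (Ek k) \<omega>)"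
      using N_integer[OF S fin] AE_space
    proof eventually_elim
      case (elim \<omega>)
      then obtain j :: nat where j: "emeasure (N \<omega>) S = of_nat j" by auto
      have "(\<Sum>k. of_nat k * indicator (Ek k) \<omega>) = (\<Sum>k\<in>{j}. of_nat k * indicator (Ek k) \<omega> :: ennreal)"
        by (rule suminf_finite) (auto simp: Ek_def j indicator_def)
      then show ?case using j elim by (auto simp: Ek_def indicator_def)
    qed
  qed
  also have "\<dots> = (\<Sum>k. \<integral>\<^sup>+\<omega>. of_nat k * indicator (Ek k) \<omega> \<partial>M)"
    by (rule nn_integral_suminf) auto
  also have "\<dots> = (\<Sum>k. ennreal (prob E * (real k * (exp (- l) * l ^ k / fact k))))"
  proof (rule suminf_cong)
    fix k
    have "(\<integral>\<^sup>+\<omega>. of_nat k * indicator (Ek k) \<omega> \<partial>M) = of_nat k * emeasure M (Ek k)"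
      by (rule nn_integral_cmult_indicator) auto
    also have "\<dots> = ennreal (real k * prob (Ek k))"
      by (simp add: emeasure_eq_measure ennreal_mult ennreal_of_nat_eq_real_of_nat)
    finally show "(\<integral>\<^sup>+\<omega>. of_nat k * indicator (Ek k) \<omega> \<partial>M) = ennreal (prob E * (real k * (exp (- l) * l ^ k / fact k)))"
      unfolding pk by (simp add: mult_ac)
  qed
  also have "\<dots> = ennreal (prob E * l)"
    using l(2) by (intro suminf_ennreal_eq sums_mult poisson_mean_sums) auto
  finally show ?thesis using l by (simp add: emeasure_eq_measure ennreal_mult)
qed

lemma mean_N:
  assumes S [measurable]: "S \<in> sets borel" and fin: "emeasure \<nu> S < \<infinity>"
  shows "(\<integral>\<^sup>+\<omega>. emeasure (N \<omega>) S \<partial>M) = emeasure \<nu> S"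
proof -
  have "(\<integral>\<^sup>+\<omega>. indicator (space M) \<omega> * emeasure (N \<omega>) S \<partial>M) = emeasure M (space M) * emeasure \<nu> S"
  proof (rule mean_of_independent[OF S fin])
    fix C :: "ennreal set" assume "C \<in> sets borel"
    have "space M \<inter> {\<omega>\<in>space M. emeasure (N \<omega>) S \<in> C} = {\<omega>\<in>space M. emeasure (N \<omega>) S \<in> C}" by auto
    then show "prob (space M \<inter> {\<omega>\<in>space M. emeasure (N \<omega>) S \<in> C})
       = prob (space M) * prob {\<omega>\<in>space M. emeasure (N \<omega>) S \<in> C}"
      by (simp add: prob_space)
  qed auto
  moreover have "(\<integral>\<^sup>+\<omega>. indicator (space M) \<omega> * emeasure (N \<omega>) S \<partial>M) = (\<integral>\<^sup>+\<omega>. emeasure (N \<omega>) S \<partial>M)"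
    by (rule nn_integral_cong) (auto simp: indicator_def)
  ultimately show ?thesis by (simp add: emeasure_space_1)
qed

lemma N_null:
  assumes S [measurable]: "S \<in> sets borel" and "emeasure \<nu> S = 0"
  shows "AE \<omega> in M. emeasure (N \<omega>) S = 0"
  using mean_N[OF S] assms(2) nn_integral_0_iff_AE[OF N_meas[OF S]] by simp

text \<open>Noise strictly after \<open>s\<close> is independent of events known at
  \<open>s\<close>. This is the compensation formula on one predictable rectangle.\<close>

lemma mean_slab:
  assumes E: "E \<in> sets (F s)" and st: "0 \<le> s" "s \<le> t" "t \<le> T" and S: "S \<in> sets borel"
    and fin: "emeasure \<nu> (time_slab S {s<..t}) < \<infinity>"
  shows "(\<integral>\<^sup>+\<omega>. indicator E \<omega> * emeasure (N \<omega>) (time_slab S {s<..t}) \<partial>M)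
    = emeasure M E * emeasure \<nu> (time_slab S {s<..t})"
  using st S by (intro mean_of_independent[OF _ fin] N_indep E F_sets[OF E] measurable_time_slab) auto

section \<open>At most one atom per short time slab\<close>

lemma N_ge_2:
  assumes S [measurable]: "S \<in> sets borel" and l: "emeasure \<nu> S \<le> ennreal l" "0 \<le> l"
  shows "prob {\<omega>\<in>space M. 1 < emeasure (N \<omega>) S} \<le> l\<^sup>2"
proof -
  have fin: "emeasure \<nu> S < \<infinity>" using l(1) by (auto simp: less_top[symmetric] top_unique)
  define r where "r = enn2real (emeasure \<nu> S)"
  have r: "0 \<le> r" "r \<le> l" using l unfolding r_def by (auto simp: enn2real_leI)
  define E where "E k = {\<omega>\<in>space M. emeasure (N \<omega>) S = of_nat k}" for k :: nat
  have E [measurable]: "E k \<in> sets M" for k unfolding E_def by measurable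
  have "prob {\<omega>\<in>space M. 1 < emeasure (N \<omega>) S} \<le> prob (space M - (E 0 \<union> E 1))"
    by (rule finite_measure_mono) (auto simp: E_def)
  also have "\<dots> = 1 - (prob (E 0) + prob (E 1))"
  proof -
    have "E 0 \<inter> E 1 = {}" by (auto simp: E_def)
    then have "prob (E 0 \<union> E 1) = prob (E 0) + prob (E 1)" by (intro finite_measure_Union E)
    then show ?thesis by (subst prob_compl) auto
  qed
  also have "\<dots> = 1 - (1 + r) * exp (- r)"
    using N_poisson[OF S fin, of 0] N_poisson[OF S fin, of 1] unfolding E_def r_def by (simp add: algebra_simps)
  \<comment> \<open>\<open>exp (- r) \<ge> 1 - r\<close> turns the Poisson tail into a term of
    second order in the mean.\<close>
  also have "\<dots> \<le> 1 - (1 + r) * (1 - r)"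
    using exp_ge_add_one_self[of "- r"] r by (intro diff_mono mult_left_mono) auto
  also have "\<dots> = r\<^sup>2" by (simp add: algebra_simps power2_eq_square)
  also have "\<dots> \<le> l\<^sup>2" using r by (intro power_mono) auto
  finally show ?thesis .
qed

lemma B_meas [measurable]: "B k \<in> sets borel"
  unfolding B_def by (intro measurable_time_slab) auto

lemma B_fin: "emeasure \<nu> (B k) < \<infinity>"
  using slab_bound[of 0 T k] T unfolding B_def by (auto simp: less_top[symmetric] top_unique)

lemma B_inc: "incseq B"
  using A_inc unfolding B_def time_slab_def incseq_def by fastforce

text \<open>The locale leaves the sign of \<open>c k\<close> open, whereas \<open>N_ge_2\<close>
  asks for a nonnegative bound.\<close>

lemma c_nonneg: "0 \<le> s \<Longrightarrow> s \<le> t \<Longrightarrow> t \<le> T \<Longrightarrow> 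
    emeasure \<nu> (time_slab (A k) {s<..t}) \<le> ennreal (max 0 (c k) * (t - s))"
  by (rule order_trans[OF slab_bound]) (auto intro!: ennreal_leI mult_right_mono)

text \<open>A slab of length \<open>t/n\<close> carries two atoms with probability at most \<open>(C/n)\<^sup>2\<close>, so some one of
  the \<open>n\<close> slabs does with probability at most \<open>C\<^sup>2/n\<close>.\<close>

lemma separating_partition:
  assumes t: "0 \<le> t" "t \<le> T"
  shows "AE \<omega> in M. \<exists>n>0. \<forall>i<n. emeasure (N \<omega>) (time_slab (A k) {t * real i / real n<..t * real (Suc i) / real n}) \<le> 1"
proof -
  define S where "S n i = time_slab (A k) {t * real i / real n<..t * real (Suc i) / real n}" for n i
  have S [measurable]: "S n i \<in> sets borel" for n i unfolding S_def by (intro measurable_time_slab) auto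
  define C where "C = max 0 (c k) * t"
  have C: "0 \<le> C" unfolding C_def using t by auto
  have Sb: "emeasure \<nu> (S n i) \<le> ennreal (C / n)" if "i < n" for n i
  proof -
    have "t * real (Suc i) / real n \<le> t * real n / real n"
      using that t by (intro divide_right_mono mult_left_mono) auto
    then have "emeasure \<nu> (S n i) \<le> ennreal (max 0 (c k) * (t * real (Suc i) / real n - t * real i / real n))"
      unfolding S_def using that t by (intro c_nonneg) (auto intro!: divide_right_mono mult_left_mono)
    also have "max 0 (c k) * (t * real (Suc i) / real n - t * real i / real n) = C / n"
      unfolding C_def using that by (simp add: diff_divide_distrib[symmetric] algebra_simps)
    finally show ?thesis .
  qed
  define bad where "bad n = (\<Union>i<n. {\<omega>\<in>space M. 1 < emeasure (N \<omega>) (S n i)})" for n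
  have bad_meas [measurable]: "bad n \<in> sets M" for n unfolding bad_def by measurable
  have bad: "prob (bad n) \<le> C\<^sup>2 / n" if "0 < n" for n
  proof -
    have "prob (bad n) \<le> (\<Sum>i<n. prob {\<omega>\<in>space M. 1 < emeasure (N \<omega>) (S n i)})"
      unfolding bad_def by (intro finite_measure_subadditive_finite) auto
    also have "\<dots> \<le> (\<Sum>i<n. (C / n)\<^sup>2)"
      using C by (intro sum_mono N_ge_2 Sb) auto
    also have "\<dots> = C\<^sup>2 / n" using that by (simp add: power2_eq_square)
    finally show ?thesis .
  qed
  define always where "always = (\<Inter>n\<in>{0<..}. bad n)"
  have am [measurable]: "always \<in> sets M" unfolding always_def by (intro sets.countable_INT') auto
  have "prob always \<le> C\<^sup>2 * inverse (real (Suc n))" for n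
  proof -
    have "prob always \<le> prob (bad (Suc n))"
      unfolding always_def by (intro finite_measure_mono) auto
    with bad[of "Suc n"] show ?thesis by (simp add: divide_inverse)
  qed
  moreover have "(\<lambda>n. C\<^sup>2 * inverse (real (Suc n))) \<longlonglongrightarrow> C\<^sup>2 * 0"
    by (intro tendsto_intros LIMSEQ_inverse_real_of_nat)
  ultimately have "prob always \<le> 0" using LIMSEQ_le_const by fastforce
  then have "always \<in> null_sets M" by (auto simp: emeasure_eq_measure measure_le_0_iff)
  then have "AE \<omega> in M. \<omega> \<notin> always" by (rule AE_not_in)
  then show ?thesis using AE_space
  proof eventually_elim
    case (elim \<omega>)
    then obtain n where "n > 0" "\<omega> \<notin> bad n" unfolding always_def by auto
    then show ?case using elim unfolding bad_def S_def by (auto simp: not_less intro!: exI[of _ n])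
  qed
qed

text \<open>The mass of a given set is an integer only almost surely, so integrality is arranged for
  countably many sets at once: all slabs, intersected with all members of a countable basis. A slab
  of mass at most 1 then takes only the values 0 and 1 on the basis, and
  \<open>zero_one_measure_atom\<close> yields its atom.\<close>

lemma one_atom_partition:
  assumes t: "0 \<le> t" "t \<le> T"
  shows "AE \<omega> in M. \<forall>k. \<exists>n>0. \<forall>i<n. one_atom (N \<omega>) (time_slab (A k) {t * real i / real n<..t * real (Suc i) / real n})"
proof -
  define S where "S k n i = time_slab (A k) {t * real i / real n<..t * real (Suc i) / real n}" for k n i
  have S [measurable]: "S k n i \<in> sets borel" for k n i unfolding S_def by (intro measurable_time_slab) auto
  obtain \<U> :: "noise_pt set set" where \<U>: "countable \<U>" "topological_basis \<U>"
    using ex_countable_basis by blast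
  have Um: "U \<in> sets borel" if "U \<in> \<U>" for U
    using topological_basis_open[OF \<U>(2) that] by auto
  have fin: "emeasure \<nu> (S k n i \<inter> U) < \<infinity>" if "U \<in> sets borel" "i < n" for k n i U
  proof -
    have "t * real (Suc i) / real n \<le> t * real n / real n"
      using that t by (intro divide_right_mono mult_left_mono) auto
    then have "t * real (Suc i) / real n \<le> t" using that by auto
    then have "x \<le> T" if "x \<le> t * real (Suc i) / real n" for x
      using that t by linarith
    moreover have "0 < x" if "t * real i / real n < x" for x
      using that t by (intro le_less_trans[OF _ that]) auto
    ultimately have "S k n i \<subseteq> B k"
      unfolding S_def B_def time_slab_def using t by auto
    then have "emeasure \<nu> (S k n i \<inter> U) \<le> emeasure \<nu> (B k)"
      using sets_\<nu> that by (intro emeasure_mono) auto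
    then show ?thesis using B_fin[of k] by (rule le_less_trans)
  qed
  \<comment> \<open>\<open>UNIV\<close> joins the basis so that the mass of the whole slab is
    covered too.\<close>
  have int: "AE \<omega> in M. \<forall>k n. \<forall>i\<in>{..<n}. \<forall>U\<in>insert UNIV \<U>. \<exists>j::nat. emeasure (N \<omega>) (S k n i \<inter> U) = of_nat j"
    using \<U>(1) Um fin fin[of UNIV] by (intro AE_all_countable[THEN iffD2] allI AE_ball_countable[THEN iffD2] ballI N_integer) auto
  have "AE \<omega> in M. \<forall>k. \<exists>n>0. \<forall>i<n. emeasure (N \<omega>) (S k n i) \<le> 1"
    unfolding AE_all_countable S_def using separating_partition[OF t] by auto
  then show ?thesis using int AE_space
  proof eventually_elim
    case (elim \<omega>)
    have sN: "sets (N \<omega>) = sets borel" using sets_N elim by auto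
    have "one_atom (N \<omega>) (S k n i)" if i: "i < n" and le: "emeasure (N \<omega>) (S k n i) \<le> 1" for k n i
    proof -
      have zo: "emeasure (N \<omega>) (S k n i \<inter> U) \<in> {0, 1}" if U: "U \<in> insert UNIV \<U>" for U
      proof -
        obtain j :: nat where j: "emeasure (N \<omega>) (S k n i \<inter> U) = of_nat j"
          using elim(2) U i by blast
        have "emeasure (N \<omega>) (S k n i \<inter> U) \<le> emeasure (N \<omega>) (S k n i)"
          using sN by (intro emeasure_mono) auto
        then have "(of_nat j :: ennreal) \<le> of_nat 1" unfolding j using le by (simp only: of_nat_1)
        then have "j \<le> 1" by (simp only: of_nat_le_iff)
        then show ?thesis using j by (cases j) auto
      qed
      show ?thesis
      proof (cases "emeasure (N \<omega>) (S k n i) = 0")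
        case False
        with zo[of UNIV] have 1: "emeasure (N \<omega>) (S k n i) = 1" by auto
        obtain p where "p \<in> S k n i" "AE x in N \<omega>. x \<in> S k n i \<longrightarrow> x = p"
          by (rule zero_one_measure_atom[OF sN _ \<U>(2,1) 1]) (use zo sN in auto)
        with 1 show ?thesis unfolding one_atom_def by blast
      qed (simp add: one_atom_def)
    qed
    note atom = this
    show ?case unfolding S_def[symmetric]
    proof
      fix k
      obtain n where "n > 0" "\<And>i. i < n \<Longrightarrow> emeasure (N \<omega>) (S k n i) \<le> 1"
        using elim(1) by (metis (no_types))
      then show "\<exists>n>0. \<forall>i<n. one_atom (N \<omega>) (S k n i)"
        by (intro exI[of _ n] conjI allI impI atom)
    qed
  qed
qed

lemma AE_N_null:
  assumes "AE p in \<nu>. P p"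
  shows "AE \<omega> in M. AE p in N \<omega>. P p"
proof -
  obtain S where S: "{p\<in>space \<nu>. \<not> P p} \<subseteq> S" "emeasure \<nu> S = 0" "S \<in> sets \<nu>"
    using assms by (rule AE_E)
  then have "AE \<omega> in M. emeasure (N \<omega>) S = 0" using N_null sets_\<nu> by auto
  then show ?thesis using AE_space
  proof eventually_elim
    case (elim \<omega>)
    have "S \<in> null_sets (N \<omega>)" using elim S sets_N sets_\<nu> by auto
    moreover have "space \<nu> = space (N \<omega>)"
      using elim(2) sets_N sets_\<nu> by (intro sets_eq_imp_space_eq) auto
    ultimately show ?case using S(1) by (intro AE_I'[of S]) auto
  qed
qed

section \<open>Predictable sets and the compensation formula for them\<close>

definition "rects = {E \<times> time_slab S {s<..t} | E S s t.
    0 \<le> s \<and> s \<le> t \<and> t \<le> T \<and> E \<in> sets (F s) \<and> S \<in> sets borel}"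
text \<open>The predictable \<sigma>-algebra, with marks. All rectangles lie over times in
  \<open>(0,T]\<close>, so the points with other times form one inseparable block, on which a
  predictable real function is constant. This is why functions are set to 0 off
  \<open>time_slab UNIV {0<..T}\<close> below.\<close>

definition "Pm = sigma (space M \<times> UNIV) rects"

lemma rects_sub: "rects \<subseteq> sets (M \<Otimes>\<^sub>M borel)"
proof
  fix R assume "R \<in> rects"
  then obtain E S s t where R: "R = E \<times> time_slab S {s<..t}" "0 \<le> s" "s \<le> t" "t \<le> T" "E \<in> sets (F s)" "S \<in> sets borel"
    unfolding rects_def by auto
  then show "R \<in> sets (M \<Otimes>\<^sub>M borel)"
    using F_sets[of E s] measurable_time_slab[of S "{s<..t}"] by auto
qed

lemma rects_Pow: "rects \<subseteq> Pow (space M \<times> UNIV)"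
  using rects_sub sets.sets_into_space[of _ "M \<Otimes>\<^sub>M (borel :: noise_pt measure)"]
  by (auto simp: space_pair_measure dest!: subsetD)

lemma space_Pm [simp]: "space Pm = space M \<times> UNIV"
  unfolding Pm_def by (rule space_measure_of[OF rects_Pow])

lemma sets_Pm: "sets Pm = sigma_sets (space M \<times> UNIV) rects"
  unfolding Pm_def by (rule sets_measure_of[OF rects_Pow])

lemma sets_Pm_sub: "sets Pm \<subseteq> sets (M \<Otimes>\<^sub>M borel)"
  unfolding sets_Pm using sets.sigma_sets_subset[OF rects_sub] by (simp add: space_pair_measure)

lemma measurable_Pm_pair: "f \<in> measurable Pm K \<Longrightarrow> f \<in> measurable (M \<Otimes>\<^sub>M borel) K"
  using sets_Pm_sub by (auto simp: measurable_def space_pair_measure)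

text \<open>The filtration increases, so both events are known at the later of the two starting
  times, and left-open intervals intersect in a left-open interval.\<close>

lemma rects_Int_stable: "Int_stable rects"
proof (rule Int_stableI)
  fix a b assume "a \<in> rects" "b \<in> rects"
  then obtain E S s t E' S' s' t' where
    a: "a = E \<times> time_slab S {s<..t}" "0 \<le> s" "s \<le> t" "t \<le> T" "E \<in> sets (F s)" "S \<in> sets borel" and
    b: "b = E' \<times> time_slab S' {s'<..t'}" "0 \<le> s'" "s' \<le> t'" "t' \<le> T" "E' \<in> sets (F s')" "S' \<in> sets borel"
    unfolding rects_def by blast
  show "a \<inter> b \<in> rects"
  proof (cases "max s s' \<le> min t t'")
    case True
    have "a \<inter> b = (E \<inter> E') \<times> time_slab (S \<inter> S') {max s s'<..min t t'}"
      unfolding a b time_slab_def by auto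
    moreover have "E \<inter> E' \<in> sets (F (max s s'))"
      using a b True F_mono[of s "max s s'"] F_mono[of s' "max s s'"] by (intro sets.Int) auto
    moreover have "S \<inter> S' \<in> sets borel" using a b by auto
    moreover have "0 \<le> max s s'" "min t t' \<le> T" using a b by auto
    ultimately show ?thesis using True unfolding rects_def
      by (intro CollectI exI[of _ "E \<inter> E'"] exI[of _ "S \<inter> S'"] exI[of _ "max s s'"] exI[of _ "min t t'"]) simp
  next
    case False
    \<comment> \<open>The time intervals are disjoint; the empty set is itself a rectangle, over a
      degenerate interval.\<close>
    have "a \<inter> b = {} \<times> time_slab {} {0<..0}"
      using False unfolding a b time_slab_def by auto
    moreover have "{} \<times> time_slab {} {0<..0} \<in> rects"
      using T unfolding rects_def by (intro CollectI exI[of _ "{}"] exI[of _ "0::real"]) auto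
    ultimately show ?thesis by simp
  qed
qed

text \<open>\<open>N'\<close> equals \<open>N\<close> almost surely and is finite on every \<open>B k\<close> for every \<open>\<omega>\<close>, so that complements
  can be formed in the Dynkin argument without losing measurability.\<close>

definition "good \<omega> \<longleftrightarrow> \<omega> \<in> space M \<and> (\<forall>k. emeasure (N \<omega>) (B k) < \<infinity>) \<and> emeasure (N \<omega>) (- (\<Union>k. B k)) = 0"
definition "N' \<omega> = (if good \<omega> then N \<omega> else null_measure borel)"

lemma \<nu>_compl_B: "emeasure \<nu> (- (\<Union>k. B k)) = 0"
proof -
  have "- (\<Union>k. B k) \<in> sets \<nu>" unfolding sets_\<nu> by auto
  from AE_iff_measurable[OF this, of "\<lambda>p. p \<in> (\<Union>k. B k)"] show ?thesis
    using A_cov[folded B_def] sets_eq_imp_space_eq[OF sets_\<nu>] by auto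
qed

lemma AE_good: "AE \<omega> in M. good \<omega>"
proof -
  have 1: "AE \<omega> in M. \<forall>k. emeasure (N \<omega>) (B k) < \<infinity>"
    unfolding AE_all_countable
  proof
    fix k
    show "AE \<omega> in M. emeasure (N \<omega>) (B k) < \<infinity>"
      using N_integer[OF B_meas B_fin, of k] by eventually_elim (auto simp: of_nat_less_top)
  qed
  have "emeasure \<nu> (- (\<Union>k. B k)) = 0" by (rule \<nu>_compl_B)
  then have "AE \<omega> in M. emeasure (N \<omega>) (- (\<Union>k. B k)) = 0" by (intro N_null) auto
  with 1 AE_space show ?thesis by eventually_elim (auto simp: good_def)
qed

lemma sets_N' [simp]: "sets (N' \<omega>) = sets borel"
  unfolding N'_def good_def using sets_N by auto

lemma good_meas [measurable]: "Measurable.pred M good"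
proof -
  have [measurable]: "- (\<Union>k. B k) \<in> sets borel" by auto
  have "Measurable.pred M (\<lambda>\<omega>. (\<forall>k. emeasure (N \<omega>) (B k) < \<infinity>) \<and> emeasure (N \<omega>) (- (\<Union>k. B k)) = 0)"
    by measurable
  then show ?thesis by (rule measurable_cong[THEN iffD1, rotated]) (auto simp: good_def)
qed

lemma N'_meas [measurable]: "S \<in> sets borel \<Longrightarrow> (\<lambda>\<omega>. emeasure (N' \<omega>) S) \<in> borel_measurable M"
  unfolding N'_def by (subst if_distrib[of "\<lambda>m. emeasure m S"]) simp

lemma N'_B_fin: "emeasure (N' \<omega>) (B k) < \<infinity>"
  unfolding N'_def good_def by auto

lemma N'_eq: "AE \<omega> in M. N' \<omega> = N \<omega>"
  using AE_good by eventually_elim (simp add: N'_def)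

lemma mean_N': "S \<in> sets borel \<Longrightarrow> emeasure \<nu> S < \<infinity> \<Longrightarrow> (\<integral>\<^sup>+\<omega>. emeasure (N' \<omega>) S \<partial>M) = emeasure \<nu> S"
  using N'_eq by (subst mean_N[symmetric]) (auto intro!: nn_integral_cong_AE elim!: eventually_mono)

definition "sect S \<omega> = {p. (\<omega>, p) \<in> S}" for S :: "('w \<times> noise_pt) set"

lemma sect_meas: "S \<in> sets Pm \<Longrightarrow> sect S \<omega> \<in> sets borel"
  using sets_Pm_sub sets_Pair1[of S M borel \<omega>] by (auto simp: sect_def vimage_def)

text \<open>\<nu> cut down to \<open>B k\<close> is finite, so that masses of sections depend
  measurably on \<omega>.\<close>

definition "\<nu>B k = density \<nu> (indicator (B k))"

lemma emeasure_\<nu>B: "S \<in> sets borel \<Longrightarrow> emeasure (\<nu>B k) S = emeasure \<nu> (S \<inter> B k)"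
  unfolding \<nu>B_def using sets_\<nu> by (simp add: emeasure_density indicator_inter_arith[symmetric] Int_commute)

lemma sets_\<nu>B: "sets (\<nu>B k) = sets borel"
  unfolding \<nu>B_def using sets_\<nu> by simp

lemma finite_\<nu>B: "finite_measure (\<nu>B k)"
  using B_fin[of k] sets_eq_imp_space_eq[OF sets_\<nu>B[of k]] by (intro finite_measureI) (auto simp: emeasure_\<nu>B)

lemma sect_\<nu>_meas: "S \<in> sets Pm \<Longrightarrow> (\<lambda>\<omega>. emeasure \<nu> (sect S \<omega> \<inter> B k)) \<in> borel_measurable M"
proof -
  assume S: "S \<in> sets Pm"
  interpret finite_measure "\<nu>B k" by (rule finite_\<nu>B)
  have "S \<in> sets (M \<Otimes>\<^sub>M \<nu>B k)"
    using S sets_Pm_sub sets_pair_measure_cong[OF refl sets_\<nu>B, of M k] by auto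
  then have "(\<lambda>\<omega>. emeasure (\<nu>B k) (Pair \<omega> -` S)) \<in> borel_measurable M"
    by (rule measurable_emeasure_Pair)
  moreover have "Pair \<omega> -` S = sect S \<omega>" for \<omega> by (auto simp: sect_def)
  ultimately show ?thesis by (simp add: emeasure_\<nu>B sect_meas[OF S])
qed

text \<open>Dynkin argument from the rectangles. The complement step subtracts masses and means,
  hence the restriction to \<open>B k\<close>, where they are finite. It also needs measurability,
  which is therefore part of the induction.\<close>

lemma predictable_set_B:
  assumes "S \<in> sets Pm"
  shows "(\<lambda>\<omega>. emeasure (N' \<omega>) (sect S \<omega> \<inter> B k)) \<in> borel_measurable M \<and>
     (\<integral>\<^sup>+\<omega>. emeasure (N' \<omega>) (sect S \<omega> \<inter> B k) \<partial>M) = (\<integral>\<^sup>+\<omega>. emeasure \<nu> (sect S \<omega> \<inter> B k) \<partial>M)"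
proof -
  have "S \<in> sigma_sets (space M \<times> UNIV) rects" using assms by (simp add: sets_Pm)
  with rects_Int_stable rects_Pow show ?thesis
  proof (induction rule: sigma_sets_induct_disjoint)
    case (basic R)
    then obtain E S s t where R: "R = E \<times> time_slab S {s<..t}" "0 \<le> s" "s \<le> t" "t \<le> T" "E \<in> sets (F s)" "S \<in> sets borel"
      unfolding rects_def by auto
    have E [measurable]: "E \<in> sets M" using F_sets[of E s] R by auto
    \<comment> \<open>Cutting the marks with \<open>A k\<close> realises the intersection with
      \<open>B k\<close> and leaves a slab, so \<open>mean_slab\<close> applies with finite
      mass.\<close>
    define C where "C = time_slab (S \<inter> A k) {s<..t}"
    have C: "C \<in> sets borel" unfolding C_def using R by (intro measurable_time_slab) auto
    have sub: "C \<subseteq> B k" using R unfolding C_def B_def time_slab_def by auto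
    have "emeasure \<nu> C \<le> emeasure \<nu> (B k)" using sub sets_\<nu> by (intro emeasure_mono) auto
    then have fin: "emeasure \<nu> C < \<infinity>" using B_fin[of k] by (rule le_less_trans)
    have sec: "sect R \<omega> \<inter> B k = (if \<omega> \<in> E then C else {})" for \<omega>
      using R unfolding sect_def C_def B_def time_slab_def by auto
    have e: "emeasure m (sect R \<omega> \<inter> B k) = indicator E \<omega> * emeasure m C" for m \<omega>
      unfolding sec by auto
    have "(\<integral>\<^sup>+\<omega>. indicator E \<omega> * emeasure (N' \<omega>) C \<partial>M) = (\<integral>\<^sup>+\<omega>. indicator E \<omega> * emeasure (N \<omega>) C \<partial>M)"
      using N'_eq by (intro nn_integral_cong_AE) (auto elim!: eventually_mono)
    also have "\<dots> = emeasure M E * emeasure \<nu> C"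
      unfolding C_def by (rule mean_slab) (use R fin in \<open>auto simp: C_def\<close>)
    also have "\<dots> = (\<integral>\<^sup>+\<omega>. indicator E \<omega> * emeasure \<nu> C \<partial>M)"
      by (subst nn_integral_multc) auto
    finally show ?case unfolding e using C by auto
  next
    case empty
    then show ?case by (simp add: sect_def)
  next
    case (compl S)
    then have S: "S \<in> sets Pm" by (simp add: sets_Pm)
    note IH = compl(2)
    have sec: "sect (space M \<times> UNIV - S) \<omega> \<inter> B k = B k - (sect S \<omega> \<inter> B k)" if "\<omega> \<in> space M" for \<omega>
      using that by (auto simp: sect_def)
    have n: "emeasure (N' \<omega>) (sect (space M \<times> UNIV - S) \<omega> \<inter> B k)
        = emeasure (N' \<omega>) (B k) - emeasure (N' \<omega>) (sect S \<omega> \<inter> B k)" if "\<omega> \<in> space M" for \<omega>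
    proof -
      have "emeasure (N' \<omega>) (sect S \<omega> \<inter> B k) \<le> emeasure (N' \<omega>) (B k)" by (intro emeasure_mono) auto
      then show ?thesis unfolding sec[OF that] using N'_B_fin[of \<omega> k] sect_meas[OF S]
        by (intro emeasure_Diff) (auto simp: less_top[symmetric] top_unique)
    qed
    have le: "emeasure \<nu> (sect S \<omega> \<inter> B k) \<le> emeasure \<nu> (B k)" for \<omega>
      using sets_\<nu> by (intro emeasure_mono) auto
    have v: "emeasure \<nu> (sect (space M \<times> UNIV - S) \<omega> \<inter> B k)
        = emeasure \<nu> (B k) - emeasure \<nu> (sect S \<omega> \<inter> B k)" if "\<omega> \<in> space M" for \<omega>
      unfolding sec[OF that] using B_fin[of k] sect_meas[OF S] le[of \<omega>] sets_\<nu>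
      by (intro emeasure_Diff) (auto simp: less_top[symmetric] top_unique)
    have fin: "(\<integral>\<^sup>+\<omega>. emeasure \<nu> (sect S \<omega> \<inter> B k) \<partial>M) \<noteq> \<infinity>"
    proof -
      have "(\<integral>\<^sup>+\<omega>. emeasure \<nu> (sect S \<omega> \<inter> B k) \<partial>M) \<le> (\<integral>\<^sup>+\<omega>. emeasure \<nu> (B k) \<partial>M)"
        by (intro nn_integral_mono le)
      then show ?thesis using B_fin[of k] by (auto simp: emeasure_space_1 top_unique)
    qed
    have "(\<integral>\<^sup>+\<omega>. emeasure (N' \<omega>) (sect (space M \<times> UNIV - S) \<omega> \<inter> B k) \<partial>M)
        = (\<integral>\<^sup>+\<omega>. emeasure (N' \<omega>) (B k) - emeasure (N' \<omega>) (sect S \<omega> \<inter> B k) \<partial>M)"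
      by (intro nn_integral_cong n)
    also have "\<dots> = (\<integral>\<^sup>+\<omega>. emeasure (N' \<omega>) (B k) \<partial>M) - (\<integral>\<^sup>+\<omega>. emeasure (N' \<omega>) (sect S \<omega> \<inter> B k) \<partial>M)"
      using IH fin by (intro nn_integral_diff) (auto intro!: emeasure_mono)
    also have "\<dots> = (\<integral>\<^sup>+\<omega>. emeasure \<nu> (B k) \<partial>M) - (\<integral>\<^sup>+\<omega>. emeasure \<nu> (sect S \<omega> \<inter> B k) \<partial>M)"
      using IH mean_N'[OF B_meas B_fin, of k] by (simp add: emeasure_space_1)
    also have "\<dots> = (\<integral>\<^sup>+\<omega>. emeasure \<nu> (B k) - emeasure \<nu> (sect S \<omega> \<inter> B k) \<partial>M)"
      using fin le sect_\<nu>_meas[OF S] by (intro nn_integral_diff[symmetric]) auto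
    also have "\<dots> = (\<integral>\<^sup>+\<omega>. emeasure \<nu> (sect (space M \<times> UNIV - S) \<omega> \<inter> B k) \<partial>M)"
      by (intro nn_integral_cong v[symmetric])
    finally have eq: "(\<integral>\<^sup>+\<omega>. emeasure (N' \<omega>) (sect (space M \<times> UNIV - S) \<omega> \<inter> B k) \<partial>M)
      = (\<integral>\<^sup>+\<omega>. emeasure \<nu> (sect (space M \<times> UNIV - S) \<omega> \<inter> B k) \<partial>M)" .
    moreover have "(\<lambda>\<omega>. emeasure (N' \<omega>) (sect (space M \<times> UNIV - S) \<omega> \<inter> B k)) \<in> borel_measurable M"
      using IH by (subst measurable_cong[OF n]) auto
    ultimately show ?case by blast
  next
    case (union R)
    then have R: "R i \<in> sets Pm" for i by (auto simp: sets_Pm)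
    have sec: "sect (\<Union>i. R i) \<omega> \<inter> B k = (\<Union>i. sect (R i) \<omega> \<inter> B k)" for \<omega> by (auto simp: sect_def)
    have d: "disjoint_family (\<lambda>i. sect (R i) \<omega> \<inter> B k)" for \<omega>
      using union(1) unfolding disjoint_family_on_def sect_def by blast
    have n: "emeasure (N' \<omega>) (sect (\<Union>i. R i) \<omega> \<inter> B k) = (\<Sum>i. emeasure (N' \<omega>) (sect (R i) \<omega> \<inter> B k))" for \<omega>
      unfolding sec using sect_meas[OF R] by (intro suminf_emeasure[symmetric] d) auto
    have v: "emeasure \<nu> (sect (\<Union>i. R i) \<omega> \<inter> B k) = (\<Sum>i. emeasure \<nu> (sect (R i) \<omega> \<inter> B k))" for \<omega>
      unfolding sec using sect_meas[OF R] sets_\<nu> by (intro suminf_emeasure[symmetric] d) auto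
    have m: "(\<lambda>\<omega>. emeasure (N' \<omega>) (sect (R i) \<omega> \<inter> B k)) \<in> borel_measurable M" for i
      using union by auto
    show ?case unfolding n v
      using union m sect_\<nu>_meas[OF R] by (auto simp: nn_integral_suminf)
  qed
qed

lemma emeasure_SUP_B:
  assumes S: "S \<in> sets borel" and m: "sets m = sets borel" "emeasure m (- (\<Union>k. B k)) = 0"
  shows "emeasure m S = (SUP k. emeasure m (S \<inter> B k))"
proof -
  have "(SUP k. emeasure m (S \<inter> B k)) = emeasure m (\<Union>k. S \<inter> B k)"
    using B_inc S m(1) by (intro SUP_emeasure_incseq) (auto simp: incseq_def)
  also have "\<dots> = emeasure m S"
  proof (rule emeasure_eq_AE)
    have "- (\<Union>k. B k) \<in> null_sets m" using m by auto
    from AE_not_in[OF this] show "AE x in m. (x \<in> (\<Union>k. S \<inter> B k)) = (x \<in> S)"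
      by eventually_elim auto
  qed (use S m in auto)
  finally show ?thesis by simp
qed

lemma predictable_set:
  assumes S: "S \<in> sets Pm"
  shows "(\<lambda>\<omega>. emeasure (N' \<omega>) (sect S \<omega>)) \<in> borel_measurable M \<and>
     (\<integral>\<^sup>+\<omega>. emeasure (N' \<omega>) (sect S \<omega>) \<partial>M) = (\<integral>\<^sup>+\<omega>. emeasure \<nu> (sect S \<omega>) \<partial>M)"
proof -
  have n0: "emeasure (N' \<omega>) (- (\<Union>k. B k)) = 0" for \<omega>
    unfolding N'_def good_def by auto
  have v0: "emeasure \<nu> (- (\<Union>k. B k)) = 0" by (rule \<nu>_compl_B)
  have n: "emeasure (N' \<omega>) (sect S \<omega>) = (SUP k. emeasure (N' \<omega>) (sect S \<omega> \<inter> B k))" for \<omega>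
    by (rule emeasure_SUP_B[OF sect_meas[OF S] _ n0]) simp
  have v: "emeasure \<nu> (sect S \<omega>) = (SUP k. emeasure \<nu> (sect S \<omega> \<inter> B k))" for \<omega>
    by (rule emeasure_SUP_B[OF sect_meas[OF S] sets_\<nu> v0])
  have inc: "incseq (\<lambda>k \<omega>. emeasure m (sect S \<omega> \<inter> B k))" if "sets m = sets borel" for m
    using B_inc that sect_meas[OF S] by (auto simp: incseq_def le_fun_def intro!: emeasure_mono)
  have inc': "incseq (\<lambda>k \<omega>. emeasure (N' \<omega>) (sect S \<omega> \<inter> B k))"
    using B_inc sect_meas[OF S] by (auto simp: incseq_def le_fun_def intro!: emeasure_mono)
  have m: "(\<lambda>\<omega>. SUP k. emeasure (N' \<omega>) (sect S \<omega> \<inter> B k)) \<in> borel_measurable M"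
    using predictable_set_B[OF S] by (intro borel_measurable_SUP) auto
  then show ?thesis unfolding n v
    using predictable_set_B[OF S] sect_\<nu>_meas[OF S] inc[OF sets_\<nu>] inc'
    by (simp add: nn_integral_monotone_convergence_SUP)
qed

end

section \<open>Compensation formula for predictable integrands\<close>

lemma integral_diff_nn_integral:
  fixes p m a :: "'s \<Rightarrow> ennreal"
  assumes [measurable]: "p \<in> borel_measurable M" "m \<in> borel_measurable M" "a \<in> borel_measurable M"
    and le: "\<And>s. p s \<le> a s" "\<And>s. m s \<le> a s" and fin: "(\<integral>\<^sup>+s. a s \<partial>M) < \<infinity>"
  shows "integrable M (\<lambda>s. enn2real (p s) - enn2real (m s))"
    and "(\<integral>s. enn2real (p s) - enn2real (m s) \<partial>M) = enn2real (\<integral>\<^sup>+s. p s \<partial>M) - enn2real (\<integral>\<^sup>+s. m s \<partial>M)"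
proof -
  \<comment> \<open>\<open>a\<close> is finite almost everywhere and dominates both functions, so
    \<open>enn2real\<close> loses nothing.\<close>
  have AEa: "AE s in M. a s \<noteq> \<infinity>" by (rule nn_integral_noteq_infinite) (use fin in auto)
  have i: "integrable M (\<lambda>s. enn2real (u s)) \<and> (\<integral>s. enn2real (u s) \<partial>M) = enn2real (\<integral>\<^sup>+s. u s \<partial>M)"
    if u [measurable]: "u \<in> borel_measurable M" and ua: "\<And>s. u s \<le> a s" for u
  proof -
    have e: "(\<integral>\<^sup>+s. ennreal (enn2real (u s)) \<partial>M) = (\<integral>\<^sup>+s. u s \<partial>M)"
    proof (rule nn_integral_cong_AE)
      show "AE s in M. ennreal (enn2real (u s)) = u s"
        using AEa
      proof eventually_elim
        case (elim s)
        then show ?case using ua[of s] by (auto simp: less_top top_unique)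
      qed
    qed
    have "(\<integral>\<^sup>+s. u s \<partial>M) < \<infinity>"
      using fin by (rule le_less_trans[rotated]) (intro nn_integral_mono ua)
    then show ?thesis
      using e by (auto intro!: integrableI_bounded simp: integral_eq_nn_integral)
  qed
  show "integrable M (\<lambda>s. enn2real (p s) - enn2real (m s))"
    using i[of p] i[of m] le by auto
  show "(\<integral>s. enn2real (p s) - enn2real (m s) \<partial>M) = enn2real (\<integral>\<^sup>+s. p s \<partial>M) - enn2real (\<integral>\<^sup>+s. m s \<partial>M)"
    using i[of p] i[of m] le by auto
qed

context poisson_noise begin

lemma Pm_sect: "u \<in> measurable Pm K \<Longrightarrow> \<omega> \<in> space M \<Longrightarrow> (\<lambda>p. u (\<omega>, p)) \<in> measurable borel K"
  by (rule measurable_Pair2[OF measurable_Pm_pair])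

text \<open>From sets to functions by multiples, sums and increasing limits. Measurability of both
  inner integrals travels along, since additivity and monotone convergence of the outer integral
  require it.\<close>

lemma predictable_nn_integral':
  fixes G :: "'w \<times> noise_pt \<Rightarrow> ennreal"
  assumes "G \<in> borel_measurable Pm"
  shows "(\<lambda>\<omega>. \<integral>\<^sup>+p. G (\<omega>, p) \<partial>N' \<omega>) \<in> borel_measurable M \<and>
     (\<lambda>\<omega>. \<integral>\<^sup>+p. G (\<omega>, p) \<partial>\<nu>) \<in> borel_measurable M \<and>
     (\<integral>\<^sup>+\<omega>. \<integral>\<^sup>+p. G (\<omega>, p) \<partial>N' \<omega> \<partial>M) = (\<integral>\<^sup>+\<omega>. \<integral>\<^sup>+p. G (\<omega>, p) \<partial>\<nu> \<partial>M)"
  using assms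
proof (induction rule: borel_measurable_induct)
  case (cong f g)
  have f: "(\<integral>\<^sup>+p. f (\<omega>, p) \<partial>m) = (\<integral>\<^sup>+p. g (\<omega>, p) \<partial>m)" if "\<omega> \<in> space M" for \<omega> m
    using cong(3) that by (intro nn_integral_cong) auto
  show ?case
    using cong(4) by (simp add: f cong: measurable_cong nn_integral_cong)
next
  case (set S)
  have i: "(\<integral>\<^sup>+p. indicator S (\<omega>, p) \<partial>m) = emeasure m (sect S \<omega>)" if "sets m = sets borel" for \<omega> m
  proof -
    have "(\<integral>\<^sup>+p. indicator S (\<omega>, p) \<partial>m) = (\<integral>\<^sup>+p. indicator (sect S \<omega>) p \<partial>m)"
      by (intro nn_integral_cong) (auto simp: sect_def indicator_def)
    then show ?thesis using sect_meas[OF set] that by simp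
  qed
  have "(\<lambda>\<omega>. emeasure \<nu> (sect S \<omega>)) \<in> borel_measurable M"
    using sect_\<nu>_meas[OF set] unfolding emeasure_SUP_B[OF sect_meas[OF set] sets_\<nu> \<nu>_compl_B]
    by (intro borel_measurable_SUP) auto
  then show ?case
    using predictable_set[OF set] by (simp add: i[OF sets_\<nu>] i[OF sets_N'])
next
  case (mult u a)
  have N: "(\<integral>\<^sup>+p. a * u (\<omega>, p) \<partial>N' \<omega>) = a * (\<integral>\<^sup>+p. u (\<omega>, p) \<partial>N' \<omega>)" if "\<omega> \<in> space M" for \<omega>
    using Pm_sect[OF mult(2) that] by (intro nn_integral_cmult) (auto cong: measurable_cong_sets)
  have V: "(\<integral>\<^sup>+p. a * u (\<omega>, p) \<partial>\<nu>) = a * (\<integral>\<^sup>+p. u (\<omega>, p) \<partial>\<nu>)" if "\<omega> \<in> space M" for \<omega>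
    using Pm_sect[OF mult(2) that] sets_\<nu> by (intro nn_integral_cmult) (auto cong: measurable_cong_sets)
  show ?case
    using mult(4) by (auto simp add: N V nn_integral_cmult cong: measurable_cong nn_integral_cong)
next
  case (add u v)
  have N: "(\<integral>\<^sup>+p. v (\<omega>, p) + u (\<omega>, p) \<partial>N' \<omega>) = (\<integral>\<^sup>+p. v (\<omega>, p) \<partial>N' \<omega>) + (\<integral>\<^sup>+p. u (\<omega>, p) \<partial>N' \<omega>)" if "\<omega> \<in> space M" for \<omega>
    using Pm_sect[OF add(1) that] Pm_sect[OF add(3) that] by (intro nn_integral_add) (auto cong: measurable_cong_sets)
  have V: "(\<integral>\<^sup>+p. v (\<omega>, p) + u (\<omega>, p) \<partial>\<nu>) = (\<integral>\<^sup>+p. v (\<omega>, p) \<partial>\<nu>) + (\<integral>\<^sup>+p. u (\<omega>, p) \<partial>\<nu>)" if "\<omega> \<in> space M" for \<omega>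
    using Pm_sect[OF add(1) that] Pm_sect[OF add(3) that] sets_\<nu> by (intro nn_integral_add) (auto cong: measurable_cong_sets)
  have [measurable]: "(\<lambda>\<omega>. \<integral>\<^sup>+p. u (\<omega>, p) \<partial>N' \<omega>) \<in> borel_measurable M" "(\<lambda>\<omega>. \<integral>\<^sup>+p. v (\<omega>, p) \<partial>N' \<omega>) \<in> borel_measurable M"
    "(\<lambda>\<omega>. \<integral>\<^sup>+p. u (\<omega>, p) \<partial>\<nu>) \<in> borel_measurable M" "(\<lambda>\<omega>. \<integral>\<^sup>+p. v (\<omega>, p) \<partial>\<nu>) \<in> borel_measurable M"
    using add(6,7) by auto
  show ?case
    using add(6,7) by (simp add: N V nn_integral_add cong: measurable_cong nn_integral_cong)
next
  case (seq U)
  have inc: "incseq (\<lambda>i p. U i (\<omega>, p))" for \<omega> using seq(3) by (auto simp: incseq_def le_fun_def)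
  have N: "(\<integral>\<^sup>+p. (SUP i. U i) (\<omega>, p) \<partial>N' \<omega>) = (SUP i. \<integral>\<^sup>+p. U i (\<omega>, p) \<partial>N' \<omega>)" if "\<omega> \<in> space M" for \<omega>
    using Pm_sect[OF seq(1) that] unfolding SUP_apply
    by (intro nn_integral_monotone_convergence_SUP inc) (auto cong: measurable_cong_sets)
  have V: "(\<integral>\<^sup>+p. (SUP i. U i) (\<omega>, p) \<partial>\<nu>) = (SUP i. \<integral>\<^sup>+p. U i (\<omega>, p) \<partial>\<nu>)" if "\<omega> \<in> space M" for \<omega>
    using Pm_sect[OF seq(1) that] sets_\<nu> unfolding SUP_apply
    by (intro nn_integral_monotone_convergence_SUP inc) (auto cong: measurable_cong_sets)
  have iN: "incseq (\<lambda>i \<omega>. \<integral>\<^sup>+p. U i (\<omega>, p) \<partial>N' \<omega>)" and iV: "incseq (\<lambda>i \<omega>. \<integral>\<^sup>+p. U i (\<omega>, p) \<partial>\<nu>)"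
    using seq(3) by (auto simp: incseq_def le_fun_def intro!: nn_integral_mono)
  have mN: "(\<lambda>\<omega>. SUP i. \<integral>\<^sup>+p. U i (\<omega>, p) \<partial>N' \<omega>) \<in> borel_measurable M"
   and mV: "(\<lambda>\<omega>. SUP i. \<integral>\<^sup>+p. U i (\<omega>, p) \<partial>\<nu>) \<in> borel_measurable M"
    using seq(5) by (auto intro!: borel_measurable_SUP)
  have "(\<integral>\<^sup>+\<omega>. (SUP i. \<integral>\<^sup>+p. U i (\<omega>, p) \<partial>N' \<omega>) \<partial>M) = (\<integral>\<^sup>+\<omega>. (SUP i. \<integral>\<^sup>+p. U i (\<omega>, p) \<partial>\<nu>) \<partial>M)"
    using seq(5) by (simp add: nn_integral_monotone_convergence_SUP[OF iN] nn_integral_monotone_convergence_SUP[OF iV])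
  with mN mV show ?case by (simp add: N V del: SUP_apply Sup_apply cong: measurable_cong nn_integral_cong)
qed

lemma predictable_integral:
  fixes H :: "'w \<times> noise_pt \<Rightarrow> real"
  assumes H [measurable]: "H \<in> borel_measurable Pm"
    and fin: "(\<integral>\<^sup>+\<omega>. \<integral>\<^sup>+p. ennreal \<bar>H (\<omega>, p)\<bar> \<partial>\<nu> \<partial>M) < \<infinity>"
  shows "(\<integral>\<omega>. (\<integral>p. H (\<omega>, p) \<partial>N' \<omega>) \<partial>M) = (\<integral>\<omega>. (\<integral>p. H (\<omega>, p) \<partial>\<nu>) \<partial>M)"
    and "integrable M (\<lambda>\<omega>. \<integral>p. H (\<omega>, p) \<partial>N' \<omega>)"
    and "integrable M (\<lambda>\<omega>. \<integral>p. H (\<omega>, p) \<partial>\<nu>)"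
proof -
  define n where "n K G \<omega> = (\<integral>\<^sup>+p. ennreal (G (\<omega>, p)) \<partial>K \<omega>)" for K :: "'w \<Rightarrow> noise_pt measure" and G :: "'w \<times> noise_pt \<Rightarrow> real" and \<omega>
  define V where "V = (\<lambda>_::'w. \<nu>)"
  let ?m = "\<lambda>q. - H q" and ?a = "\<lambda>q. \<bar>H q\<bar>"
  have m [measurable]: "n N' G \<in> borel_measurable M" "n V G \<in> borel_measurable M"
    and eq: "(\<integral>\<^sup>+\<omega>. n N' G \<omega> \<partial>M) = (\<integral>\<^sup>+\<omega>. n V G \<omega> \<partial>M)" if "G \<in> borel_measurable Pm" for G
    using predictable_nn_integral'[of "\<lambda>q. ennreal (G q)"] that unfolding n_def V_def by auto
  have a: "(\<integral>\<^sup>+\<omega>. n V ?a \<omega> \<partial>M) < \<infinity>" using fin unfolding n_def V_def by simp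
  \<comment> \<open>Stated for any kernel \<open>K\<close>, so that it serves the noise
    \<open>N'\<close> and the constant kernel \<nu> alike; the two values agree by the nonnegative
    case.\<close>
  have key: "(\<integral>\<omega>. (\<integral>p. H (\<omega>, p) \<partial>K \<omega>) \<partial>M) =
       enn2real (\<integral>\<^sup>+\<omega>. n K H \<omega> \<partial>M) - enn2real (\<integral>\<^sup>+\<omega>. n K ?m \<omega> \<partial>M)
     \<and> integrable M (\<lambda>\<omega>. \<integral>p. H (\<omega>, p) \<partial>K \<omega>)"
    if mK [measurable]: "n K H \<in> borel_measurable M" "n K ?m \<in> borel_measurable M" "n K ?a \<in> borel_measurable M"
      and fK: "(\<integral>\<^sup>+\<omega>. n K ?a \<omega> \<partial>M) < \<infinity>"
      and sK: "\<And>\<omega>. sets (K \<omega>) = sets borel" for K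
  proof -
    have le: "n K G \<omega> \<le> n K ?a \<omega>" if "\<And>q. G q \<le> \<bar>H q\<bar>" for G \<omega>
      unfolding n_def by (intro nn_integral_mono ennreal_leI that)
    have AEa: "AE \<omega> in M. n K ?a \<omega> \<noteq> \<infinity>" by (rule nn_integral_noteq_infinite) (use fK mK in auto)
    note parts = integral_diff_nn_integral[OF mK le le fK, OF abs_ge_self abs_ge_minus_self]
    \<comment> \<open>Where the absolute integral is infinite, the integral has the default value 0.
      The case distinction shows measurability in \<omega> on all of \<open>space M\<close>.\<close>
    have val: "(\<integral>p. H (\<omega>, p) \<partial>K \<omega>) = (if n K ?a \<omega> = \<infinity> then 0 else enn2real (n K H \<omega>) - enn2real (n K ?m \<omega>))"
      if "\<omega> \<in> space M" for \<omega>
    proof -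
      have [measurable]: "(\<lambda>p. H (\<omega>, p)) \<in> borel_measurable (K \<omega>)"
        using Pm_sect[OF H that] sK by (auto cong: measurable_cong_sets)
      have "integrable (K \<omega>) (\<lambda>p. H (\<omega>, p)) \<longleftrightarrow> n K ?a \<omega> \<noteq> \<infinity>"
        unfolding integrable_iff_bounded n_def by (auto simp: less_top)
      then show ?thesis unfolding n_def
        using real_lebesgue_integral_def[of "K \<omega>" "\<lambda>p. H (\<omega>, p)"] not_integrable_integral_eq by auto
    qed
    have meas: "(\<lambda>\<omega>. \<integral>p. H (\<omega>, p) \<partial>K \<omega>) \<in> borel_measurable M"
      by (subst measurable_cong[OF val]) auto
    have AEH: "AE \<omega> in M. (\<integral>p. H (\<omega>, p) \<partial>K \<omega>) = enn2real (n K H \<omega>) - enn2real (n K ?m \<omega>)"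
      using AEa AE_space by eventually_elim (simp add: val)
    show ?thesis
    proof
      show "(\<integral>\<omega>. (\<integral>p. H (\<omega>, p) \<partial>K \<omega>) \<partial>M) =
        enn2real (\<integral>\<^sup>+\<omega>. n K H \<omega> \<partial>M) - enn2real (\<integral>\<^sup>+\<omega>. n K ?m \<omega> \<partial>M)"
        unfolding parts(2)[symmetric] using meas AEH by (intro integral_cong_AE) auto
      show "integrable M (\<lambda>\<omega>. \<integral>p. H (\<omega>, p) \<partial>K \<omega>)"
        using parts(1) meas AEH by (subst integrable_cong_AE) auto
    qed
  qed
  have mH: "?m \<in> borel_measurable Pm" "?a \<in> borel_measurable Pm" by auto
  have a': "(\<integral>\<^sup>+\<omega>. n N' ?a \<omega> \<partial>M) < \<infinity>" using a eq[OF mH(2)] by simp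
  show "(\<integral>\<omega>. (\<integral>p. H (\<omega>, p) \<partial>N' \<omega>) \<partial>M) = (\<integral>\<omega>. (\<integral>p. H (\<omega>, p) \<partial>\<nu>) \<partial>M)"
    using key[OF m(1)[OF H] m(1)[OF mH(1)] m(1)[OF mH(2)] a' sets_N']
      key[OF m(2)[OF H] m(2)[OF mH(1)] m(2)[OF mH(2)] a] sets_\<nu> eq[OF H] eq[OF mH(1)]
    unfolding V_def by simp
  show "integrable M (\<lambda>\<omega>. \<integral>p. H (\<omega>, p) \<partial>N' \<omega>)"
    using key[OF m(1)[OF H] m(1)[OF mH(1)] m(1)[OF mH(2)] a' sets_N'] by simp
  show "integrable M (\<lambda>\<omega>. \<integral>p. H (\<omega>, p) \<partial>\<nu>)"
    using key[OF m(2)[OF H] m(2)[OF mH(1)] m(2)[OF mH(2)] a] sets_\<nu> unfolding V_def by simp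
qed

section \<open>Predictability of marks, times and left limits\<close>

lemma if_measurableI:
  fixes f :: "'q \<Rightarrow> 'b::{topological_space, zero}"
  assumes R: "R \<in> sets K" and C: "\<And>C. C \<in> sets borel \<Longrightarrow> {q\<in>R. f q \<in> C} \<in> sets K"
  shows "(\<lambda>q. if q \<in> R then f q else 0) \<in> borel_measurable K"
proof (rule measurableI)
  fix C :: "'b set" assume "C \<in> sets borel"
  then have "{q\<in>R. f q \<in> C} \<union> (if 0 \<in> C then space K - R else {}) \<in> sets K" using R C by auto
  moreover have "(\<lambda>q. if q \<in> R then f q else 0) -` C \<inter> space K = {q\<in>R. f q \<in> C} \<union> (if 0 \<in> C then space K - R else {})"
    using sets.sets_into_space[OF R] by (auto split: if_splits)
  ultimately show "(\<lambda>q. if q \<in> R then f q else 0) -` C \<inter> space K \<in> sets K" by simp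
qed auto

lemma rect_Pm:
  assumes "0 \<le> s" "s \<le> t" "t \<le> T" "E \<in> sets (F s)" "S \<in> sets borel"
  shows "E \<times> time_slab S {s<..t} \<in> sets Pm"
  unfolding sets_Pm using assms by (intro sigma_sets.Basic) (auto simp: rects_def)

lemma slab_Pm: "0 \<le> s \<Longrightarrow> s \<le> t \<Longrightarrow> t \<le> T \<Longrightarrow> S \<in> sets borel \<Longrightarrow> space M \<times> time_slab S {s<..t} \<in> sets Pm"
  using rect_Pm[of s t "space M" S] sets.top[of "F s"] F_space[of s] by (simp del: sets.top)

text \<open>A value known at time \<open>s\<close> is frozen on \<open>(s,t]\<close>; inside this
  slab its level sets are generating rectangles.\<close>

lemma leftpoint_predictable:
  fixes Y :: "'w \<Rightarrow> 'b::{topological_space, zero}"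
  assumes st: "0 \<le> s" "s \<le> t" "t \<le> T" and Y: "Y \<in> borel_measurable (F s)"
  shows "(\<lambda>q. if q \<in> space M \<times> time_slab UNIV {s<..t} then Y (fst q) else 0) \<in> borel_measurable Pm"
proof (rule if_measurableI)
  fix C :: "'b set" assume "C \<in> sets borel"
  then have "Y -` C \<inter> space M \<in> sets (F s)" using measurable_sets[OF Y] F_space[of s] st by auto
  then have "(Y -` C \<inter> space M) \<times> time_slab UNIV {s<..t} \<in> sets Pm" by (intro rect_Pm st) auto
  also have "(Y -` C \<inter> space M) \<times> time_slab UNIV {s<..t} = {q \<in> space M \<times> time_slab UNIV {s<..t}. Y (fst q) \<in> C}"
    by auto
  finally show "{q \<in> space M \<times> time_slab UNIV {s<..t}. Y (fst q) \<in> C} \<in> sets Pm" .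
qed (use st in \<open>auto intro: slab_Pm\<close>)

lemma mark_predictable:
  fixes h :: "_ \<Rightarrow> 'b::{topological_space, zero}"
  assumes h: "h \<in> borel_measurable borel"
  shows "(\<lambda>q. if q \<in> space M \<times> time_slab UNIV {0<..T} then
      h (fst (snd q), fst (snd (snd q)), fst (snd (snd (snd q))), fst (snd (snd (snd (snd q))))) else 0) \<in> borel_measurable Pm"
proof (rule if_measurableI)
  fix C :: "'b set" assume "C \<in> sets borel"
  then have "space M \<times> time_slab (h -` C) {0<..T} \<in> sets Pm"
    using measurable_sets[OF h] T by (intro slab_Pm) auto
  also have "space M \<times> time_slab (h -` C) {0<..T} = {q \<in> space M \<times> time_slab UNIV {0<..T}.
      h (fst (snd q), fst (snd (snd q)), fst (snd (snd (snd q))), fst (snd (snd (snd (snd q))))) \<in> C}"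
    by (auto simp: time_slab_def)
  finally show "{q \<in> space M \<times> time_slab UNIV {0<..T}.
      h (fst (snd q), fst (snd (snd q)), fst (snd (snd (snd q))), fst (snd (snd (snd (snd q))))) \<in> C} \<in> sets Pm" .
qed (use T in \<open>auto intro: slab_Pm\<close>)

lemma time_predictable:
  "(\<lambda>q. if q \<in> space M \<times> time_slab UNIV {0<..T} then tm (snd q) else 0) \<in> borel_measurable Pm"
  (is "?f \<in> _")
proof (rule borel_measurableI_le)
  fix a :: real
  have R: "space M \<times> time_slab UNIV {0<..T} \<in> sets Pm" using T by (intro slab_Pm) auto
  show "{q \<in> space Pm. ?f q \<le> a} \<in> sets Pm"
  proof (cases "a < 0")
    case True
    then have "{q \<in> space Pm. ?f q \<le> a} = {}" by (auto simp: time_slab_def)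
    then show ?thesis by (simp only: sets.empty_sets)
  next
    case False
    then have *: "{q \<in> space Pm. ?f q \<le> a} = (space Pm - space M \<times> time_slab UNIV {0<..T})
        \<union> space M \<times> time_slab UNIV {0<..min a T}"
      by (auto simp: time_slab_def)
    have "space M \<times> time_slab UNIV {0<..min a T} \<in> sets Pm" using T False by (intro slab_Pm) auto
    then show ?thesis unfolding * by (intro sets.Un sets.Diff sets.top R)
  qed
qed

lemma point_predictable:
  "(\<lambda>q. if q \<in> space M \<times> time_slab UNIV {0<..T} then snd q else 0) \<in> borel_measurable Pm"
proof -
  let ?R = "space M \<times> time_slab UNIV {0<..T}"
  have c: "(\<lambda>x :: vec3 \<times> real \<times> real \<times> real. fst x) \<in> borel_measurable borel"
    "(\<lambda>x :: vec3 \<times> real \<times> real \<times> real. fst (snd x)) \<in> borel_measurable borel"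
    "(\<lambda>x :: vec3 \<times> real \<times> real \<times> real. fst (snd (snd x))) \<in> borel_measurable borel"
    "(\<lambda>x :: vec3 \<times> real \<times> real \<times> real. snd (snd (snd x))) \<in> borel_measurable borel"
    by (intro borel_measurable_continuous_onI continuous_intros)+
  have "(\<lambda>q. (if q \<in> ?R then fst (snd q) else 0, if q \<in> ?R then fst (snd (snd q)) else 0,
      if q \<in> ?R then fst (snd (snd (snd q))) else 0, if q \<in> ?R then fst (snd (snd (snd (snd q)))) else 0,
      if q \<in> ?R then tm (snd q) else 0)) \<in> borel_measurable Pm"
    by (intro borel_measurable_Pair time_predictable c[THEN mark_predictable, unfolded fst_conv snd_conv])
  also have "(\<lambda>q. (if q \<in> ?R then fst (snd q) else 0, if q \<in> ?R then fst (snd (snd q)) else 0,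
      if q \<in> ?R then fst (snd (snd (snd q))) else 0, if q \<in> ?R then fst (snd (snd (snd (snd q)))) else 0,
      if q \<in> ?R then tm (snd q) else 0)) = (\<lambda>q. if q \<in> ?R then snd q else 0)"
    by (auto simp: zero_prod_def fun_eq_iff)
  finally show ?thesis .
qed

lemma leftlim_tendsto:
  assumes "cadlag_on T y" "0 < s" "s \<le> T"
  shows "(y \<longlongrightarrow> leftlim y s) (at_left s)"
proof -
  obtain l where l: "(y \<longlongrightarrow> l) (at_left s)"
    using assms unfolding cadlag_on_def by (metis greaterThanAtMost_iff)
  have "Lim (at_left s) y = l" by (rule tendsto_Lim[OF _ l]) simp
  then show ?thesis using l assms unfolding leftlim_def by simp
qed

text \<open>The process is sampled at the left endpoint of the grid cell that contains the time. The
  sampling times are strictly earlier and converge, so the samples tend to the left limit for every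
  \<omega>, not only almost surely.\<close>

lemma leftlim_predictable:
  fixes Y :: "'w \<Rightarrow> real \<Rightarrow> 'b::{second_countable_topology, real_normed_vector}"
  assumes Y: "\<And>s. 0 \<le> s \<Longrightarrow> s \<le> T \<Longrightarrow> (\<lambda>\<omega>. Y \<omega> s) \<in> borel_measurable (F s)"
    and cad: "\<And>\<omega>. \<omega> \<in> space M \<Longrightarrow> cadlag_on T (Y \<omega>)"
  shows "(\<lambda>q. if q \<in> space M \<times> time_slab UNIV {0<..T} then leftlim (Y (fst q)) (tm (snd q)) else 0) \<in> borel_measurable Pm"
proof (rule borel_measurable_LIMSEQ_metric)
  define U where "U n q = (\<Sum>i<n. if q \<in> space M \<times> time_slab UNIV {T * real i / n<..T * real (Suc i) / n}
      then Y (fst q) (T * real i / n) else 0)" for n q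
  have iT: "T * real j / n \<le> T" if "j \<le> n" for j n :: nat
    using that T by (cases "n = 0") (auto simp: divide_simps)
  have "U n \<in> borel_measurable Pm" for n
    unfolding U_def[abs_def]
  proof (intro borel_measurable_sum leftpoint_predictable Y)
    fix i assume i: "i \<in> {..<n}"
    show "0 \<le> T * real i / n" "0 \<le> T * real i / n" using T by auto
    show "T * real i / n \<le> T * real (Suc i) / n" using T by (intro divide_right_mono mult_left_mono) auto
    show "T * real (Suc i) / n \<le> T" "T * real i / n \<le> T" using i by (intro iT; simp)+
  qed
  then show "U (Suc n) \<in> borel_measurable Pm" for n .
  fix q assume "q \<in> space Pm"
  then obtain \<omega> p where q: "q = (\<omega>, p)" "\<omega> \<in> space M" by auto
  define s where "s = tm p"
  have p: "p \<in> time_slab UNIV {a<..b} \<longleftrightarrow> a < s \<and> s \<le> b" for a b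
    unfolding s_def time_slab_def by (cases p) auto
  show "(\<lambda>n. U (Suc n) q) \<longlonglongrightarrow> (if q \<in> space M \<times> time_slab UNIV {0<..T} then leftlim (Y (fst q)) (tm (snd q)) else 0)"
  proof (cases "0 < s \<and> s \<le> T")
    case True
    \<comment> \<open>The cells are left-open, so a time on the grid belongs to the cell that ends
      there: hence the ceiling minus 1. This keeps the sampling time strictly below
      \<open>s\<close>.\<close>
    define j where "j n = nat (\<lceil>s * real (Suc n) / T\<rceil> - 1)" for n
    have jr: "real (j n) = real_of_int \<lceil>s * real (Suc n) / T\<rceil> - 1" for n
    proof -
      have "0 < s * real (Suc n) / T" using True T by simp
      then show ?thesis unfolding j_def by simp
    qed
    have j: "real (j n) < s * real (Suc n) / T" "s * real (Suc n) / T \<le> real (Suc (j n))" for n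
      using jr[of n] ceiling_correct[of "s * real (Suc n) / T"] by auto
    have jlt: "j n < Suc n" for n
    proof -
      have "s * real (Suc n) / T \<le> T * real (Suc n) / T" using True T by (intro divide_right_mono mult_right_mono) auto
      then have "real (j n) < real (Suc n)" using j(1)[of n] T by simp
      then show ?thesis by simp
    qed
    define x where "x n = T * real (j n) / real (Suc n)" for n
    have x1: "x n < s" for n using j(1)[of n] T unfolding x_def by (simp add: field_simps)
    have x2: "s \<le> T * real (Suc (j n)) / real (Suc n)" for n using j(2)[of n] T by (simp add: field_simps)
    have x3: "s - T / real (Suc n) \<le> x n" for n
    proof -
      have "T * real (Suc (j n)) / real (Suc n) = x n + T / real (Suc n)"
        unfolding x_def by (simp add: distrib_left add_divide_distrib)
      then show ?thesis using x2[of n] by linarith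
    qed
    have U: "U (Suc n) q = Y \<omega> (x n)" for n
    proof -
      have "q \<in> space M \<times> time_slab UNIV {T * real i / Suc n<..T * real (Suc i) / Suc n} \<longleftrightarrow> i = j n" for i
      proof
        assume "i = j n" then show "q \<in> space M \<times> time_slab UNIV {T * real i / Suc n<..T * real (Suc i) / Suc n}"
          using q x1[of n] x2[of n] p unfolding x_def by auto
      next
        assume "q \<in> space M \<times> time_slab UNIV {T * real i / Suc n<..T * real (Suc i) / Suc n}"
        then have "T * real i / Suc n < s" "s \<le> T * real (Suc i) / Suc n" using q p by auto
        then have "real i < s * real (Suc n) / T" "s * real (Suc n) / T \<le> real (Suc i)" using T by (auto simp: field_simps)
        then have "real i < real (Suc (j n))" "real (j n) < real (Suc i)" using j[of n] by linarith+
        then show "i = j n" by simp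
      qed
      then have "U (Suc n) q = (\<Sum>i<Suc n. if i = j n then Y \<omega> (T * real i / Suc n) else 0)"
        unfolding U_def using q by (intro sum.cong) auto
      also have "\<dots> = Y \<omega> (x n)" using jlt[of n] unfolding x_def by (simp add: sum.delta)
      finally show ?thesis .
    qed
    have "x \<longlonglongrightarrow> s"
    proof (rule tendsto_sandwich)
      have "(\<lambda>n. s - T * inverse (real (Suc n))) \<longlonglongrightarrow> s - T * 0"
        by (intro tendsto_intros LIMSEQ_inverse_real_of_nat)
      then show "(\<lambda>n. s - T / real (Suc n)) \<longlonglongrightarrow> s" by (simp add: divide_inverse)
      show "(\<lambda>_. s) \<longlonglongrightarrow> s" by simp
    qed (use x1 x3 in \<open>auto intro!: always_eventually less_imp_le\<close>)
    then have "filterlim x (at_left s) sequentially"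
      using x1 by (auto simp: filterlim_at intro!: always_eventually less_imp_neq)
    from filterlim_compose[OF leftlim_tendsto[OF cad[OF q(2)]] this]
    have "(\<lambda>n. Y \<omega> (x n)) \<longlonglongrightarrow> leftlim (Y \<omega>) s" using True by auto
    then show ?thesis unfolding U using True q p by (auto simp: s_def)
  next
    case False
    have "U (Suc n) q = 0" for n
      unfolding U_def
    proof (rule sum.neutral, rule ballI)
      fix i assume "i \<in> {..<Suc n}"
      then have "T * real (Suc i) / Suc n \<le> T" "0 \<le> T * real i / Suc n" using iT[of "Suc i" "Suc n"] T by auto
      then have "\<not> (T * real i / Suc n < s \<and> s \<le> T * real (Suc i) / Suc n)" using False by linarith
      then show "(if q \<in> space M \<times> time_slab UNIV {T * real i / Suc n<..T * real (Suc i) / Suc n}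
          then Y (fst q) (T * real i / Suc n) else 0) = 0"
        using q p by auto
    qed
    then show ?thesis using False q p by auto
  qed
qed

end

section \<open>The intensity and the collision operator\<close>

lemma borel_measurable_fst [measurable (raw)]:
  fixes f :: "'m \<Rightarrow> 'a::topological_space \<times> 'b::topological_space"
  shows "f \<in> borel_measurable M \<Longrightarrow> (\<lambda>x. fst (f x)) \<in> borel_measurable M"
  by (rule measurable_compose, assumption) (intro borel_measurable_continuous_onI continuous_intros)

lemma borel_measurable_snd [measurable (raw)]:
  fixes f :: "'m \<Rightarrow> 'a::topological_space \<times> 'b::topological_space"
  shows "f \<in> borel_measurable M \<Longrightarrow> (\<lambda>x. snd (f x)) \<in> borel_measurable M"
  by (rule measurable_compose, assumption) (intro borel_measurable_continuous_onI continuous_intros)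

lemma sets_lborel_pair: "sets Q = sets (borel :: 'b::second_countable_topology measure) \<Longrightarrow>
   sets (P \<Otimes>\<^sub>M Q) = sets (borel :: ('a::second_countable_topology \<times> 'b) measure)" if "sets P = sets borel"
  unfolding borel_prod[symmetric] by (rule sets_pair_measure_cong[OF that])

lemma sigma_finite_indicator: "A \<in> sets borel \<Longrightarrow> sigma_finite_measure (density lborel (indicator A :: real \<Rightarrow> ennreal))"
  by (subst sigma_finite_measure.sigma_finite_iff_density_finite[OF sigma_finite_lborel]) (auto simp: indicator_def)

lemma continuous_AE_zero_imp_zero:
  fixes h :: "'a::euclidean_space \<Rightarrow> real"
  assumes "continuous_on UNIV h" "AE y in lborel. h y = 0"
  shows "h x = 0"
proof (rule ccontr)
  assume "h x \<noteq> 0"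
  have "open (h -` (- {0}))" by (rule open_vimage[OF _ assms(1)]) auto
  then obtain e where e: "e > 0" "ball x e \<subseteq> h -` (- {0})"
    using \<open>h x \<noteq> 0\<close> by (metis ComplI open_contains_ball singletonD vimageI)
  have "AE y in lborel. y \<notin> ball x e" using assms(2) by eventually_elim (use e in auto)
  then have "emeasure lborel (ball x e) = 0"
    by (subst (asm) AE_iff_measurable[where N="ball x e"]) auto
  moreover have "emeasure lborel (ball x e) > 0"
    using e(1) content_ball_pos[of e x] emeasure_lborel_ball_finite[of x e] by (simp add: emeasure_eq_ennreal_measure)
  ultimately show False by simp
qed

section \<open>Kinetic data: collision map, density and marginal\<close>

locale kinetic =
  fixes I J :: "vec3 \<Rightarrow> vec3" and Q :: "real measure" and \<sigma> :: "real \<Rightarrow> real"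
    and T :: real and f :: "real \<Rightarrow> vec3 \<Rightarrow> vec3 \<Rightarrow> real"
  assumes IJ: "admissible_IJ I J"
    and A': "hypA' Q \<sigma>"
    and T: "T > 0"
    and dens: "\<And>t. t \<in> {0..T} \<Longrightarrow> prob_density6 (f t)"
    and cont: "continuous_on ({0..T} \<times> UNIV) (\<lambda>(t, x, v). f t x v)"
    and B2: "hypB2 T f"
begin

lemma IJ_meas [measurable]: "I \<in> borel_measurable borel" "J \<in> borel_measurable borel"
  using IJ unfolding admissible_IJ_def by auto

lemma sets_Q: "sets Q = sets borel"
  using A' unfolding hypA'_def by auto

lemma measurable_Q [simp]: "measurable Q K = measurable borel K"
  by (rule measurable_cong_sets[OF sets_Q refl])

lemma space_Q [simp]: "space Q = UNIV"
  using sets_eq_imp_space_eq[OF sets_Q] by simp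

sublocale Q: sigma_finite_measure Q
  using A' unfolding hypA'_def by auto

sublocale Phi: sigma_finite_measure phi_measure
  unfolding phi_measure_def by (rule sigma_finite_indicator) auto

lemma sets_phi: "sets phi_measure = sets borel"
  unfolding phi_measure_def by simp

lemma emeasure_phi: "emeasure phi_measure UNIV = ennreal (2 * pi)"
  unfolding phi_measure_def by (subst emeasure_density) auto

lemma sigma_finite_QP: "sigma_finite_measure (Q \<Otimes>\<^sub>M phi_measure)"
  by (intro sigma_finite_pair_measure Q.sigma_finite_measure_axioms Phi.sigma_finite_measure_axioms)

lemma sets_coll: "sets (coll_measure Q) = sets borel"
  unfolding coll_measure_def by (intro sets_lborel_pair sets_Q sets_phi) auto

lemma measurable_coll [simp]: "measurable (coll_measure Q) K = measurable borel K"
  by (rule measurable_cong_sets[OF sets_coll refl])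

sublocale coll: sigma_finite_measure "coll_measure Q"
  unfolding coll_measure_def by (intro sigma_finite_pair_measure sigma_finite_lborel sigma_finite_QP)

lemma measurable_QP: "measurable (Q \<Otimes>\<^sub>M phi_measure) K = measurable borel K"
  by (intro measurable_cong_sets sets_lborel_pair sets_Q sets_phi) auto

lemma measurable_phi [simp]: "measurable phi_measure K = measurable borel K"
  by (rule measurable_cong_sets[OF sets_phi refl])

lemma nn_integral_coll:
  fixes h :: "vec3 \<times> real \<times> real \<Rightarrow> ennreal"
  assumes h [measurable]: "h \<in> borel_measurable borel"
  shows "(\<integral>\<^sup>+q. h q \<partial>coll_measure Q) = (\<integral>\<^sup>+v. \<integral>\<^sup>+\<theta>. \<integral>\<^sup>+\<phi>. h (v, \<theta>, \<phi>) \<partial>phi_measure \<partial>Q \<partial>lborel)"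
proof -
  have h': "h \<in> borel_measurable (lborel \<Otimes>\<^sub>M (Q \<Otimes>\<^sub>M phi_measure))"
    unfolding measurable_coll[unfolded coll_measure_def] by (rule h)
  have "(\<integral>\<^sup>+q. h q \<partial>coll_measure Q) = (\<integral>\<^sup>+v. \<integral>\<^sup>+w. h (v, w) \<partial>(Q \<Otimes>\<^sub>M phi_measure) \<partial>lborel)"
    unfolding coll_measure_def using sigma_finite_measure.nn_integral_fst[OF sigma_finite_QP h'] by simp
  also have "\<dots> = (\<integral>\<^sup>+v. \<integral>\<^sup>+\<theta>. \<integral>\<^sup>+\<phi>. h (v, \<theta>, \<phi>) \<partial>phi_measure \<partial>Q \<partial>lborel)"
  proof (intro nn_integral_cong)
    fix v
    have "(\<lambda>w. h (v, w)) \<in> borel_measurable (Q \<Otimes>\<^sub>M phi_measure)"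
      unfolding measurable_QP by measurable
    from Phi.nn_integral_fst[OF this]
    show "(\<integral>\<^sup>+w. h (v, w) \<partial>(Q \<Otimes>\<^sub>M phi_measure)) = (\<integral>\<^sup>+\<theta>. \<integral>\<^sup>+\<phi>. h (v, \<theta>, \<phi>) \<partial>phi_measure \<partial>Q)" by simp
  qed
  finally show ?thesis .
qed

lemma AE_Q: "AE \<theta> in Q. 0 < \<theta> \<and> \<theta> \<le> pi"
proof -
  have "emeasure Q (UNIV - {0<..pi}) = 0" using A' unfolding hypA'_def by auto
  moreover have "UNIV - {0<..pi} \<in> sets Q" using sets_Q by auto
  ultimately have "UNIV - {0<..pi} \<in> null_sets Q" by auto
  from AE_not_in[OF this] show ?thesis by eventually_elim auto
qed

lemma AE_coll_iterated:
  assumes P: "{q. \<not> P q} \<in> sets borel" and AE: "AE v in lborel. AE \<theta> in Q. \<forall>\<phi>. P (v, \<theta>, \<phi>)"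
  shows "AE q in coll_measure Q. P q"
proof -
  have "emeasure (coll_measure Q) {q. \<not> P q} = (\<integral>\<^sup>+q. indicator {q. \<not> P q} q \<partial>coll_measure Q)"
    by (rule nn_integral_indicator[symmetric]) (simp only: sets_coll P)
  also have "\<dots> = (\<integral>\<^sup>+v. \<integral>\<^sup>+\<theta>. \<integral>\<^sup>+\<phi>. indicator {q. \<not> P q} (v, \<theta>, \<phi>) \<partial>phi_measure \<partial>Q \<partial>lborel)"
    using P by (intro nn_integral_coll) auto
  also have "\<dots> = (\<integral>\<^sup>+v. 0 \<partial>(lborel :: vec3 measure))"
  proof (rule nn_integral_cong_AE)
    show "AE v in lborel. (\<integral>\<^sup>+\<theta>. \<integral>\<^sup>+\<phi>. indicator {q. \<not> P q} (v, \<theta>, \<phi>) \<partial>phi_measure \<partial>Q) = 0"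
      using AE
    proof eventually_elim
      case (elim v)
      then have "AE \<theta> in Q. (\<integral>\<^sup>+\<phi>. indicator {q. \<not> P q} (v, \<theta>, \<phi>) \<partial>phi_measure) = 0"
        by eventually_elim simp
      from nn_integral_cong_AE[OF this] show ?case by simp
    qed
  qed
  finally have "{q. \<not> P q} \<in> null_sets (coll_measure Q)" using P sets_coll by auto
  from AE_not_in[OF this] show ?thesis by simp
qed

lemma AE_coll: "AE q in coll_measure Q. 0 < fst (snd q) \<and> fst (snd q) \<le> pi"
proof (rule AE_coll_iterated)
  have "{q\<in>space borel. \<not> (0 < fst (snd q) \<and> fst (snd q) \<le> pi)} \<in> sets (borel :: (vec3 \<times> real \<times> real) measure)"
    by measurable
  then show "{q :: vec3 \<times> real \<times> real. \<not> (0 < fst (snd q) \<and> fst (snd q) \<le> pi)} \<in> sets borel" by simp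
qed (use AE_Q in simp)

lemma \<sigma>: obtains c where "c > 0" "\<And>r. \<sigma> r = c * r"
  using A' unfolding hypA'_def by auto

lemma \<sigma>_meas [measurable]: "\<sigma> \<in> borel_measurable borel"
proof -
  obtain c where "\<sigma> = (\<lambda>r. c * r)" using \<sigma> by (metis ext)
  then show ?thesis by simp
qed

lemma \<sigma>_nonneg: "0 \<le> r \<Longrightarrow> 0 \<le> \<sigma> r"
  by (rule \<sigma>) simp

lemma theta_moment: "(\<integral>\<^sup>+\<theta>. ennreal \<theta> \<partial>Q) < \<infinity>"
proof -
  have "(\<integral>\<^sup>+\<theta>. ennreal \<theta> \<partial>Q) = (\<integral>\<^sup>+\<theta>. ennreal \<theta> * indicator {0<..pi} \<theta> \<partial>Q)"
  proof (rule nn_integral_cong_AE)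
    show "AE \<theta> in Q. ennreal \<theta> = ennreal \<theta> * indicator {0<..pi} \<theta>"
      using AE_Q by eventually_elim simp
  qed
  also have "\<dots> < \<infinity>" using A' pi_gt_zero unfolding hypA'_def by blast
  finally show ?thesis .
qed

lemma alpha_meas [measurable (raw)]:
  assumes [measurable]: "z \<in> borel_measurable K" "v \<in> borel_measurable K" "\<theta> \<in> borel_measurable K" "\<phi> \<in> borel_measurable K"
  shows "(\<lambda>x. alpha I J (z x) (v x) (\<theta> x) (\<phi> x)) \<in> borel_measurable K"
  unfolding alpha_def Gam_def by measurable

text \<open>One factor \<theta> is what \<open>Q\<close> integrates near 0. The two parts of
  \<open>alpha\<close> contribute \<theta>/2 and \<theta>, rounded up to 2\<theta>. The case
  \<open>v = z\<close> is excluded because \<open>I\<close> and \<open>J\<close> are controlled only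
  off 0.\<close>

lemma alpha_bound:
  assumes "v \<noteq> z" "0 \<le> \<theta>"
  shows "norm (alpha I J z v \<theta> \<phi>) \<le> 2 * \<theta> * norm (z - v)"
proof -
  let ?w = "v - z"
  have w: "norm (I ?w) = norm ?w" "norm (J ?w) = norm ?w"
    using IJ assms(1) unfolding admissible_IJ_def by auto
  have "norm (Gam I J ?w \<phi>) \<le> \<bar>cos \<phi>\<bar> * norm ?w + \<bar>sin \<phi>\<bar> * norm ?w"
    unfolding Gam_def by (rule order_trans[OF norm_triangle_ineq]) (simp add: w)
  also have "\<dots> \<le> 1 * norm ?w + 1 * norm ?w"
    by (intro add_mono mult_right_mono) auto
  finally have G: "norm (Gam I J ?w \<phi>) \<le> 2 * norm ?w" by simp
  have s: "\<bar>sin \<theta>\<bar> \<le> \<theta>" "\<bar>sin (\<theta>/2)\<bar> \<le> \<theta>/2"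
    using abs_sin_x_le_abs_x[of \<theta>] abs_sin_x_le_abs_x[of "\<theta>/2"] assms(2) by auto
  have "(sin (\<theta>/2))\<^sup>2 = \<bar>sin (\<theta>/2)\<bar> * \<bar>sin (\<theta>/2)\<bar>" by (simp add: power2_eq_square)
  also have "\<dots> \<le> 1 * (\<theta>/2)" using s by (intro mult_mono) auto
  finally have s2: "(sin (\<theta>/2))\<^sup>2 \<le> \<theta>/2" by simp
  have "norm (alpha I J z v \<theta> \<phi>) \<le> (sin (\<theta>/2))\<^sup>2 * norm ?w + \<bar>sin \<theta>\<bar> / 2 * norm (Gam I J ?w \<phi>)"
    unfolding alpha_def by (rule order_trans[OF norm_triangle_ineq]) simp
  also have "\<dots> \<le> (\<theta>/2) * norm ?w + \<theta> / 2 * (2 * norm ?w)"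
    using s s2 G assms(2) by (intro add_mono mult_mono) auto
  also have "\<dots> \<le> 2 * \<theta> * norm ?w" using assms(2) by (simp add: algebra_simps)
  finally show ?thesis by (simp add: norm_minus_commute)
qed

text \<open>\<open>f\<close> is arbitrary outside \<open>[0,T]\<close>. Cut off by 0 it is Borel in
  all variables together, being continuous on a closed set and 0 elsewhere.\<close>

definition "fT s x v = (if 0 \<le> s \<and> s \<le> T then f s x v else 0)"
definition "mT s v = marg fT s v"

lemma fT_eq: "s \<in> {0..T} \<Longrightarrow> fT s = f s"
  unfolding fT_def by auto

lemma mT_eq: "s \<in> {0..T} \<Longrightarrow> mT s = marg f s"
  unfolding mT_def marg_def fT_def by auto

lemma fT_nonneg: "0 \<le> fT s x v"
  using dens[of s] unfolding fT_def prob_density6_def by auto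

lemma mT_nonneg: "0 \<le> mT s v"
  unfolding mT_def marg_def using fT_nonneg by simp

lemma fT_meas0: "(\<lambda>p. fT (fst p) (fst (snd p)) (snd (snd p))) \<in> borel_measurable borel"
proof -
  have "{0..T} \<times> (UNIV :: (vec3 \<times> vec3) set) \<in> sets borel" by (intro borel_closed closed_Times) auto
  then have "(\<lambda>p. indicator ({0..T} \<times> UNIV) p *\<^sub>R (case p of (t, x, v) \<Rightarrow> f t x v)) \<in> borel_measurable borel"
    by (intro borel_measurable_continuous_on_indicator cont)
  also have "(\<lambda>p. indicator ({0..T} \<times> UNIV) p *\<^sub>R (case p of (t, x, v) \<Rightarrow> f t x v))
    = (\<lambda>p. fT (fst p) (fst (snd p)) (snd (snd p)))"
    by (auto simp: fT_def indicator_def)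
  finally show ?thesis .
qed

lemma fT_meas [measurable (raw)]:
  assumes [measurable]: "s \<in> borel_measurable K" "x \<in> borel_measurable K" "v \<in> borel_measurable K"
  shows "(\<lambda>w. fT (s w) (x w) (v w)) \<in> borel_measurable K"
  using measurable_compose[OF _ fT_meas0, of "\<lambda>w. (s w, x w, v w)" K] by simp

lemma mT_meas [measurable (raw)]:
  assumes [measurable]: "s \<in> borel_measurable K" "v \<in> borel_measurable K"
  shows "(\<lambda>w. mT (s w) (v w)) \<in> borel_measurable K"
  unfolding mT_def marg_def by (rule lborel.borel_measurable_lebesgue_integral) measurable

lemma fT_total: 
  assumes "s \<in> {0..T}" shows "(\<integral>\<^sup>+v. \<integral>\<^sup>+x. ennreal (fT s x v) \<partial>lborel \<partial>lborel) = 1"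
proof -
  have "1 = (\<integral>\<^sup>+p. ennreal (fT s (fst p) (snd p)) \<partial>(lborel :: (vec3 \<times> vec3) measure))"
    using dens[OF assms] fT_eq[OF assms] unfolding prob_density6_def by simp
  also have "\<dots> = (\<integral>\<^sup>+p. ennreal (fT s (fst p) (snd p)) \<partial>((lborel :: vec3 measure) \<Otimes>\<^sub>M (lborel :: vec3 measure)))"
    by (simp add: lborel_prod)
  also have "\<dots> = (\<integral>\<^sup>+v. \<integral>\<^sup>+x. ennreal (fT s x v) \<partial>lborel \<partial>lborel)"
    by (subst lborel_pair.nn_integral_snd[symmetric]) (auto simp: split_beta')
  finally show ?thesis by simp
qed

lemma AE_integrable: "AE v in lborel. integrable lborel (\<lambda>x. fT s x v)"
proof (cases "s \<in> {0..T}")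
  case True
  have "AE v in lborel. (\<integral>\<^sup>+x. ennreal (fT s x v) \<partial>lborel) \<noteq> \<infinity>"
    by (rule nn_integral_noteq_infinite) (use fT_total[OF True] in auto)
  then show ?thesis
    by eventually_elim (intro integrableI_bounded, auto simp: fT_nonneg less_top)
qed (auto simp: fT_def)

text \<open>Where a slice of \<open>fT\<close> is not integrable, its marginal has the default value
  0 and so stays below the nonnegative integral; outside \<open>[0,T]\<close> it is 0.\<close>

lemma mT_le_1: "(\<integral>\<^sup>+v. ennreal (mT s v) \<partial>lborel) \<le> 1"
proof (cases "s \<in> {0..T}")
  case True
  have "ennreal (mT s v) \<le> (\<integral>\<^sup>+x. ennreal (fT s x v) \<partial>lborel)" for v
    unfolding mT_def marg_def
    by (cases "integrable lborel (\<lambda>x. fT s x v)")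
       (auto simp: nn_integral_eq_integral fT_nonneg not_integrable_integral_eq)
  then have "(\<integral>\<^sup>+v. ennreal (mT s v) \<partial>lborel) \<le> (\<integral>\<^sup>+v. \<integral>\<^sup>+x. ennreal (fT s x v) \<partial>lborel \<partial>lborel)"
    by (intro nn_integral_mono)
  then show ?thesis using fT_total[OF True] by simp
qed (auto simp: mT_def marg_def fT_def)

lemma fT_cont: "s \<in> {0..T} \<Longrightarrow> continuous_on UNIV (\<lambda>x. fT s x v)"
proof -
  assume s: "s \<in> {0..T}"
  have "continuous_on UNIV (\<lambda>x. (\<lambda>(t, x, v). f t x v) (s, x, v))"
    by (rule continuous_on_compose2[OF cont]) (use s in \<open>auto intro!: continuous_intros\<close>)
  then show ?thesis using s by (simp add: fT_eq)
qed

text \<open>The two junk values are harmless: a nonintegrable marginal (\<open>mT = 0\<close>) occurs only for a null set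
  of \<open>v\<close>, and where the marginal really vanishes so does the continuous function \<open>fT s \<cdot> v\<close>.\<close>

lemma mT_cond: "AE v in lborel. \<forall>x. mT s v * cond_dens fT s x v = fT s x v"
  using AE_integrable[of s]
proof eventually_elim
  case (elim v)
  show ?case
  proof
    fix x
    show "mT s v * cond_dens fT s x v = fT s x v"
    proof (cases "s \<in> {0..T} \<and> mT s v = 0")
      case True
      then have "(\<integral>x. fT s x v \<partial>lborel) = 0" unfolding mT_def marg_def by simp
      then have "AE x in lborel. fT s x v = 0"
        using integral_nonneg_eq_0_iff_AE[OF elim] fT_nonneg by auto
      then have "fT s x v = 0"
        using continuous_AE_zero_imp_zero[OF fT_cont] True by blast
      then show ?thesis by (simp add: cond_dens_def)
    next
      case False
      then show ?thesis unfolding cond_dens_def mT_def[symmetric]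
        by (auto simp: fT_def)
    qed
  qed
qed

end

section \<open>The intensity as an iterated integral\<close>

lemma borel_nn_integral_measurable:
  assumes "sigma_finite_measure M" "sets M = sets borel"
    and "(\<lambda>(x, y). h x y) \<in> borel_measurable (K \<Otimes>\<^sub>M borel)"
  shows "(\<lambda>x. \<integral>\<^sup>+y. h x y \<partial>M) \<in> borel_measurable K"
  using assms by (intro sigma_finite_measure.borel_measurable_nn_integral)
    (simp_all cong: measurable_cong_sets sets_pair_measure_cong)

lemma borel_nn_integral_swap:
  fixes M1 :: "'a::second_countable_topology measure" and M2 :: "'b::second_countable_topology measure"
  assumes "sigma_finite_measure M1" "sets M1 = sets borel" "sigma_finite_measure M2" "sets M2 = sets borel"
    and h: "(\<lambda>(x, y). h x y) \<in> borel_measurable (borel \<Otimes>\<^sub>M borel)"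
  shows "(\<integral>\<^sup>+x. \<integral>\<^sup>+y. h x y \<partial>M2 \<partial>M1) = (\<integral>\<^sup>+y. \<integral>\<^sup>+x. h x y \<partial>M1 \<partial>M2)"
proof -
  interpret pair_sigma_finite M1 M2 using assms by (intro pair_sigma_finite.intro)
  have "(\<lambda>(x, y). h x y) \<in> borel_measurable (M1 \<Otimes>\<^sub>M M2)"
    using h assms by (simp cong: measurable_cong_sets sets_pair_measure_cong)
  from Fubini'[OF this] show ?thesis by simp
qed

context kinetic begin

definition "timeM = density lborel (indicator {0..T} :: real \<Rightarrow> ennreal)"
definition "radM = density lborel (indicator {0..} :: real \<Rightarrow> ennreal)"
definition "base = lborel \<Otimes>\<^sub>M (Q \<Otimes>\<^sub>M (phi_measure \<Otimes>\<^sub>M (radM \<Otimes>\<^sub>M timeM)))"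
definition "\<nu> = intensity Q T (marg f)"

lemma sets_timeM [simp]: "sets timeM = sets borel" unfolding timeM_def by simp
lemma sets_radM [simp]: "sets radM = sets borel" unfolding radM_def by simp

sublocale timeM: sigma_finite_measure timeM unfolding timeM_def by (rule sigma_finite_indicator) auto
sublocale radM: sigma_finite_measure radM unfolding radM_def by (rule sigma_finite_indicator) auto

lemmas sf = timeM.sigma_finite_measure_axioms radM.sigma_finite_measure_axioms Q.sigma_finite_measure_axioms
  Phi.sigma_finite_measure_axioms coll.sigma_finite_measure_axioms

lemmas nn_meas [measurable (raw)] =
  borel_nn_integral_measurable[OF sf(1) sets_timeM] borel_nn_integral_measurable[OF sf(2) sets_radM]
  borel_nn_integral_measurable[OF sf(3) sets_Q] borel_nn_integral_measurable[OF sf(4) sets_phi]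
  borel_nn_integral_measurable[OF sf(5) sets_coll]

lemma sets_base: "sets base = sets borel"
  unfolding base_def by (intro sets_lborel_pair sets_Q sets_phi sets_radM sets_timeM) auto

lemma nn_integral_pair_borel:
  fixes M1 :: "'a::second_countable_topology measure" and M2 :: "'b::second_countable_topology measure"
  assumes "sets M1 = sets borel" "sigma_finite_measure M2" "sets M2 = sets borel" "h \<in> borel_measurable borel"
  shows "(\<integral>\<^sup>+p. h p \<partial>(M1 \<Otimes>\<^sub>M M2)) = (\<integral>\<^sup>+x. \<integral>\<^sup>+y. h (x, y) \<partial>M2 \<partial>M1)"
proof -
  have "h \<in> borel_measurable (M1 \<Otimes>\<^sub>M M2)"
    using assms(4) measurable_cong_sets[OF sets_lborel_pair[OF assms(1,3)] refl] by blast
  from sigma_finite_measure.nn_integral_fst[OF assms(2) this] show ?thesis by simp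
qed

text \<open>The order is chosen for use: time outermost, because position and velocity will be
  functions of \<open>s\<close>, and \<open>r\<close> innermost, to be integrated out at fixed time
  and collision parameters.\<close>

lemma nn_integral_base:
  fixes h :: "noise_pt \<Rightarrow> ennreal"
  assumes h [measurable]: "h \<in> borel_measurable borel"
  shows "(\<integral>\<^sup>+p. h p \<partial>base) = (\<integral>\<^sup>+s. \<integral>\<^sup>+q. \<integral>\<^sup>+r. h (fst q, fst (snd q), snd (snd q), r, s) \<partial>radM \<partial>coll_measure Q \<partial>timeM)"
proof -
  have "(\<integral>\<^sup>+p. h p \<partial>base) = (\<integral>\<^sup>+v. \<integral>\<^sup>+\<theta>. \<integral>\<^sup>+\<phi>. \<integral>\<^sup>+r. \<integral>\<^sup>+s. h (v, \<theta>, \<phi>, r, s) \<partial>timeM \<partial>radM \<partial>phi_measure \<partial>Q \<partial>lborel)"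
    unfolding base_def
    by (subst nn_integral_pair_borel, (auto intro!: nn_integral_cong sigma_finite_pair_measure sf sets_lborel_pair sets_Q sets_phi)[4])+
       simp
  also have "\<dots> = (\<integral>\<^sup>+q. \<integral>\<^sup>+r. \<integral>\<^sup>+s. h (fst q, fst (snd q), snd (snd q), r, s) \<partial>timeM \<partial>radM \<partial>coll_measure Q)"
    by (subst nn_integral_coll) auto
  also have "\<dots> = (\<integral>\<^sup>+q. \<integral>\<^sup>+s. \<integral>\<^sup>+r. h (fst q, fst (snd q), snd (snd q), r, s) \<partial>radM \<partial>timeM \<partial>coll_measure Q)"
    by (intro nn_integral_cong borel_nn_integral_swap sf sets_timeM sets_radM) measurable
  also have "\<dots> = (\<integral>\<^sup>+s. \<integral>\<^sup>+q. \<integral>\<^sup>+r. h (fst q, fst (snd q), snd (snd q), r, s) \<partial>radM \<partial>coll_measure Q \<partial>timeM)"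
    by (intro borel_nn_integral_swap sf sets_timeM sets_coll) measurable
  finally show ?thesis .
qed

lemma AE_timeM: "AE s in timeM. 0 \<le> s \<and> s \<le> T"
  unfolding timeM_def by (subst AE_density) (auto simp: indicator_def)

lemma AE_base_iterated:
  assumes P: "{p. \<not> P p} \<in> sets borel"
    and AE: "AE s in timeM. AE q in coll_measure Q. AE r in radM. P (fst q, fst (snd q), snd (snd q), r, s)"
  shows "AE p in base. P p"
proof -
  let ?S = "{p. \<not> P p}"
  have "emeasure base ?S = (\<integral>\<^sup>+p. indicator ?S p \<partial>base)"
    by (rule nn_integral_indicator[symmetric]) (simp only: sets_base P)
  also have "\<dots> = (\<integral>\<^sup>+s. \<integral>\<^sup>+q. \<integral>\<^sup>+r. indicator ?S (fst q, fst (snd q), snd (snd q), r, s) \<partial>radM \<partial>coll_measure Q \<partial>timeM)"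
    using P by (intro nn_integral_base) auto
  also have "\<dots> = (\<integral>\<^sup>+s. 0 \<partial>timeM)"
  proof (rule nn_integral_cong_AE)
    show "AE s in timeM. (\<integral>\<^sup>+q. \<integral>\<^sup>+r. indicator ?S (fst q, fst (snd q), snd (snd q), r, s) \<partial>radM \<partial>coll_measure Q) = 0"
      using AE
    proof eventually_elim
      case (elim s)
      then have "AE q in coll_measure Q. (\<integral>\<^sup>+r. indicator ?S (fst q, fst (snd q), snd (snd q), r, s) \<partial>radM) = 0"
      proof eventually_elim
        case (elim q)
        then have "AE r in radM. indicator ?S (fst q, fst (snd q), snd (snd q), r, s) = (0 :: ennreal)"
          by eventually_elim simp
        from nn_integral_cong_AE[OF this] show ?case by simp
      qed
      from nn_integral_cong_AE[OF this] show ?case by simp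
    qed
  qed
  finally have "?S \<in> null_sets base" using P sets_base by auto
  from AE_not_in[OF this] show ?thesis by simp
qed

lemma AE_base_time: "AE p in base. 0 \<le> tm p \<and> tm p \<le> T"
proof (rule AE_base_iterated)
  have "{p\<in>space borel. \<not> (0 \<le> tm p \<and> tm p \<le> T)} \<in> sets (borel :: noise_pt measure)"
    by measurable
  then show "{p :: noise_pt. \<not> (0 \<le> tm p \<and> tm p \<le> T)} \<in> sets borel" by simp
qed (rule eventually_mono[OF AE_timeM], simp)

text \<open>Outside \<open>[0, T]\<close> the function \<open>f\<close> is arbitrary, so the density defining the intensity
  need not be measurable there; it may be replaced by \<open>mT\<close> because the lower integral
  defining \<open>density\<close> ignores null sets.\<close>

lemma \<nu>_eq: "\<nu> = density base (\<lambda>p. ennreal (mT (tm p) (fst p)))"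
proof -
  have AE: "AE p in base. (case p of (v, \<theta>, \<phi>, r, s) \<Rightarrow> ennreal (marg f s v)) = ennreal (mT (tm p) (fst p))"
    using AE_base_time by eventually_elim (auto simp: mT_eq split: prod.split)
  have "\<nu> = density base (\<lambda>(v, \<theta>, \<phi>, r, s). ennreal (marg f s v))"
    unfolding \<nu>_def intensity_def base_def radM_def timeM_def ..
  also have "\<dots> = density base (\<lambda>p. ennreal (mT (tm p) (fst p)))"
    unfolding density_def
    by (intro arg_cong2[where f="measure_of (space base)"] refl ext nn_integral_cong_AE)
       (use AE in \<open>eventually_elim, simp\<close>)
  finally show ?thesis .
qed

lemma sets_\<nu>: "sets \<nu> = sets borel"
  unfolding \<nu>_eq using sets_base by simp

lemma AE_\<nu>:
  assumes "AE p in base. P p" shows "AE p in \<nu>. P p"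
proof -
  have "(\<lambda>p. ennreal (mT (tm p) (fst p))) \<in> borel_measurable base"
    by (subst measurable_cong_sets[OF sets_base refl]) measurable
  from AE_density[OF this] show ?thesis unfolding \<nu>_eq using assms by (auto elim: eventually_mono)
qed

lemma nn_integral_\<nu>:
  fixes h :: "noise_pt \<Rightarrow> ennreal"
  assumes h [measurable]: "h \<in> borel_measurable borel"
  shows "(\<integral>\<^sup>+p. h p \<partial>\<nu>) = (\<integral>\<^sup>+s. \<integral>\<^sup>+q. \<integral>\<^sup>+r. ennreal (mT s (fst q)) * h (fst q, fst (snd q), snd (snd q), r, s)
      \<partial>radM \<partial>coll_measure Q \<partial>timeM)"
proof -
  have b: "measurable base K = measurable borel K" for K by (rule measurable_cong_sets[OF sets_base refl])
  have "(\<integral>\<^sup>+p. h p \<partial>\<nu>) = (\<integral>\<^sup>+p. ennreal (mT (tm p) (fst p)) * h p \<partial>base)"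
    unfolding \<nu>_eq by (rule nn_integral_density) (auto simp: b)
  also have "\<dots> = (\<integral>\<^sup>+s. \<integral>\<^sup>+q. \<integral>\<^sup>+r. ennreal (mT s (fst q)) * h (fst q, fst (snd q), snd (snd q), r, s)
      \<partial>radM \<partial>coll_measure Q \<partial>timeM)"
    by (subst nn_integral_base) auto
  finally show ?thesis .
qed

lemma AE_coll_fst:
  assumes "AE v in lborel. P v"
  shows "AE q in coll_measure Q. P (fst q)"
proof -
  obtain N where N: "{v\<in>space lborel. \<not> P v} \<subseteq> N" "emeasure lborel N = 0" "N \<in> sets lborel"
    using assms by (rule AE_E)
  have "(\<lambda>x. fst x) -` N \<inter> space borel \<in> sets (borel :: (vec3 \<times> real \<times> real) measure)"
    by (rule measurable_sets[where A=borel]) (use N in auto)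
  then have "{q :: vec3 \<times> real \<times> real. \<not> fst q \<notin> N} \<in> sets borel" by (simp add: vimage_def)
  moreover have "N \<in> null_sets lborel" using N by auto
  ultimately have "AE q in coll_measure Q. fst q \<notin> N"
    using AE_not_in[of N lborel] by (intro AE_coll_iterated) auto
  then show ?thesis by eventually_elim (use N(1) in auto)
qed

text \<open>The threshold in (S) up to which a noise point is accepted, with \<open>fT\<close> in
  place of \<open>f\<close>.\<close>

definition "rate s x z v = \<sigma> (norm (z - v)) * cond_dens fT s x v"

lemma rate_meas [measurable (raw)]:
  assumes [measurable]: "s \<in> borel_measurable K" "x \<in> borel_measurable K" "z \<in> borel_measurable K" "v \<in> borel_measurable K"
  shows "(\<lambda>w. rate (s w) (x w) (z w) (v w)) \<in> borel_measurable K"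
  unfolding rate_def cond_dens_def mT_def[symmetric] by measurable

lemma rate_nonneg: "0 \<le> rate s x z v"
  unfolding rate_def cond_dens_def mT_def[symmetric]
  by (intro mult_nonneg_nonneg divide_nonneg_nonneg \<sigma>_nonneg fT_nonneg mT_nonneg) auto

text \<open>The accepted \<open>r\<close> form an interval of length \<open>rate\<close>. For almost
  every \<open>v\<close>, \<open>mT_cond\<close> then cancels the marginal against the denominator
  of the conditional density.\<close>

lemma rate_slice:
  fixes k :: "vec3 \<times> real \<times> real \<Rightarrow> real"
  assumes [measurable]: "k \<in> borel_measurable borel" and k0: "\<And>q. 0 \<le> k q"
  shows "(\<integral>\<^sup>+q. \<integral>\<^sup>+r. ennreal (mT s (fst q)) * ennreal (indicator {0..rate s x z (fst q)} r * k q) \<partial>radM \<partial>coll_measure Q)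
    = (\<integral>\<^sup>+q. ennreal (k q * fT s x (fst q) * \<sigma> (norm (z - fst q))) \<partial>coll_measure Q)"
proof (rule nn_integral_cong_AE)
  have r: "(\<integral>\<^sup>+r. ennreal (indicator {0..a} r) \<partial>radM) = ennreal a" if "0 \<le> a" for a
  proof -
    have "(\<integral>\<^sup>+r. ennreal (indicator {0..a} r) \<partial>radM) = (\<integral>\<^sup>+r. indicator {0..} r * ennreal (indicator {0..a} r) \<partial>lborel)"
      unfolding radM_def by (rule nn_integral_density) auto
    also have "\<dots> = (\<integral>\<^sup>+r. indicator {0..a} r \<partial>lborel)"
      by (rule nn_integral_cong) (auto simp: indicator_def)
    finally have "(\<integral>\<^sup>+r. ennreal (indicator {0..a} r) \<partial>radM) = (\<integral>\<^sup>+r. indicator {0..a} r \<partial>lborel)" .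
    then show ?thesis using that by simp
  qed
  show "AE q in coll_measure Q. (\<integral>\<^sup>+r. ennreal (mT s (fst q)) * ennreal (indicator {0..rate s x z (fst q)} r * k q) \<partial>radM)
      = ennreal (k q * fT s x (fst q) * \<sigma> (norm (z - fst q)))"
    using AE_coll_fst[OF mT_cond[of s]]
  proof eventually_elim
    case (elim q)
    have "(\<integral>\<^sup>+r. ennreal (mT s (fst q)) * ennreal (indicator {0..rate s x z (fst q)} r * k q) \<partial>radM)
        = (\<integral>\<^sup>+r. ennreal (mT s (fst q) * k q) * ennreal (indicator {0..rate s x z (fst q)} r) \<partial>radM)"
      using k0 mT_nonneg by (intro nn_integral_cong) (auto simp: indicator_def ennreal_mult)
    also have "\<dots> = ennreal (mT s (fst q) * k q) * ennreal (rate s x z (fst q))"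
      using rate_nonneg by (subst nn_integral_cmult) (auto simp: r measurable_cong_sets[OF sets_radM refl])
    also have "\<dots> = ennreal (k q * (mT s (fst q) * cond_dens fT s x (fst q)) * \<sigma> (norm (z - fst q)))"
      using k0 mT_nonneg rate_nonneg by (subst ennreal_mult[symmetric]) (auto simp: rate_def mult_ac)
    finally show ?case using elim by simp
  qed
qed

text \<open>Along fixed paths \<open>x\<close> and \<open>z\<close> the intensity becomes the
  collision rate; the paths will be the left limits of one sample path.\<close>

lemma nn_integral_\<nu>_rate:
  fixes G :: "real \<Rightarrow> vec3 \<times> real \<times> real \<Rightarrow> real" and x z :: "real \<Rightarrow> vec3"
  assumes G [measurable]: "(\<lambda>w. G (fst w) (snd w)) \<in> borel_measurable borel" and G0: "\<And>s q. 0 \<le> G s q"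
    and [measurable]: "x \<in> borel_measurable borel" "z \<in> borel_measurable borel"
  shows "(\<integral>\<^sup>+p. (case p of (v, \<theta>, \<phi>, r, s) \<Rightarrow> ennreal (indicator {0..rate s (x s) (z s) v} r * G s (v, \<theta>, \<phi>))) \<partial>\<nu>)
    = (\<integral>\<^sup>+s. \<integral>\<^sup>+q. ennreal (G s q * fT s (x s) (fst q) * \<sigma> (norm (z s - fst q))) \<partial>coll_measure Q \<partial>timeM)"
proof -
  have Gm [measurable (raw)]: "(\<lambda>w. G (a w) (b w)) \<in> borel_measurable K"
    if [measurable]: "a \<in> borel_measurable K" "b \<in> borel_measurable K" for a b and K :: "'k measure"
    using measurable_compose[OF _ G, of "\<lambda>w. (a w, b w)" K] by simp
  have Gs: "G s \<in> borel_measurable borel" for s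
    using Gm[of "\<lambda>_. s" borel "\<lambda>q. q"] by simp
  have ind: "indicator {0..a} r = (if 0 \<le> r \<and> r \<le> a then 1 else 0 :: real)" for a r by auto
  have "(\<lambda>p :: noise_pt. ennreal (indicator {0..rate (tm p) (x (tm p)) (z (tm p)) (fst p)} (fst (snd (snd (snd p))))
      * G (tm p) (fst p, fst (snd p), fst (snd (snd p))))) \<in> borel_measurable borel"
    unfolding ind by measurable
  then show ?thesis
    by (simp add: split_beta' nn_integral_\<nu>) (rule nn_integral_cong, rule rate_slice[OF Gs G0])
qed

end

section \<open>Truncated marks of finite rate\<close>

context kinetic begin

lemma measurable_timeM [simp]: "measurable timeM K = measurable borel K"
  by (rule measurable_cong_sets[OF sets_timeM refl])

lemma measurable_radM [simp]: "measurable radM K = measurable borel K"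
  by (rule measurable_cong_sets[OF sets_radM refl])

text \<open>Only \<theta> and \<open>r\<close> are truncated: \<open>Q\<close> is finite away from 0
  and \<open>r\<close> has Lebesgue measure. The variable \<open>v\<close> stays free because
  \<open>mT s\<close> has mass at most 1, and \<phi> contributes 2 pi; the product of these bounds
  is \<open>mark_rate\<close>.\<close>

definition "marks k = {q :: vec3 \<times> real \<times> real \<times> real. inverse (real (Suc k)) \<le> fst (snd q) \<and> fst (snd q) \<le> pi
   \<and> 0 \<le> snd (snd (snd q)) \<and> snd (snd (snd q)) \<le> real (Suc k)}"
definition "mark_rate k = measure Q {inverse (real (Suc k))..pi} * (2 * pi) * real (Suc k)"

lemma marks_meas: "marks k \<in> sets borel"
proof -
  have "{q\<in>space borel. inverse (real (Suc k)) \<le> fst (snd q) \<and> fst (snd q) \<le> pi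
   \<and> 0 \<le> snd (snd (snd q)) \<and> snd (snd (snd q)) \<le> real (Suc k)} \<in> sets (borel :: (vec3 \<times> real \<times> real \<times> real) measure)"
    by measurable
  then show ?thesis unfolding marks_def by simp
qed

lemma marks_inc: "incseq marks"
proof (rule incseq_SucI, rule subsetI)
  fix k q assume "q \<in> marks k"
  moreover have "inverse (real (Suc (Suc k))) \<le> inverse (real (Suc k))" by (simp add: field_simps)
  moreover have "real (Suc k) \<le> real (Suc (Suc k))" by simp
  ultimately show "q \<in> marks (Suc k)" unfolding marks_def mem_Collect_eq by (metis order_trans)
qed

lemma emeasure_Q_Icc: "emeasure Q {inverse (real (Suc k))..pi} = ennreal (measure Q {inverse (real (Suc k))..pi})"
proof -
  have "emeasure Q {inverse (real (Suc k))..pi} < \<infinity>"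
    using A' unfolding hypA'_def by (simp add: inverse_positive_iff_positive)
  then show ?thesis by (intro emeasure_eq_ennreal_measure) auto
qed

lemma nu_slab_bound:
  assumes "0 \<le> s" "s \<le> t" "t \<le> T"
  shows "emeasure \<nu> (time_slab (marks k) {s<..t}) \<le> ennreal (mark_rate k * (t - s))"
proof -
  let ?S = "time_slab (marks k) {s<..t}" and ?E = "{inverse (real (Suc k))..pi}"
  have S: "?S \<in> sets borel" by (intro measurable_time_slab marks_meas) auto
  have r: "(\<integral>\<^sup>+r. indicator {0..real (Suc k)} r \<partial>radM) \<le> ennreal (real (Suc k))"
  proof -
    have "(\<integral>\<^sup>+r. indicator {0..real (Suc k)} r \<partial>radM) = emeasure radM {0..real (Suc k)}" by simp
    also have "\<dots> = (\<integral>\<^sup>+r. indicator {0..} r * indicator {0..real (Suc k)} r \<partial>lborel)"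
      unfolding radM_def by (rule emeasure_density) auto
    also have "\<dots> \<le> (\<integral>\<^sup>+r. indicator {0..real (Suc k)} r \<partial>lborel)"
      by (intro nn_integral_mono) (auto simp: indicator_def)
    finally show ?thesis by simp
  qed
  have tt: "(\<integral>\<^sup>+u. indicator {s<..t} u \<partial>timeM) \<le> ennreal (t - s)"
  proof -
    have "(\<integral>\<^sup>+u. indicator {s<..t} u \<partial>timeM) = emeasure timeM {s<..t}" by simp
    also have "\<dots> = (\<integral>\<^sup>+u. indicator {0..T} u * indicator {s<..t} u \<partial>lborel)"
      unfolding timeM_def by (rule emeasure_density) auto
    also have "\<dots> \<le> (\<integral>\<^sup>+u. indicator {s<..t} u \<partial>lborel)"
      by (intro nn_integral_mono) (auto simp: indicator_def)
    finally show ?thesis using assms by simp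
  qed
  have "emeasure \<nu> ?S = (\<integral>\<^sup>+p. indicator ?S p \<partial>\<nu>)"
    by (rule nn_integral_indicator[symmetric]) (simp only: sets_\<nu> S)
  also have "\<dots> = (\<integral>\<^sup>+u. \<integral>\<^sup>+q. \<integral>\<^sup>+r. ennreal (mT u (fst q)) * indicator ?S (fst q, fst (snd q), snd (snd q), r, u)
      \<partial>radM \<partial>coll_measure Q \<partial>timeM)"
    using S by (intro nn_integral_\<nu>) auto
  also have "\<dots> = (\<integral>\<^sup>+u. \<integral>\<^sup>+q. \<integral>\<^sup>+r. (indicator {s<..t} u * (ennreal (mT u (fst q)) * indicator ?E (fst (snd q)))) * indicator {0..real (Suc k)} r
      \<partial>radM \<partial>coll_measure Q \<partial>timeM)"
    by (intro nn_integral_cong) (auto simp: time_slab_def marks_def indicator_def)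
  also have "\<dots> \<le> (\<integral>\<^sup>+u. \<integral>\<^sup>+q. (indicator {s<..t} u * (ennreal (mT u (fst q)) * indicator ?E (fst (snd q)))) * ennreal (real (Suc k))
      \<partial>coll_measure Q \<partial>timeM)"
    using r by (intro nn_integral_mono) (subst nn_integral_cmult, auto intro!: mult_left_mono simp del: of_nat_Suc)
  also have "\<dots> = (\<integral>\<^sup>+u. indicator {s<..t} u * (\<integral>\<^sup>+q. ennreal (mT u (fst q)) * (indicator ?E (fst (snd q)) * ennreal (real (Suc k)))
      \<partial>coll_measure Q) \<partial>timeM)"
    by (intro nn_integral_cong) (simp add: nn_integral_cmult mult.assoc)
  also have "\<dots> \<le> (\<integral>\<^sup>+u. indicator {s<..t} u * ennreal (mark_rate k) \<partial>timeM)"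
  proof (intro nn_integral_mono mult_left_mono)
    fix u
    have "(\<integral>\<^sup>+q. ennreal (mT u (fst q)) * (indicator ?E (fst (snd q)) * ennreal (real (Suc k))) \<partial>coll_measure Q)
      = (\<integral>\<^sup>+v. \<integral>\<^sup>+\<theta>. \<integral>\<^sup>+\<phi>. ennreal (mT u v) * (indicator ?E \<theta> * ennreal (real (Suc k))) \<partial>phi_measure \<partial>Q \<partial>lborel)"
      by (subst nn_integral_coll) auto
    also have "\<dots> = (\<integral>\<^sup>+v. ennreal (mT u v) * (emeasure Q ?E * (ennreal (real (Suc k)) * ennreal (2 * pi))) \<partial>lborel)"
    proof (intro nn_integral_cong)
      fix v
      have "(\<integral>\<^sup>+\<theta>. \<integral>\<^sup>+\<phi>. ennreal (mT u v) * (indicator ?E \<theta> * ennreal (real (Suc k))) \<partial>phi_measure \<partial>Q)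
        = (\<integral>\<^sup>+\<theta>. (ennreal (mT u v) * (ennreal (real (Suc k)) * ennreal (2 * pi))) * indicator ?E \<theta> \<partial>Q)"
        by (intro nn_integral_cong) (simp add: emeasure_phi sets_eq_imp_space_eq[OF sets_phi] mult_ac)
      also have "\<dots> = ennreal (mT u v) * (emeasure Q ?E * (ennreal (real (Suc k)) * ennreal (2 * pi)))"
        by (subst nn_integral_cmult_indicator) (auto simp: sets_Q mult_ac)
      finally show "(\<integral>\<^sup>+\<theta>. \<integral>\<^sup>+\<phi>. ennreal (mT u v) * (indicator ?E \<theta> * ennreal (real (Suc k))) \<partial>phi_measure \<partial>Q)
        = ennreal (mT u v) * (emeasure Q ?E * (ennreal (real (Suc k)) * ennreal (2 * pi)))" .
    qed
    also have "\<dots> = (\<integral>\<^sup>+v. ennreal (mT u v) \<partial>lborel) * (emeasure Q ?E * (ennreal (real (Suc k)) * ennreal (2 * pi)))"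
      by (rule nn_integral_multc) auto
    also have "\<dots> \<le> 1 * (emeasure Q ?E * (ennreal (real (Suc k)) * ennreal (2 * pi)))"
      by (intro mult_right_mono mT_le_1) auto
    also have "\<dots> = ennreal (mark_rate k)"
      unfolding emeasure_Q_Icc mark_rate_def by (simp add: ennreal_mult[symmetric] mult_ac del: of_nat_Suc ennreal_plus)
    finally show "(\<integral>\<^sup>+q. ennreal (mT u (fst q)) * (indicator ?E (fst (snd q)) * ennreal (real (Suc k))) \<partial>coll_measure Q)
      \<le> ennreal (mark_rate k)" .
  qed auto
  also have "\<dots> = (\<integral>\<^sup>+u. indicator {s<..t} u \<partial>timeM) * ennreal (mark_rate k)"
    by (rule nn_integral_multc) auto
  also have "\<dots> \<le> ennreal (t - s) * ennreal (mark_rate k)"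
    by (intro mult_right_mono tt) auto
  also have "\<dots> = ennreal (mark_rate k * (t - s))"
    using assms by (subst ennreal_mult[symmetric]) (auto simp: mark_rate_def mult_ac)
  finally show ?thesis .
qed

lemma AE_timeM': "AE s in timeM. 0 < s \<and> s \<le> T"
proof -
  have "AE s in lborel. s \<noteq> (0::real)" by (rule AE_lborel_singleton)
  then show ?thesis unfolding timeM_def by (subst AE_density) (auto elim!: eventually_mono simp: indicator_def)
qed

lemma marks_cover: "AE p in \<nu>. p \<in> (\<Union>k. time_slab (marks k) {0<..T})"
proof -
  define S where "S = - (\<Union>k. time_slab (marks k) {0<..T})"
  have S: "S \<in> sets borel" unfolding S_def using marks_meas by (intro borel_comp sets.countable_UN) (auto intro!: measurable_time_slab)
  have notS: "(fst q, fst (snd q), snd (snd q), r, u) \<notin> S"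
    if "0 < u" "u \<le> T" "0 < fst (snd q)" "fst (snd q) \<le> pi" "0 \<le> r" for u r and q :: "vec3 \<times> real \<times> real"
  proof -
    obtain n :: nat where n: "max r (inverse (fst (snd q))) < real n" using reals_Archimedean2 by blast
    have "inverse (real (Suc n)) \<le> inverse (inverse (fst (snd q)))"
      using n that by (intro le_imp_inverse_le) auto
    then have "(fst q, fst (snd q), snd (snd q), r, u) \<in> time_slab (marks n) {0<..T}"
      using n that by (auto simp: time_slab_def marks_def)
    then show ?thesis unfolding S_def by auto
  qed
  have "AE r in radM. 0 \<le> r" unfolding radM_def by (subst AE_density) (auto simp: indicator_def)
  then have "AE r in radM. (fst q, fst (snd q), snd (snd q), r, u) \<notin> S"
    if "0 < u \<and> u \<le> T" "0 < fst (snd q) \<and> fst (snd q) \<le> pi" for u and q :: "vec3 \<times> real \<times> real"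
    by eventually_elim (use that notS in blast)
  then have "AE u in timeM. AE q in coll_measure Q. AE r in radM. (fst q, fst (snd q), snd (snd q), r, u) \<notin> S"
    by (intro eventually_mono[OF AE_timeM'] eventually_mono[OF AE_coll])
  then have "AE p in \<nu>. p \<notin> S" using S by (intro AE_\<nu> AE_base_iterated) auto
  then show ?thesis unfolding S_def by simp
qed

lemma poisson_noise_intensity:
  "stochastic_basis M F T \<Longrightarrow> adapted_PRM M F T \<nu> N \<Longrightarrow> poisson_noise M F T \<nu> N marks mark_rate"
  using sets_\<nu> T marks_meas marks_inc nu_slab_bound marks_cover by unfold_locales

text \<open>Lebesgue measure in time has no atoms. This excludes jumps at a prescribed time, so that
  \<open>Z\<close> and its left limit agree there almost surely.\<close>

lemma nu_time_null: "emeasure \<nu> {p. tm p = u} = 0"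
proof -
  have "{p\<in>space borel. tm p = u} \<in> sets (borel :: noise_pt measure)" by measurable
  then have S: "{p. tm p = u} \<in> sets borel" by simp
  have "AE w in lborel. w \<noteq> u" by (rule AE_lborel_singleton)
  then have "AE w in timeM. w \<noteq> u" unfolding timeM_def by (subst AE_density) (auto elim!: eventually_mono)
  then have "AE p in \<nu>. tm p \<noteq> u"
    using S by (intro AE_\<nu> AE_base_iterated) (auto elim!: eventually_mono)
  then show ?thesis
    using S sets_\<nu> sets_eq_imp_space_eq[OF sets_\<nu>] by (subst (asm) AE_iff_measurable[where N="{p. tm p = u}"]) auto
qed

section \<open>Moments of the density and the size of collisions\<close>

lemma second_moment_bound:
  obtains b where "0 \<le> b" "\<And>s x. s \<in> {0..T} \<Longrightarrow> (\<integral>\<^sup>+v. ennreal ((norm v)\<^sup>2 * fT s x v) \<partial>lborel) \<le> ennreal b"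
proof -
  have c: "continuous_on {0..T} (\<lambda>t. enn2real (moment_B2 T f t))" and fin: "\<And>t. t \<in> {0..T} \<Longrightarrow> moment_B2 T f t < \<infinity>"
    using B2 unfolding hypB2_def by auto
  \<comment> \<open>(B2) contains the supremum over \<open>x\<close>; continuity on the compact
    interval makes the bound uniform in time as well.\<close>
  have "bounded ((\<lambda>t. enn2real (moment_B2 T f t)) ` {0..T})"
    by (intro compact_imp_bounded compact_continuous_image c) auto
  then obtain b where "0 < b" "\<forall>y\<in>(\<lambda>t. enn2real (moment_B2 T f t)) ` {0..T}. norm y \<le> b"
    unfolding bounded_pos by blast
  then have b: "\<bar>enn2real (moment_B2 T f t)\<bar> \<le> b" "0 < b" if "t \<in> {0..T}" for t
    using that by auto
  show ?thesis
  proof (rule that)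
    fix s x assume s: "s \<in> {0..T}"
    have "(\<integral>\<^sup>+v. ennreal ((norm v)\<^sup>2 * fT s x v) \<partial>lborel) \<le> moment_B2 T f s"
      unfolding moment_B2_def fT_eq[OF s] by (rule SUP_upper) simp
    also have "\<dots> = ennreal (enn2real (moment_B2 T f s))" using fin[OF s] by simp
    also have "\<dots> \<le> ennreal b" using b(1)[OF s] by (intro ennreal_leI) auto
    finally show "(\<integral>\<^sup>+v. ennreal ((norm v)\<^sup>2 * fT s x v) \<partial>lborel) \<le> ennreal b" .
  qed (use \<open>0 < b\<close> in auto)
qed

text \<open>For \<open>norm v \<le> 1\<close> continuity on a compact set bounds \<open>f\<close>;
  for larger \<open>v\<close> the second moment dominates the mass. The bound depends on \<rho>,
  which will be the size of the support of a test function.\<close>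

lemma mass_bound:
  obtains D where "0 \<le> D" "\<And>s x. s \<in> {0..T} \<Longrightarrow> norm x \<le> \<rho> \<Longrightarrow> (\<integral>\<^sup>+v. ennreal (fT s x v) \<partial>lborel) \<le> ennreal D"
proof -
  obtain b where b: "0 \<le> b" "\<And>s x. s \<in> {0..T} \<Longrightarrow> (\<integral>\<^sup>+v. ennreal ((norm v)\<^sup>2 * fT s x v) \<partial>lborel) \<le> ennreal b"
    by (rule second_moment_bound) blast
  have "bounded ((\<lambda>(t, x, v). f t x v) ` ({0..T} \<times> cball (0::vec3) \<rho> \<times> cball (0::vec3) 1))"
    by (intro compact_imp_bounded compact_continuous_image continuous_on_subset[OF cont] compact_Times) auto
  then obtain K where K0: "0 < K" and KK: "\<forall>y\<in>(\<lambda>(t, x, v). f t x v) ` ({0..T} \<times> cball (0::vec3) \<rho> \<times> cball (0::vec3) 1). norm y \<le> K"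
    unfolding bounded_pos by blast
  have K: "\<bar>f t x v\<bar> \<le> K" if "t \<in> {0..T}" "norm x \<le> \<rho>" "norm v \<le> 1" for t x v
  proof -
    have "(t, x, v) \<in> {0..T} \<times> cball (0::vec3) \<rho> \<times> cball (0::vec3) 1" using that by simp
    then show ?thesis using KK by fastforce
  qed
  define V where "V = measure lborel (cball (0::vec3) 1)"
  have V: "emeasure lborel (cball (0::vec3) 1) = ennreal V"
    unfolding V_def using emeasure_lborel_cball_finite[of "0::vec3" 1] by (intro emeasure_eq_ennreal_measure) auto
  show ?thesis
  proof (rule that)
    show "0 \<le> K * V + b" using K0 b unfolding V_def by auto
    fix s :: real and x :: vec3 assume s: "s \<in> {0..T}" and x: "norm x \<le> \<rho>"
    have "ennreal (fT s x v) \<le> ennreal K * indicator (cball 0 1) v + ennreal ((norm v)\<^sup>2 * fT s x v)" for v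
    proof (cases "norm v \<le> 1")
      case True
      have "ennreal (fT s x v) \<le> ennreal K" using K[OF s x True] by (intro ennreal_leI) (simp add: fT_eq[OF s])
      then show ?thesis using True by (simp add: add_increasing2)
    next
      case False
      then have "1 \<le> (norm v)\<^sup>2" by simp
      then have "fT s x v \<le> (norm v)\<^sup>2 * fT s x v" using mult_right_mono[OF _ fT_nonneg[of s x v], of 1] by simp
      from ennreal_leI[OF this] show ?thesis using False by simp
    qed
    then have "(\<integral>\<^sup>+v. ennreal (fT s x v) \<partial>lborel) \<le> (\<integral>\<^sup>+v. ennreal K * indicator (cball 0 1) v + ennreal ((norm v)\<^sup>2 * fT s x v) \<partial>lborel)"
      by (rule nn_integral_mono)
    also have "\<dots> = ennreal K * ennreal V + (\<integral>\<^sup>+v. ennreal ((norm v)\<^sup>2 * fT s x v) \<partial>lborel)"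
    proof -
      have [measurable]: "(indicator (cball (0::vec3) 1) :: vec3 \<Rightarrow> ennreal) \<in> borel_measurable borel"
        by (rule borel_measurable_indicator) auto
      have "(\<lambda>v. ennreal K * indicator (cball (0::vec3) 1) v) \<in> borel_measurable borel"
        by (intro borel_measurable_times_ennreal) measurable
      then show ?thesis
        by (subst nn_integral_add) (auto simp: nn_integral_cmult_indicator V)
    qed
    also have "\<dots> \<le> ennreal K * ennreal V + ennreal b" by (intro add_left_mono b s)
    also have "\<dots> = ennreal (K * V + b)" using K0 b unfolding V_def by (simp add: ennreal_mult)
    finally show "(\<integral>\<^sup>+v. ennreal (fT s x v) \<partial>lborel) \<le> ennreal (K * V + b)" .
  qed
qed

definition "\<Delta> \<psi> x z q = \<psi> (x, zstar I J z (fst q) (fst (snd q)) (snd (snd q))) - \<psi> (x, z)" for \<psi> :: "vec3 \<times> vec3 \<Rightarrow> real"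

lemma \<Delta>_meas [measurable (raw)]:
  assumes [measurable]: "\<psi> \<in> borel_measurable borel" "x \<in> borel_measurable K" "z \<in> borel_measurable K" "q \<in> borel_measurable K"
  shows "(\<lambda>w. \<Delta> \<psi> (x w) (z w) (q w)) \<in> borel_measurable K"
  unfolding \<Delta>_def zstar_def by measurable

text \<open>The Lipschitz bound with \<open>alpha_bound\<close> gives \<theta>|z-v|, the hard-sphere
  rate a second |z-v|. Splitting |z-v|^2 into 2|z|^2 + 2|v|^2 leaves the mass bound \<open>D\<close>
  and the second moment bound \<open>b\<close>, hence growth quadratic in \<open>z\<close>.\<close>

lemma collision_bound:
  assumes \<psi> [measurable]: "\<psi> \<in> borel_measurable borel" and lip: "\<And>a b. \<bar>\<psi> a - \<psi> b\<bar> \<le> L * norm (a - b)" and L: "0 \<le> L"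
    and supp: "\<And>x z. \<psi> (x, z) \<noteq> 0 \<Longrightarrow> norm x \<le> \<rho>"
  obtains C where "0 \<le> C" "\<And>s x z. s \<in> {0..T} \<Longrightarrow>
     (\<integral>\<^sup>+q. ennreal (\<bar>\<Delta> \<psi> x z q\<bar> * fT s x (fst q) * \<sigma> (norm (z - fst q))) \<partial>coll_measure Q) \<le> ennreal (C * (1 + (norm z)\<^sup>2))"
proof -
  obtain b where b: "0 \<le> b" "\<And>s x. s \<in> {0..T} \<Longrightarrow> (\<integral>\<^sup>+v. ennreal ((norm v)\<^sup>2 * fT s x v) \<partial>lborel) \<le> ennreal b"
    by (rule second_moment_bound) blast
  obtain D where D: "0 \<le> D" "\<And>s x. s \<in> {0..T} \<Longrightarrow> norm x \<le> \<rho> \<Longrightarrow> (\<integral>\<^sup>+v. ennreal (fT s x v) \<partial>lborel) \<le> ennreal D"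
    by (rule mass_bound) blast
  obtain c where c: "c > 0" "\<And>r. \<sigma> r = c * r" using \<sigma> by blast
  define \<Theta> where "\<Theta> = enn2real (\<integral>\<^sup>+\<theta>. ennreal \<theta> \<partial>Q)"
  have \<Theta>: "(\<integral>\<^sup>+\<theta>. ennreal \<theta> \<partial>Q) = ennreal \<Theta>" "0 \<le> \<Theta>" using theta_moment unfolding \<Theta>_def by auto
  \<comment> \<open>Collects \<open>2 * L\<close> from the displacement, \<open>c\<close> from the
    rate, the first moment of \<open>Q\<close>, and 2 pi from \<phi>.\<close>
  define E where "E = 2 * L * c * \<Theta> * (2 * pi)"
  have E0: "0 \<le> E" unfolding E_def using L c \<Theta> by auto
  show ?thesis
  proof (rule that)
    show "0 \<le> E * (2 * D + 2 * b)" using E0 b D by auto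
    fix s :: real and x z :: vec3 assume s: "s \<in> {0..T}"
    let ?h = "\<lambda>q. \<bar>\<Delta> \<psi> x z q\<bar> * fT s x (fst q) * \<sigma> (norm (z - fst q))"
    show "(\<integral>\<^sup>+q. ennreal (?h q) \<partial>coll_measure Q) \<le> ennreal (E * (2 * D + 2 * b) * (1 + (norm z)\<^sup>2))"
    proof (cases "norm x \<le> \<rho>")
      case False
      \<comment> \<open>A collision does not move \<open>x\<close>, so off the support both terms of
        \<Delta> vanish.\<close>
      then have "\<Delta> \<psi> x z q = 0" for q using supp unfolding \<Delta>_def by (metis diff_self)
      then show ?thesis by simp
    next
      case True
      have "(\<integral>\<^sup>+q. ennreal (?h q) \<partial>coll_measure Q)
        \<le> (\<integral>\<^sup>+q. ennreal ((norm (z - fst q))\<^sup>2 * fT s x (fst q)) * (ennreal (2 * L * c) * ennreal (fst (snd q))) \<partial>coll_measure Q)"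
      proof (rule nn_integral_mono_AE)
        show "AE q in coll_measure Q. ennreal (?h q) \<le> ennreal ((norm (z - fst q))\<^sup>2 * fT s x (fst q)) * (ennreal (2 * L * c) * ennreal (fst (snd q)))"
          using AE_coll
        proof eventually_elim
          case (elim q)
          \<comment> \<open>For \<open>v = z\<close>, not covered by \<open>alpha_bound\<close>,
            both sides vanish because \<sigma> is 0 at 0.\<close>
          have "?h q \<le> ((norm (z - fst q))\<^sup>2 * fT s x (fst q)) * ((2 * L * c) * fst (snd q))"
          proof (cases "fst q = z")
            case False
            have "\<bar>\<Delta> \<psi> x z q\<bar> \<le> L * norm (alpha I J z (fst q) (fst (snd q)) (snd (snd q)))"
              unfolding \<Delta>_def by (rule order_trans[OF lip]) (simp add: zstar_def norm_Pair)
            also have "\<dots> \<le> L * (2 * fst (snd q) * norm (z - fst q))"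
              using elim False by (intro mult_left_mono alpha_bound L) auto
            finally have "?h q \<le> (L * (2 * fst (snd q) * norm (z - fst q))) * fT s x (fst q) * \<sigma> (norm (z - fst q))"
              by (intro mult_right_mono \<sigma>_nonneg fT_nonneg) auto
            then show ?thesis by (simp add: c power2_eq_square mult_ac)
          qed (simp add: c)
          then have "ennreal (?h q) \<le> ennreal (((norm (z - fst q))\<^sup>2 * fT s x (fst q)) * ((2 * L * c) * fst (snd q)))"
            by (rule ennreal_leI)
          also have "\<dots> = ennreal ((norm (z - fst q))\<^sup>2 * fT s x (fst q)) * (ennreal (2 * L * c) * ennreal (fst (snd q)))"
            using elim L c fT_nonneg by (simp add: ennreal_mult)
          finally show ?case .
        qed
      qed
      also have "\<dots> = (\<integral>\<^sup>+v. \<integral>\<^sup>+\<theta>. \<integral>\<^sup>+\<phi>. ennreal ((norm (z - v))\<^sup>2 * fT s x v) * (ennreal (2 * L * c) * ennreal \<theta>) \<partial>phi_measure \<partial>Q \<partial>lborel)"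
        by (subst nn_integral_coll) auto
      also have "\<dots> = (\<integral>\<^sup>+v. ennreal ((norm (z - v))\<^sup>2 * fT s x v) * ennreal E \<partial>lborel)"
      proof (intro nn_integral_cong)
        fix v
        let ?a = "ennreal ((norm (z - v))\<^sup>2 * fT s x v)"
        have "(\<integral>\<^sup>+\<theta>. \<integral>\<^sup>+\<phi>. ?a * (ennreal (2 * L * c) * ennreal \<theta>) \<partial>phi_measure \<partial>Q)
          = (\<integral>\<^sup>+\<theta>. (?a * ennreal (2 * L * c) * ennreal (2 * pi)) * ennreal \<theta> \<partial>Q)"
          by (intro nn_integral_cong) (simp add: emeasure_phi sets_eq_imp_space_eq[OF sets_phi] mult_ac)
        also have "\<dots> = (?a * ennreal (2 * L * c) * ennreal (2 * pi)) * ennreal \<Theta>"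
          by (subst nn_integral_cmult) (auto simp: \<Theta>)
        also have "\<dots> = ?a * ennreal E"
          unfolding E_def using L c \<Theta> by (simp add: ennreal_mult mult_ac)
        finally show "(\<integral>\<^sup>+\<theta>. \<integral>\<^sup>+\<phi>. ?a * (ennreal (2 * L * c) * ennreal \<theta>) \<partial>phi_measure \<partial>Q) = ?a * ennreal E" .
      qed
      also have "\<dots> = (\<integral>\<^sup>+v. ennreal ((norm (z - v))\<^sup>2 * fT s x v) \<partial>lborel) * ennreal E"
        by (rule nn_integral_multc) auto
      also have "\<dots> \<le> ennreal (2 * (norm z)\<^sup>2 * D + 2 * b) * ennreal E"
      proof (rule mult_right_mono)
        have "(\<integral>\<^sup>+v. ennreal ((norm (z - v))\<^sup>2 * fT s x v) \<partial>lborel)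
          \<le> (\<integral>\<^sup>+v. ennreal (2 * (norm z)\<^sup>2) * ennreal (fT s x v) + ennreal 2 * ennreal ((norm v)\<^sup>2 * fT s x v) \<partial>lborel)"
        proof (rule nn_integral_mono)
          fix v
          have "(norm (z - v))\<^sup>2 \<le> (norm z + norm v)\<^sup>2" by (intro power_mono norm_triangle_ineq4) auto
          also have "\<dots> \<le> 2 * (norm z)\<^sup>2 + 2 * (norm v)\<^sup>2"
            using sum_squares_bound[of "norm z" "norm v"] by (simp add: power2_sum)
          finally have "(norm (z - v))\<^sup>2 * fT s x v \<le> (2 * (norm z)\<^sup>2 + 2 * (norm v)\<^sup>2) * fT s x v"
            by (rule mult_right_mono) (rule fT_nonneg)
          then have "ennreal ((norm (z - v))\<^sup>2 * fT s x v) \<le> ennreal ((2 * (norm z)\<^sup>2 + 2 * (norm v)\<^sup>2) * fT s x v)"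
            by (rule ennreal_leI)
          also have "\<dots> = ennreal (2 * (norm z)\<^sup>2) * ennreal (fT s x v) + ennreal 2 * ennreal ((norm v)\<^sup>2 * fT s x v)"
            using fT_nonneg[of s x v] by (simp add: ennreal_mult[symmetric] ennreal_plus[symmetric] distrib_right mult.assoc del: ennreal_plus ennreal_numeral)
          finally show "ennreal ((norm (z - v))\<^sup>2 * fT s x v) \<le> ennreal (2 * (norm z)\<^sup>2) * ennreal (fT s x v) + ennreal 2 * ennreal ((norm v)\<^sup>2 * fT s x v)" .
        qed
        also have "\<dots> = ennreal (2 * (norm z)\<^sup>2) * (\<integral>\<^sup>+v. ennreal (fT s x v) \<partial>lborel) + ennreal 2 * (\<integral>\<^sup>+v. ennreal ((norm v)\<^sup>2 * fT s x v) \<partial>lborel)"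
          by (subst nn_integral_add) (auto simp: nn_integral_cmult)
        also have "\<dots> \<le> ennreal (2 * (norm z)\<^sup>2) * ennreal D + ennreal 2 * ennreal b"
          by (intro add_mono mult_left_mono b D s True) auto
        also have "\<dots> = ennreal (2 * (norm z)\<^sup>2 * D + 2 * b)"
          using D b by (simp add: ennreal_mult[symmetric] ennreal_plus[symmetric] del: ennreal_plus ennreal_numeral)
        finally show "(\<integral>\<^sup>+v. ennreal ((norm (z - v))\<^sup>2 * fT s x v) \<partial>lborel) \<le> ennreal (2 * (norm z)\<^sup>2 * D + 2 * b)" .
      qed simp
      also have "\<dots> = ennreal (E * (2 * (norm z)\<^sup>2 * D + 2 * b))"
        using D(1) b(1) E0 by (subst ennreal_mult[symmetric]) (auto simp: mult.commute)
      also have "\<dots> \<le> ennreal (E * (2 * D + 2 * b) * (1 + (norm z)\<^sup>2))"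
      proof (rule ennreal_leI)
        have "2 * (norm z)\<^sup>2 * D + 2 * b \<le> (2 * D + 2 * b) * (1 + (norm z)\<^sup>2)"
          using D b by (simp add: algebra_simps)
        then show "E * (2 * (norm z)\<^sup>2 * D + 2 * b) \<le> E * (2 * D + 2 * b) * (1 + (norm z)\<^sup>2)"
          using E0 by (simp only: mult.assoc) (rule mult_left_mono)
      qed
      finally show ?thesis .
    qed
  qed
qed

end

section \<open>The compensator of the jumps of a test function\<close>

locale kinetic_test = kinetic +
  fixes \<psi> :: "vec3 \<times> vec3 \<Rightarrow> real" and L \<rho> :: real
  assumes \<psi>_meas [measurable]: "\<psi> \<in> borel_measurable borel"
    and lip: "\<And>a b. \<bar>\<psi> a - \<psi> b\<bar> \<le> L * norm (a - b)" and L: "0 \<le> L"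
    and supp: "\<And>x z. \<psi> (x, z) \<noteq> 0 \<Longrightarrow> norm x \<le> \<rho>"
begin

definition "W s x z q = \<Delta> \<psi> x z q * fT s x (fst q) * \<sigma> (norm (z - fst q))"
definition "collop s x z = (\<integral>q. W s x z q \<partial>coll_measure Q)"

lemma W_meas [measurable (raw)]:
  assumes [measurable]: "s \<in> borel_measurable K" "x \<in> borel_measurable K" "z \<in> borel_measurable K" "q \<in> borel_measurable K"
  shows "(\<lambda>w. W (s w) (x w) (z w) (q w)) \<in> borel_measurable K"
  unfolding W_def by measurable

lemma collop_meas [measurable (raw)]:
  assumes [measurable]: "s \<in> borel_measurable K" "x \<in> borel_measurable K" "z \<in> borel_measurable K"
  shows "(\<lambda>w. collop (s w) (x w) (z w)) \<in> borel_measurable K"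
proof -
  have "(\<lambda>(w, q). W (s w) (x w) (z w) q) \<in> borel_measurable (K \<Otimes>\<^sub>M borel)" by measurable
  then have "(\<lambda>(w, q). W (s w) (x w) (z w) q) \<in> borel_measurable (K \<Otimes>\<^sub>M coll_measure Q)"
    by (simp cong: measurable_cong_sets sets_pair_measure_cong add: sets_coll)
  then show ?thesis unfolding collop_def by (rule coll.borel_measurable_lebesgue_integral)
qed

lemma Lop_eq: "s \<in> {0..T} \<Longrightarrow> Lop I J Q \<sigma> f s \<psi> (x, z) = collop s x z"
  unfolding Lop_def collop_def W_def \<Delta>_def by (simp add: split_beta' fT_eq)

lemma W_bound:
  obtains C where "0 \<le> C" "\<And>s x z. s \<in> {0..T} \<Longrightarrow>
     (\<integral>\<^sup>+q. ennreal \<bar>W s x z q\<bar> \<partial>coll_measure Q) \<le> ennreal (C * (1 + (norm z)\<^sup>2))"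
proof -
  have eq: "\<bar>W s x z q\<bar> = \<bar>\<Delta> \<psi> x z q\<bar> * fT s x (fst q) * \<sigma> (norm (z - fst q))" for s x z q
    unfolding W_def using fT_nonneg \<sigma>_nonneg by (simp add: abs_mult)
  show ?thesis
  proof (rule collision_bound[OF \<psi>_meas lip L supp])
    fix C assume "0 \<le> C" "\<And>s x z. s \<in> {0..T} \<Longrightarrow>
     (\<integral>\<^sup>+q. ennreal (\<bar>\<Delta> \<psi> x z q\<bar> * fT s x (fst q) * \<sigma> (norm (z - fst q))) \<partial>coll_measure Q) \<le> ennreal (C * (1 + (norm z)\<^sup>2))"
    then show thesis by (intro that[of C]) (simp_all only: eq)
  qed
qed

lemma W_integrable:
  assumes "s \<in> {0..T}" shows "integrable (coll_measure Q) (W s x z)"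
proof -
  obtain C where "\<And>s x z. s \<in> {0..T} \<Longrightarrow>
     (\<integral>\<^sup>+q. ennreal \<bar>W s x z q\<bar> \<partial>coll_measure Q) \<le> ennreal (C * (1 + (norm z)\<^sup>2))"
    by (rule W_bound) blast
  from this[OF assms, of x z] have "(\<integral>\<^sup>+q. ennreal \<bar>W s x z q\<bar> \<partial>coll_measure Q) < \<infinity>"
    by (rule le_less_trans) simp
  moreover have "(\<lambda>q. W s x z q) \<in> borel_measurable borel" by measurable
  ultimately show ?thesis by (intro integrableI_bounded) auto
qed

lemma collop_bound:
  obtains C where "0 \<le> C" "\<And>s x z. s \<in> {0..T} \<Longrightarrow> \<bar>collop s x z\<bar> \<le> C * (1 + (norm z)\<^sup>2)"
proof -
  obtain C where C: "0 \<le> C" "\<And>s x z. s \<in> {0..T} \<Longrightarrow>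
     (\<integral>\<^sup>+q. ennreal \<bar>W s x z q\<bar> \<partial>coll_measure Q) \<le> ennreal (C * (1 + (norm z)\<^sup>2))"
    by (rule W_bound) blast
  show ?thesis
  proof (rule that[OF C(1)])
    fix s x z assume s: "s \<in> {0..T}"
    have "ennreal \<bar>collop s x z\<bar> \<le> (\<integral>\<^sup>+q. ennreal (norm (W s x z q)) \<partial>coll_measure Q)"
      unfolding collop_def using integral_norm_bound_ennreal[OF W_integrable[OF s, of x z]] by simp
    also have "\<dots> \<le> ennreal (C * (1 + (norm z)\<^sup>2))" using C(2)[OF s] by simp
    finally show "\<bar>collop s x z\<bar> \<le> C * (1 + (norm z)\<^sup>2)" using C(1) by (subst (asm) ennreal_le_iff) auto
  qed
qed

text \<open>The jump of \<psi> that the noise point \<open>p\<close> causes along given paths. The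
  acceptance indicator can stand outside \<psi>, since a rejected point causes no jump.\<close>

definition "Hf t x z p = indicator {0<..t} (tm p) * (indicator {0..rate (tm p) (x (tm p)) (z (tm p)) (fst p)} (fst (snd (snd (snd p))))
   * \<Delta> \<psi> (x (tm p)) (z (tm p)) (fst p, fst (snd p), fst (snd (snd p))))"

lemma Hf_meas:
  assumes [measurable]: "x \<in> borel_measurable borel" "z \<in> borel_measurable borel"
  shows "Hf t x z \<in> borel_measurable borel"
proof -
  have ind: "indicator {0..a} r = (if 0 \<le> r \<and> r \<le> a then 1 else 0 :: real)" for a r by auto
  have "(\<lambda>p. Hf t x z p) \<in> borel_measurable borel" unfolding Hf_def ind by measurable
  then show ?thesis by simp
qed

text \<open>\<open>g\<close> stands for the positive part, the negative part and the absolute value.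
  All three vanish at 0 and are positively homogeneous, so they pass through the indicators and the
  nonnegative factors \<open>fT\<close> and \<sigma>.\<close>

lemma nn_Hf:
  assumes g: "g \<in> borel_measurable borel" "\<And>a. 0 \<le> g a" "g 0 = (0::real)" and hom: "\<And>a b. 0 \<le> b \<Longrightarrow> g (a * b) = g a * b"
    and x [measurable]: "x \<in> borel_measurable borel" and z [measurable]: "z \<in> borel_measurable borel"
  shows "(\<integral>\<^sup>+p. ennreal (g (Hf t x z p)) \<partial>\<nu>)
    = (\<integral>\<^sup>+s. indicator {0<..t} s * (\<integral>\<^sup>+q. ennreal (g (W s (x s) (z s) q)) \<partial>coll_measure Q) \<partial>timeM)"
proof -
  note [measurable] = g(1)
  define G where "G s q = indicator {0<..t} s * g (\<Delta> \<psi> (x s) (z s) q)" for s :: real and q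
  have G: "(\<lambda>w. G (fst w) (snd w)) \<in> borel_measurable borel" unfolding G_def by measurable
  have "(\<integral>\<^sup>+p. ennreal (g (Hf t x z p)) \<partial>\<nu>)
    = (\<integral>\<^sup>+p. (case p of (v, \<theta>, \<phi>, r, s) \<Rightarrow> ennreal (indicator {0..rate s (x s) (z s) v} r * G s (v, \<theta>, \<phi>))) \<partial>\<nu>)"
    by (intro nn_integral_cong) (auto simp: Hf_def G_def indicator_def g(3))
  also have "\<dots> = (\<integral>\<^sup>+s. \<integral>\<^sup>+q. ennreal (G s q * fT s (x s) (fst q) * \<sigma> (norm (z s - fst q))) \<partial>coll_measure Q \<partial>timeM)"
    by (rule nn_integral_\<nu>_rate[OF G _ x z]) (simp add: G_def g(2))
  also have "\<dots> = (\<integral>\<^sup>+s. indicator {0<..t} s * (\<integral>\<^sup>+q. ennreal (g (W s (x s) (z s) q)) \<partial>coll_measure Q) \<partial>timeM)"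
  proof (rule nn_integral_cong)
    fix s
    have "g (W s (x s) (z s) q) = g (\<Delta> \<psi> (x s) (z s) q) * fT s (x s) (fst q) * \<sigma> (norm (z s - fst q))" for q
      unfolding W_def by (simp add: hom fT_nonneg \<sigma>_nonneg)
    then show "(\<integral>\<^sup>+q. ennreal (G s q * fT s (x s) (fst q) * \<sigma> (norm (z s - fst q))) \<partial>coll_measure Q)
      = indicator {0<..t} s * (\<integral>\<^sup>+q. ennreal (g (W s (x s) (z s) q)) \<partial>coll_measure Q)"
      by (auto simp: G_def indicator_def)
  qed
  finally show ?thesis .
qed

lemma nn_abs_Hf_bound:
  obtains C where "0 \<le> C" "\<And>t x z. x \<in> borel_measurable borel \<Longrightarrow> z \<in> borel_measurable borel \<Longrightarrow>
    (\<integral>\<^sup>+p. ennreal \<bar>Hf t x z p\<bar> \<partial>\<nu>) \<le> (\<integral>\<^sup>+s. ennreal (C * (1 + (norm (z s))\<^sup>2)) \<partial>timeM)"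
proof -
  obtain C where C: "0 \<le> C" "\<And>s x z. s \<in> {0..T} \<Longrightarrow>
     (\<integral>\<^sup>+q. ennreal \<bar>W s x z q\<bar> \<partial>coll_measure Q) \<le> ennreal (C * (1 + (norm z)\<^sup>2))"
    by (rule W_bound) blast
  show ?thesis
  proof (rule that[OF C(1)])
    fix t and x z :: "real \<Rightarrow> vec3"
    assume xz: "x \<in> borel_measurable borel" "z \<in> borel_measurable borel"
    have "(\<integral>\<^sup>+p. ennreal \<bar>Hf t x z p\<bar> \<partial>\<nu>)
      = (\<integral>\<^sup>+s. indicator {0<..t} s * (\<integral>\<^sup>+q. ennreal \<bar>W s (x s) (z s) q\<bar> \<partial>coll_measure Q) \<partial>timeM)"
      by (rule nn_Hf[OF _ _ _ _ xz]) (auto simp: abs_mult)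
    also have "\<dots> \<le> (\<integral>\<^sup>+s. ennreal (C * (1 + (norm (z s))\<^sup>2)) \<partial>timeM)"
    proof (rule nn_integral_mono_AE)
      show "AE s in timeM. indicator {0<..t} s * (\<integral>\<^sup>+q. ennreal \<bar>W s (x s) (z s) q\<bar> \<partial>coll_measure Q)
          \<le> ennreal (C * (1 + (norm (z s))\<^sup>2))"
        using AE_timeM by eventually_elim (use C(2) in \<open>auto simp: indicator_def\<close>)
    qed
    finally show "(\<integral>\<^sup>+p. ennreal \<bar>Hf t x z p\<bar> \<partial>\<nu>) \<le> (\<integral>\<^sup>+s. ennreal (C * (1 + (norm (z s))\<^sup>2)) \<partial>timeM)" .
  qed
qed

lemma integral_timeM:
  fixes h :: "real \<Rightarrow> real"
  assumes "t \<le> T" and [measurable]: "h \<in> borel_measurable borel"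
  shows "(\<integral>s. indicator {0<..t} s * h s \<partial>timeM) = (LINT s:{0..t}|lborel. h s)"
proof -
  have "(\<integral>s. indicator {0<..t} s * h s \<partial>timeM) = (\<integral>s. indicator {0..T} s *\<^sub>R (indicator {0<..t} s * h s) \<partial>lborel)"
  proof -
    have "timeM = density lborel (\<lambda>s. ennreal (indicator {0..T} s))"
      unfolding timeM_def by (simp add: ennreal_indicator)
    then show ?thesis by (simp only:) (rule integral_density, auto)
  qed
  also have "\<dots> = (\<integral>s. indicator {0..t} s *\<^sub>R h s \<partial>lborel)"
  proof (rule integral_cong_AE)
    have "AE s in lborel. s \<noteq> (0::real)" by (rule AE_lborel_singleton)
    then show "AE s in lborel. indicator {0..T} s *\<^sub>R (indicator {0<..t} s * h s) = indicator {0..t} s *\<^sub>R h s"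
      by eventually_elim (use assms in \<open>auto simp: indicator_def\<close>)
  qed auto
  finally show ?thesis unfolding set_lebesgue_integral_def .
qed

text \<open>The nonnegative formula is applied to the positive and the negative part and the results
  are subtracted. At times in \<open>[0,T]\<close> the function \<open>W\<close> is integrable, so
  the difference of its two parts is \<open>collop\<close>.\<close>

lemma integral_Hf:
  assumes t: "t \<le> T" and x [measurable]: "x \<in> borel_measurable borel" and z [measurable]: "z \<in> borel_measurable borel"
    and fin: "(\<integral>\<^sup>+p. ennreal \<bar>Hf t x z p\<bar> \<partial>\<nu>) < \<infinity>"
  shows "(\<integral>p. Hf t x z p \<partial>\<nu>) = (LINT s:{0..t}|lborel. collop s (x s) (z s))"
proof -
  define P where "P g s = indicator {0<..t} s * (\<integral>\<^sup>+q. ennreal (g (W s (x s) (z s) q)) \<partial>coll_measure Q)" for g :: "real \<Rightarrow> real" and s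
  have P_meas [measurable]: "P g \<in> borel_measurable borel" if [measurable]: "g \<in> borel_measurable borel" for g
    unfolding P_def by measurable
  have mx: "(\<integral>\<^sup>+p. ennreal (g (Hf t x z p)) \<partial>\<nu>) = (\<integral>\<^sup>+s. P g s \<partial>timeM)"
    if "g = (\<lambda>a. max 0 a) \<or> g = (\<lambda>a. max 0 (- a)) \<or> g = abs" for g
  proof -
    have "g \<in> borel_measurable borel" using that by auto
    moreover have "g (a * b) = g a * b" if "0 \<le> b" for a b
      using \<open>g = (\<lambda>a. max 0 a) \<or> g = (\<lambda>a. max 0 (- a)) \<or> g = abs\<close> that
      by (auto simp: max_def abs_mult mult_nonneg_nonneg mult_nonpos_nonneg not_le zero_le_mult_iff mult_le_0_iff)
    ultimately show ?thesis unfolding P_def using that by (intro nn_Hf x z) auto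
  qed
  let ?p = "\<lambda>a::real. max 0 a" and ?m = "\<lambda>a::real. max 0 (- a)"
  have finA: "(\<integral>\<^sup>+s. P abs s \<partial>timeM) < \<infinity>" using fin mx[of abs] by simp
  have le: "P g s \<le> P abs s" if "\<And>a. g a \<le> \<bar>a\<bar>" for g s
    unfolding P_def by (intro mult_left_mono nn_integral_mono ennreal_leI that) auto
  have g: "?p a \<le> \<bar>a\<bar>" "?m a \<le> \<bar>a\<bar>" for a by auto
  note parts = integral_diff_nn_integral[of "P ?p" timeM "P ?m" "P abs", OF _ _ _ le[OF g(1)] le[OF g(2)] finA]
  \<comment> \<open>\<open>ennreal\<close> sends negative numbers to 0, so taking the positive part
    first changes nothing.\<close>
  have mp: "ennreal (?p a) = ennreal a" "ennreal (?m a) = ennreal (- a)" for a by (auto simp: max_def ennreal_neg)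
  have int\<nu>: "integrable \<nu> (Hf t x z)"
    using Hf_meas[OF x z] fin by (intro integrableI_bounded) (auto simp: measurable_cong_sets[OF sets_\<nu> refl])
  have "(\<integral>p. Hf t x z p \<partial>\<nu>) = enn2real (\<integral>\<^sup>+p. ennreal (?p (Hf t x z p)) \<partial>\<nu>) - enn2real (\<integral>\<^sup>+p. ennreal (?m (Hf t x z p)) \<partial>\<nu>)"
    unfolding mp by (rule real_lebesgue_integral_def[OF int\<nu>])
  also have "\<dots> = (\<integral>s. enn2real (P ?p s) - enn2real (P ?m s) \<partial>timeM)"
  proof -
    have "(\<integral>\<^sup>+p. ennreal (?p (Hf t x z p)) \<partial>\<nu>) = (\<integral>\<^sup>+s. P ?p s \<partial>timeM)"
      by (rule mx) (rule disjI1, rule refl)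
    moreover have "(\<integral>\<^sup>+p. ennreal (?m (Hf t x z p)) \<partial>\<nu>) = (\<integral>\<^sup>+s. P ?m s \<partial>timeM)"
      by (rule mx) (rule disjI2, rule disjI1, rule refl)
    ultimately show ?thesis by (subst parts(2)) simp_all
  qed
  also have "\<dots> = (\<integral>s. indicator {0<..t} s * collop s (x s) (z s) \<partial>timeM)"
  proof (rule integral_cong_AE)
    show "AE s in timeM. enn2real (P ?p s) - enn2real (P ?m s) = indicator {0<..t} s * collop s (x s) (z s)"
      using AE_timeM
    proof eventually_elim
      case (elim s)
      then have "integrable (coll_measure Q) (W s (x s) (z s))" by (intro W_integrable) auto
      from real_lebesgue_integral_def[OF this] show ?case
        unfolding collop_def P_def mp by (auto simp: indicator_def)
    qed
  qed auto
  also have "\<dots> = (LINT s:{0..t}|lborel. collop s (x s) (z s))"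
    by (rule integral_timeM[OF t]) auto
  finally show ?thesis .
qed

end

section \<open>The solution of the stochastic system\<close>

lemma expectation_set_integral:
  fixes h :: "'w \<Rightarrow> real \<Rightarrow> real"
  assumes M: "prob_space M" and h [measurable]: "(\<lambda>(\<omega>, s). h \<omega> s) \<in> borel_measurable (M \<Otimes>\<^sub>M borel)"
    and fin: "(\<integral>\<^sup>+\<omega>. \<integral>\<^sup>+s. indicator {0..t} s * ennreal \<bar>h \<omega> s\<bar> \<partial>lborel \<partial>M) < \<infinity>"
  shows "(\<integral>\<omega>. (LINT s:{0..t}|lborel. h \<omega> s) \<partial>M) = (LINT s:{0..t}|lborel. (\<integral>\<omega>. h \<omega> s \<partial>M))"
    and "integrable M (\<lambda>\<omega>. LINT s:{0..t}|lborel. h \<omega> s)"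
proof -
  interpret prob_space M by (rule M)
  interpret P: pair_sigma_finite M lborel by unfold_locales
  have m [measurable]: "(\<lambda>(\<omega>, s). h \<omega> s) \<in> borel_measurable (M \<Otimes>\<^sub>M lborel)"
    using h by (simp cong: measurable_cong_sets sets_pair_measure_cong)
  have m2: "(\<lambda>(\<omega>, s). indicator {0..t} s *\<^sub>R h \<omega> s) \<in> borel_measurable (M \<Otimes>\<^sub>M lborel)" by measurable
  have i: "integrable (M \<Otimes>\<^sub>M lborel) (\<lambda>(\<omega>, s). indicator {0..t} s *\<^sub>R h \<omega> s)"
  proof (rule integrableI_bounded[OF m2])
    have "(\<integral>\<^sup>+q. ennreal (norm (case q of (\<omega>, s) \<Rightarrow> indicator {0..t} s *\<^sub>R h \<omega> s)) \<partial>(M \<Otimes>\<^sub>M lborel))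
      = (\<integral>\<^sup>+\<omega>. \<integral>\<^sup>+s. ennreal (norm (indicator {0..t} s *\<^sub>R h \<omega> s)) \<partial>lborel \<partial>M)"
      using m2 by (subst lborel.nn_integral_fst[symmetric]) auto
    also have "\<dots> = (\<integral>\<^sup>+\<omega>. \<integral>\<^sup>+s. indicator {0..t} s * ennreal \<bar>h \<omega> s\<bar> \<partial>lborel \<partial>M)"
      by (intro nn_integral_cong) (auto simp: indicator_def)
    finally show "(\<integral>\<^sup>+q. ennreal (norm (case q of (\<omega>, s) \<Rightarrow> indicator {0..t} s *\<^sub>R h \<omega> s)) \<partial>(M \<Otimes>\<^sub>M lborel)) < \<infinity>"
      using fin by simp
  qed
  from P.Fubini_integral[OF i] show "(\<integral>\<omega>. (LINT s:{0..t}|lborel. h \<omega> s) \<partial>M) = (LINT s:{0..t}|lborel. (\<integral>\<omega>. h \<omega> s \<partial>M))"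
    unfolding set_lebesgue_integral_def by simp
  from P.integrable_fst[OF i] show "integrable M (\<lambda>\<omega>. LINT s:{0..t}|lborel. h \<omega> s)"
    unfolding set_lebesgue_integral_def by simp
qed

locale boltzmann_system = kinetic_test I J Q \<sigma> T f \<psi> L \<rho>
  for I J Q \<sigma> T f \<psi> L \<rho> +
  fixes M :: "'w measure" and F :: "real \<Rightarrow> 'w measure"
    and N :: "'w \<Rightarrow> noise_pt measure" and X Z :: "'w \<Rightarrow> real \<Rightarrow> vec3"
    and D :: "vec3 \<times> vec3 \<Rightarrow> (vec3 \<times> vec3) \<Rightarrow>\<^sub>L real" and K :: real
  assumes basis: "stochastic_basis M F T"
    and PRM: "adapted_PRM M F T \<nu> N"
    and adapted: "\<forall>t\<in>{0..T}. (\<lambda>\<omega>. X \<omega> t) \<in> borel_measurable (F t) \<and> (\<lambda>\<omega>. Z \<omega> t) \<in> borel_measurable (F t)"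
    and cadlag: "\<forall>\<omega>\<in>space M. cadlag_on T (X \<omega>) \<and> cadlag_on T (Z \<omega>)"
    and S: "AE \<omega> in M. system_S I J \<sigma> f T (N \<omega>) (X \<omega>) (Z \<omega>)"
    and moment: "(\<Squnion>t\<in>{0..T}. \<integral>\<^sup>+ \<omega>. ennreal ((norm (Z \<omega> t))\<^sup>2) \<partial>M) < \<infinity>"
    and deriv: "\<And>q. (\<psi> has_derivative blinfun_apply (D q)) (at q)"
    and D_cont: "continuous_on UNIV D"
    and D_bound: "\<And>q. norm (D q) \<le> L"
    and \<psi>_bound: "\<And>q. \<bar>\<psi> q\<bar> \<le> K"
    and drift_bound: "\<And>x z. \<bar>D (x, z) (z, 0)\<bar> \<le> K"
begin

sublocale PN: poisson_noise M F T \<nu> N marks mark_rate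
  by (rule poisson_noise_intensity[OF basis PRM])

text \<open>The value 0 outside \<open>(0,T]\<close> follows the convention for predictable
  functions and makes the paths Borel on the whole line.\<close>

definition "Xl \<omega> s = (if 0 < s \<and> s \<le> T then leftlim (X \<omega>) s else 0)"
definition "Zl \<omega> s = (if 0 < s \<and> s \<le> T then leftlim (Z \<omega>) s else 0)"

lemma XZ_meas [measurable]: 
  assumes "s \<in> {0..T}" shows "(\<lambda>\<omega>. X \<omega> s) \<in> borel_measurable M" "(\<lambda>\<omega>. Z \<omega> s) \<in> borel_measurable M"
  using adapted PN.F_sub[OF assms] assms measurable_from_subalg by blast+

lemma predictable:
  "(\<lambda>q. if q \<in> space M \<times> time_slab UNIV {0<..T} then Xl (fst q) (tm (snd q)) else 0) \<in> borel_measurable PN.Pm"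
  "(\<lambda>q. if q \<in> space M \<times> time_slab UNIV {0<..T} then Zl (fst q) (tm (snd q)) else 0) \<in> borel_measurable PN.Pm"
proof -
  have *: "(\<lambda>q. if q \<in> space M \<times> time_slab UNIV {0<..T} then (if 0 < tm (snd q) \<and> tm (snd q) \<le> T then leftlim (Y (fst q)) (tm (snd q)) else 0) else 0)
    = (\<lambda>q. if q \<in> space M \<times> time_slab UNIV {0<..T} then leftlim (Y (fst q)) (tm (snd q)) else 0)" for Y :: "'w \<Rightarrow> real \<Rightarrow> vec3"
    by (auto simp: time_slab_def fun_eq_iff)
  show "(\<lambda>q. if q \<in> space M \<times> time_slab UNIV {0<..T} then Xl (fst q) (tm (snd q)) else 0) \<in> borel_measurable PN.Pm"
    unfolding Xl_def * using adapted cadlag by (intro PN.leftlim_predictable) auto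
  show "(\<lambda>q. if q \<in> space M \<times> time_slab UNIV {0<..T} then Zl (fst q) (tm (snd q)) else 0) \<in> borel_measurable PN.Pm"
    unfolding Zl_def * using adapted cadlag by (intro PN.leftlim_predictable) auto
qed

lemma left_joint_meas:
  "(\<lambda>(\<omega>, s). Xl \<omega> s) \<in> borel_measurable (M \<Otimes>\<^sub>M borel)" "(\<lambda>(\<omega>, s). Zl \<omega> s) \<in> borel_measurable (M \<Otimes>\<^sub>M borel)"
proof -
  \<comment> \<open>Time is embedded into the noise points with dummy marks, so that predictability
    yields joint measurability in \<omega> and \<open>s\<close>.\<close>
  have e: "(\<lambda>(\<omega>, s). (\<omega>, (0, 0, 0, 0, s))) \<in> measurable (M \<Otimes>\<^sub>M borel) (M \<Otimes>\<^sub>M (borel :: noise_pt measure))"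
    by measurable
  show "(\<lambda>(\<omega>, s). Xl \<omega> s) \<in> borel_measurable (M \<Otimes>\<^sub>M borel)"
    using measurable_compose[OF e PN.measurable_Pm_pair[OF predictable(1)]]
    by (rule measurable_cong[THEN iffD1, rotated]) (auto simp: space_pair_measure time_slab_def Xl_def)
  show "(\<lambda>(\<omega>, s). Zl \<omega> s) \<in> borel_measurable (M \<Otimes>\<^sub>M borel)"
    using measurable_compose[OF e PN.measurable_Pm_pair[OF predictable(2)]]
    by (rule measurable_cong[THEN iffD1, rotated]) (auto simp: space_pair_measure time_slab_def Zl_def)
qed

lemma left_meas [measurable (raw)]:
  assumes "w \<in> measurable K' M" "s \<in> borel_measurable K'"
  shows "(\<lambda>a. Xl (w a) (s a)) \<in> borel_measurable K'" "(\<lambda>a. Zl (w a) (s a)) \<in> borel_measurable K'"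
  using measurable_compose[OF measurable_Pair[OF assms] left_joint_meas(1)]
    measurable_compose[OF measurable_Pair[OF assms] left_joint_meas(2)] by simp_all

lemma left_path_meas:
  assumes "\<omega> \<in> space M" shows "Xl \<omega> \<in> borel_measurable borel" "Zl \<omega> \<in> borel_measurable borel"
  using measurable_Pair2[OF left_joint_meas(1) assms] measurable_Pair2[OF left_joint_meas(2) assms] by simp_all

definition "H t q = Hf t (Xl (fst q)) (Zl (fst q)) (snd q)"

lemma H_predictable:
  assumes "t \<le> T" shows "H t \<in> borel_measurable PN.Pm"
proof -
  let ?R = "space M \<times> time_slab UNIV {0<..T}"
  define x where "x q = (if q \<in> ?R then Xl (fst q) (tm (snd q)) else 0)" for q
  define z where "z q = (if q \<in> ?R then Zl (fst q) (tm (snd q)) else 0)" for q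
  define p where "p q = (if q \<in> ?R then snd q else 0)" for q
  have [measurable]: "x \<in> borel_measurable PN.Pm" "z \<in> borel_measurable PN.Pm" "p \<in> borel_measurable PN.Pm"
    unfolding x_def[abs_def] z_def[abs_def] p_def[abs_def] by (intro predictable PN.point_predictable)+
  have ind: "indicator {0..a} r = (if 0 \<le> r \<and> r \<le> a then 1 else 0 :: real)" for a r by auto
  have "(\<lambda>q. indicator {0<..t} (tm (p q)) * (indicator {0..rate (tm (p q)) (x q) (z q) (fst (p q))} (fst (snd (snd (snd (p q)))))
     * \<Delta> \<psi> (x q) (z q) (fst (p q), fst (snd (p q)), fst (snd (snd (p q)))))) \<in> borel_measurable PN.Pm"
    unfolding ind by measurable
  then show ?thesis
  proof (rule measurable_cong[THEN iffD1, rotated])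
    fix q assume q: "q \<in> space PN.Pm"
    show "indicator {0<..t} (tm (p q)) * (indicator {0..rate (tm (p q)) (x q) (z q) (fst (p q))} (fst (snd (snd (snd (p q)))))
     * \<Delta> \<psi> (x q) (z q) (fst (p q), fst (snd (p q)), fst (snd (snd (p q))))) = H t q"
    proof (cases "q \<in> ?R")
      case True
      then show ?thesis by (simp add: H_def Hf_def x_def z_def p_def)
    next
      case False
      \<comment> \<open>Off the slab the substitute point has time 0 and the true time is not in
        \<open>{0<..t}\<close>, so both sides vanish.\<close>
      then have "tm (p q) = 0" "tm (snd q) \<notin> {0<..t}"
        using q assms by (auto simp: p_def time_slab_def)
      then show ?thesis by (simp add: H_def Hf_def)
    qed
  qed
qed

text \<open>A cadlag path has a left limit, so one sequence identifies it. The sequence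
  \<open>u\<close> starts at 0 and stays below \<open>s\<close>, hence within the range where (S) is
  available.\<close>

lemma fixed_time_left:
  assumes y: "cadlag_on T y" and s: "0 < s" "s \<le> T" and conv: "\<And>u. (\<And>n. 0 \<le> u n \<and> u n < s) \<Longrightarrow> u \<longlonglongrightarrow> s \<Longrightarrow> (\<lambda>n. y (u n)) \<longlonglongrightarrow> l"
  shows "leftlim y s = (l :: vec3)"
proof -
  define u where "u n = s - s * inverse (real (Suc n))" for n
  have u: "0 \<le> u n" "u n < s" for n
  proof -
    have "inverse (real (Suc n)) \<le> 1" "0 < inverse (real (Suc n))" by (auto simp: field_simps)
    then have "s * inverse (real (Suc n)) \<le> s * 1" "0 < s * inverse (real (Suc n))"
      using s by (auto intro!: mult_left_mono simp del: of_nat_Suc mult_1_right)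
    then show "0 \<le> u n" "u n < s" unfolding u_def by auto
  qed
  have "u \<longlonglongrightarrow> s - s * 0" unfolding u_def by (intro tendsto_intros LIMSEQ_inverse_real_of_nat)
  then have lim: "u \<longlonglongrightarrow> s" by simp
  then have "filterlim u (at_left s) sequentially"
    using u by (auto simp: filterlim_at intro!: always_eventually less_imp_neq)
  from filterlim_compose[OF PN.leftlim_tendsto[OF y s] this] have "(\<lambda>n. y (u n)) \<longlonglongrightarrow> leftlim y s" .
  moreover have "(\<lambda>n. y (u n)) \<longlonglongrightarrow> l" by (rule conv) (use u lim in auto)
  ultimately show ?thesis by (rule LIMSEQ_unique)
qed

end

section \<open>One sample path of a solution\<close>

context boltzmann_system begin

lemma drift_meas [measurable (raw)]:
  assumes x: "x \<in> borel_measurable K'" and z: "z \<in> borel_measurable K'"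
  shows "(\<lambda>w. D (x w, z w) (z w, 0)) \<in> borel_measurable K'"
proof -
  have "continuous_on UNIV (\<lambda>q::vec3 \<times> vec3. D (fst q, snd q) (snd q, 0))"
    by (intro continuous_intros continuous_on_compose2[OF D_cont]) auto
  then have "(\<lambda>q::vec3 \<times> vec3. D (fst q, snd q) (snd q, 0)) \<in> borel_measurable borel"
    by (rule borel_measurable_continuous_onI)
  from measurable_compose[OF borel_measurable_Pair[OF x z] this] show ?thesis by simp
qed

text \<open>The integrand of (S) up to the final time. One integrable function serves all earlier
  times through an indicator of \<open>tm p\<close>, which is the form \<open>pathwise_ito\<close>
  asks for.\<close>

definition "jumpsize \<omega> = sde_integrand I J \<sigma> f (X \<omega>) (Z \<omega>) T"
definition "solves \<omega> \<longleftrightarrow> \<omega> \<in> space M \<and> system_S I J \<sigma> f T (N \<omega>) (X \<omega>) (Z \<omega>) \<and> (AE p in N \<omega>. 0 < tm p)"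

lemma AE_solves: "AE \<omega> in M. solves \<omega>"
proof -
  have "AE p in \<nu>. 0 < tm p"
    using marks_cover by eventually_elim (auto simp: time_slab_def)
  then have "AE \<omega> in M. AE p in N \<omega>. 0 < tm p" by (rule PN.AE_N_null)
  with S AE_space show ?thesis by eventually_elim (simp add: solves_def)
qed

lemma tm_meas: "\<omega> \<in> space M \<Longrightarrow> tm \<in> borel_measurable (N \<omega>)"
proof -
  assume "\<omega> \<in> space M"
  then have "sets (N \<omega>) = sets borel" by (rule PN.sets_N)
  moreover have "tm \<in> borel_measurable borel"
    using borel_measurable_snd[OF borel_measurable_snd[OF borel_measurable_snd[OF borel_measurable_snd[OF measurable_ident]]]]
    by (simp add: id_def)
  ultimately show ?thesis by (simp cong: measurable_cong_sets)
qed

context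
  fixes \<omega> assumes sol: "solves \<omega>"
begin

lemma sol_space: "\<omega> \<in> space M" and sol_S: "system_S I J \<sigma> f T (N \<omega>) (X \<omega>) (Z \<omega>)" and sol_pos: "AE p in N \<omega>. 0 < tm p"
  using sol unfolding solves_def by auto

lemma sol_conj: "0 \<le> u \<Longrightarrow> u \<le> T \<Longrightarrow> Z \<omega> integrable_on {0..u} \<and> X \<omega> u = X \<omega> 0 + integral {0..u} (Z \<omega>) \<and>
        integrable (N \<omega>) (sde_integrand I J \<sigma> f (X \<omega>) (Z \<omega>) u) \<and>
        Z \<omega> u = Z \<omega> 0 + (\<integral>p. sde_integrand I J \<sigma> f (X \<omega>) (Z \<omega>) u p \<partial>N \<omega>)"
  using sol_S[unfolded system_S_def, THEN bspec, of u] by simp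

lemma jumpsize_integrable: "integrable (N \<omega>) (jumpsize \<omega>)"
  using sol_conj[of T] T unfolding jumpsize_def by simp

lemma tm_N [measurable]: "tm \<in> borel_measurable (N \<omega>)"
  by (rule tm_meas[OF sol_space])

lemma jump_ind: "A \<in> sets borel \<Longrightarrow> integrable (N \<omega>) (\<lambda>p. indicator A (tm p) *\<^sub>R jumpsize \<omega> p)"
  using jumpsize_integrable
  by (rule_tac Bochner_Integration.integrable_bound[OF jumpsize_integrable]) (auto simp: indicator_def)

lemma sol_Z: 
  assumes u: "0 \<le> u" "u \<le> T"
  shows "Z \<omega> u = Z \<omega> 0 + (\<integral>p. indicator {..u} (tm p) *\<^sub>R jumpsize \<omega> p \<partial>N \<omega>)"
proof -
  have S: "integrable (N \<omega>) (sde_integrand I J \<sigma> f (X \<omega>) (Z \<omega>) u)"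
    "Z \<omega> u = Z \<omega> 0 + (\<integral>p. sde_integrand I J \<sigma> f (X \<omega>) (Z \<omega>) u p \<partial>N \<omega>)"
    using sol_conj[of u] u by blast+
  have "(\<integral>p. sde_integrand I J \<sigma> f (X \<omega>) (Z \<omega>) u p \<partial>N \<omega>) = (\<integral>p. indicator {..u} (tm p) *\<^sub>R jumpsize \<omega> p \<partial>N \<omega>)"
  proof (rule integral_cong_AE)
    \<comment> \<open>(S) counts times in \<open>[0,u]\<close>; no noise sits at nonpositive times,
      so \<open>{..u}\<close> gives the same integral.\<close>
    show "AE p in N \<omega>. sde_integrand I J \<sigma> f (X \<omega>) (Z \<omega>) u p = indicator {..u} (tm p) *\<^sub>R jumpsize \<omega> p"
      using sol_pos by eventually_elim (use u in \<open>auto simp: jumpsize_def sde_integrand_def indicator_def split_beta'\<close>)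
  qed (use S(1) jump_ind[of "{..u}"] in auto)
  then show ?thesis using S(2) by simp
qed

lemma sol_Zl:
  assumes u: "0 < u" "u \<le> T"
  shows "Zl \<omega> u = Z \<omega> 0 + (\<integral>p. indicator {..<u} (tm p) *\<^sub>R jumpsize \<omega> p \<partial>N \<omega>)"
proof -
  have "leftlim (Z \<omega>) u = Z \<omega> 0 + (\<integral>p. indicator {..<u} (tm p) *\<^sub>R jumpsize \<omega> p \<partial>N \<omega>)"
  proof (rule fixed_time_left[OF _ u])
    show "cadlag_on T (Z \<omega>)" using cadlag sol_space by auto
    fix s :: "nat \<Rightarrow> real" assume s: "\<And>n. 0 \<le> s n \<and> s n < u" "s \<longlonglongrightarrow> u"
    have "(\<lambda>n. \<integral>p. indicator {..s n} (tm p) *\<^sub>R jumpsize \<omega> p \<partial>N \<omega>) \<longlonglongrightarrow> (\<integral>p. indicator {..<u} (tm p) *\<^sub>R jumpsize \<omega> p \<partial>N \<omega>)"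
    proof (rule integral_dominated_convergence[where w="\<lambda>p. norm (jumpsize \<omega> p)"])
      show "AE p in N \<omega>. (\<lambda>n. indicator {..s n} (tm p) *\<^sub>R jumpsize \<omega> p) \<longlonglongrightarrow> indicator {..<u} (tm p) *\<^sub>R jumpsize \<omega> p"
      proof (rule AE_I2)
        fix p
        \<comment> \<open>Noise at time \<open>u\<close> is never counted since
          \<open>s n < u\<close>, which is why the limit runs over \<open>{..<u}\<close>.\<close>
        have "eventually (\<lambda>n. indicator {..s n} (tm p) *\<^sub>R jumpsize \<omega> p = indicator {..<u} (tm p) *\<^sub>R jumpsize \<omega> p) sequentially"
        proof (cases "tm p < u")
          case True
          from order_tendstoD(1)[OF s(2) True] show ?thesis
            by eventually_elim (use True in \<open>auto simp: indicator_def\<close>)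
        next
          case False
          then have "\<not> tm p \<le> s n" for n using s(1)[of n] by auto
          then show ?thesis using False by (auto simp: indicator_def)
        qed
        then show "(\<lambda>n. indicator {..s n} (tm p) *\<^sub>R jumpsize \<omega> p) \<longlonglongrightarrow> indicator {..<u} (tm p) *\<^sub>R jumpsize \<omega> p"
          by (rule tendsto_eventually)
      qed
    qed (use jumpsize_integrable in \<open>auto simp: indicator_def\<close>)
    moreover have "Z \<omega> (s n) = Z \<omega> 0 + (\<integral>p. indicator {..s n} (tm p) *\<^sub>R jumpsize \<omega> p \<partial>N \<omega>)" for n
      using s(1)[of n] u by (intro sol_Z) auto
    ultimately show "(\<lambda>n. Z \<omega> (s n)) \<longlonglongrightarrow> Z \<omega> 0 + (\<integral>p. indicator {..<u} (tm p) *\<^sub>R jumpsize \<omega> p \<partial>N \<omega>)"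
      by (simp only:) (intro tendsto_intros)
  qed
  then show ?thesis using u by (simp add: Zl_def)
qed

lemma sol_X: "0 \<le> u \<Longrightarrow> u \<le> T \<Longrightarrow> X \<omega> u = X \<omega> 0 + integral {0..u} (Z \<omega>)"
  using sol_conj by blast

text \<open>\<open>X\<close> is an indefinite integral and hence continuous. So (S), which contains
  the position at time \<open>s\<close> itself, may be read with the predictable left limit.\<close>

lemma sol_Xl:
  assumes u: "0 < u" "u \<le> T"
  shows "Xl \<omega> u = X \<omega> u"
proof -
  have "(Z \<omega>) integrable_on {0..T}" using sol_conj[of T] T by simp
  then have c: "continuous_on {0..T} (\<lambda>u. integral {0..u} (Z \<omega>))" by (rule indefinite_integral_continuous_1)
  have "leftlim (X \<omega>) u = X \<omega> u"
  proof (rule fixed_time_left[OF _ u])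
    show "cadlag_on T (X \<omega>)" using cadlag sol_space by auto
    fix s :: "nat \<Rightarrow> real" assume s: "\<And>n. 0 \<le> s n \<and> s n < u" "s \<longlonglongrightarrow> u"
    have "(\<lambda>n. X \<omega> 0 + integral {0..s n} (Z \<omega>)) \<longlonglongrightarrow> X \<omega> 0 + integral {0..u} (Z \<omega>)"
    proof (intro tendsto_intros continuous_on_tendsto_compose[OF c s(2)])
      show "u \<in> {0..T}" using u by auto
      show "\<forall>\<^sub>F n in sequentially. s n \<in> {0..T}"
        using s(1) u by (intro always_eventually) (auto intro: less_imp_le less_le_trans order_trans)
    qed
    moreover have "X \<omega> (s n) = X \<omega> 0 + integral {0..s n} (Z \<omega>)" for n
      using s(1)[of n] u by (intro sol_X) auto
    ultimately show "(\<lambda>n. X \<omega> (s n)) \<longlonglongrightarrow> X \<omega> u" using u by (simp add: sol_X[of u])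
  qed
  then show ?thesis using u by (simp add: Xl_def)
qed

text \<open>At an accepted point this is the definition of \<open>zstar\<close>; at a rejected one
  \<open>jumpsize\<close> is 0 and both sides vanish.\<close>

lemma sol_jump:
  assumes "t \<le> T"
  shows "indicator {0<..t} (tm p) * (\<psi> (X \<omega> (tm p), Zl \<omega> (tm p) + jumpsize \<omega> p) - \<psi> (X \<omega> (tm p), Zl \<omega> (tm p)))
    = Hf t (Xl \<omega>) (Zl \<omega>) p"
proof (cases "0 < tm p \<and> tm p \<le> t")
  case True
  define s where "s = tm p"
  have s: "0 < s" "s \<le> T" "s \<in> {0..T}" using True assms s_def by auto
  have x: "Xl \<omega> s = X \<omega> s" using sol_Xl s by auto
  have z: "leftlim (Z \<omega>) s = Zl \<omega> s" using s by (simp add: Zl_def)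
  have c: "cond_dens f s = cond_dens fT s" unfolding cond_dens_def marg_def fT_eq[OF s(3)] ..
  obtain v \<theta> \<phi> r where p: "p = (v, \<theta>, \<phi>, r, s)" unfolding s_def by (cases p) auto
  have "jumpsize \<omega> p = indicator {0..rate s (Xl \<omega> s) (Zl \<omega> s) v} r *\<^sub>R alpha I J (Zl \<omega> s) v \<theta> \<phi>"
    using s by (simp add: p jumpsize_def sde_integrand_def rate_def x z c indicator_def)
  then show ?thesis
    using True unfolding Hf_def s_def[symmetric] x[symmetric]
    by (simp add: p \<Delta>_def zstar_def indicator_def)
qed (auto simp: Hf_def)

lemma no_fixed_jump:
  assumes u: "0 < u" "u \<le> T" and null: "emeasure (N \<omega>) {p. tm p = u} = 0"
  shows "Zl \<omega> u = Z \<omega> u"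
proof -
  have "{p. tm p = u} \<in> sets (N \<omega>)"
  proof -
    have "{p\<in>space (N \<omega>). tm p = u} \<in> sets (N \<omega>)" by measurable
    moreover have "space (N \<omega>) = UNIV" using sets_eq_imp_space_eq[OF PN.sets_N[OF sol_space]] by simp
    ultimately show ?thesis by simp
  qed
  then have "{p. tm p = u} \<in> null_sets (N \<omega>)" using null by auto
  from AE_not_in[OF this] have ae: "AE p in N \<omega>. indicator {..<u} (tm p) *\<^sub>R jumpsize \<omega> p = indicator {..u} (tm p) *\<^sub>R jumpsize \<omega> p"
    by eventually_elim (auto simp: indicator_def)
  show ?thesis
    unfolding sol_Zl[OF u] using u sol_Z[of u] jump_ind[of "{..<u}"] jump_ind[of "{..u}"] ae
    by (simp add: integral_cong_AE[OF _ _ ae])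
qed

lemma pathwise:
  assumes t: "0 \<le> t" "t \<le> T"
    and good: "PN.good \<omega>"
    and one: "\<forall>k. \<exists>n>0. \<forall>i<n. one_atom (N \<omega>) (time_slab (marks k) {t * real i / real n<..t * real (Suc i) / real n})"
  shows "\<psi> (X \<omega> t, Z \<omega> t) = \<psi> (X \<omega> 0, Z \<omega> 0)
    + (LINT s:{0..t}|lborel. D (Xl \<omega> s, Zl \<omega> s) (Zl \<omega> s, 0)) + (\<integral>p. Hf t (Xl \<omega>) (Zl \<omega>) p \<partial>N \<omega>)"
proof -
  have sN: "sets (N \<omega>) = sets borel" by (rule PN.sets_N[OF sol_space])
  have jump: "(\<lambda>p. indicator {0<..t} (tm p) * (\<psi> (X \<omega> (tm p), Zl \<omega> (tm p) + jumpsize \<omega> p) - \<psi> (X \<omega> (tm p), Zl \<omega> (tm p))))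
    = Hf t (Xl \<omega>) (Zl \<omega>)" using sol_jump[OF t(2)] by auto
  have ito: "((\<lambda>s. D (X \<omega> s, Zl \<omega> s) (Zl \<omega> s, 0)) has_integral
       (\<psi> (X \<omega> t, Z \<omega> t) - \<psi> (X \<omega> 0, Z \<omega> 0) - (\<integral>p. indicator {0<..t} (tm p) * (\<psi> (X \<omega> (tm p), Zl \<omega> (tm p) + jumpsize \<omega> p) - \<psi> (X \<omega> (tm p), Zl \<omega> (tm p))) \<partial>N \<omega>))) {0..t}"
  proof (rule pathwise_ito(2)[where B=PN.B])
    show "PN.B k \<in> sets (N \<omega>)" for k using sN PN.B_meas by auto
    show "emeasure (N \<omega>) (PN.B k) < \<infinity>" for k using good unfolding PN.good_def by auto
    show "AE p in N \<omega>. p \<in> (\<Union>k. PN.B k)"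
    proof -
      have "- (\<Union>k. PN.B k) \<in> null_sets (N \<omega>)" using good sN PN.B_meas unfolding PN.good_def by auto
      from AE_not_in[OF this] show ?thesis by eventually_elim auto
    qed
    show "\<exists>n>0. \<forall>i<n. one_atom (N \<omega>) (PN.B k \<inter> {p\<in>space (N \<omega>). t * real i / real n < tm p \<and> tm p \<le> t * real (Suc i) / real n})" for k
    proof -
      obtain n where n: "n > 0" "\<And>i. i < n \<Longrightarrow> one_atom (N \<omega>) (time_slab (marks k) {t * real i / real n<..t * real (Suc i) / real n})"
        using one by (metis (no_types))
      have "PN.B k \<inter> {p\<in>space (N \<omega>). t * real i / real n < tm p \<and> tm p \<le> t * real (Suc i) / real n}
        = time_slab (marks k) {t * real i / real n<..t * real (Suc i) / real n}" if i: "i < n" for i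
      proof -
        have "t * real (Suc i) / real n \<le> t * real n / real n"
          using i t by (intro divide_right_mono mult_left_mono) auto
        then have le: "t * real (Suc i) / real n \<le> T" using n t by auto
        have ge: "0 \<le> t * real i / real n" using t by auto
        have "space (N \<omega>) = UNIV" using sets_eq_imp_space_eq[OF sN] by simp
        then show ?thesis
          unfolding PN.B_def time_slab_def using le ge by (auto intro: order_trans le_less_trans simp del: of_nat_Suc)
      qed
      then show ?thesis using n by (intro exI[of _ n]) auto
    qed
    show "(\<lambda>p. indicator {0<..t} (tm p) * (\<psi> (X \<omega> (tm p), Zl \<omega> (tm p) + jumpsize \<omega> p) - \<psi> (X \<omega> (tm p), Zl \<omega> (tm p)))) \<in> borel_measurable (N \<omega>)"
      unfolding jump using Hf_meas[OF left_path_meas[OF sol_space]] sN by (simp cong: measurable_cong_sets)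
    show "Z \<omega> u = Z \<omega> 0 + (\<integral>p. indicator {..u} (tm p) *\<^sub>R jumpsize \<omega> p \<partial>N \<omega>)" if "0 \<le> u" "u \<le> t" for u
      by (rule sol_Z) (use that t in linarith)+
    show "Zl \<omega> u = Z \<omega> 0 + (\<integral>p. indicator {..<u} (tm p) *\<^sub>R jumpsize \<omega> p \<partial>N \<omega>)" if "0 < u" "u \<le> t" for u
      by (rule sol_Zl) (use that t in linarith)+
    show "X \<omega> u = X \<omega> 0 + integral {0..u} (Z \<omega>)" if "0 \<le> u" "u \<le> t" for u
      by (rule sol_X) (use that t in linarith)+
  qed (rule tm_N jumpsize_integrable sol_pos t(1) deriv D_cont D_bound PN.B_inc)+
  \<comment> \<open>On \<open>[0,t]\<close> the paths \<open>Xl \<omega>\<close> and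
    \<open>X \<omega>\<close> can differ only at time 0.\<close>
  have ito': "((\<lambda>s. D (Xl \<omega> s, Zl \<omega> s) (Zl \<omega> s, 0)) has_integral
       (\<psi> (X \<omega> t, Z \<omega> t) - \<psi> (X \<omega> 0, Z \<omega> 0) - (\<integral>p. Hf t (Xl \<omega>) (Zl \<omega>) p \<partial>N \<omega>))) {0..t}"
    using ito[unfolded jump] by (rule has_integral_spike_finite[where S="{0}", rotated 2]) (use t sol_Xl in auto)
  \<comment> \<open>\<open>ito'\<close> concerns the gauge integral. Its integrand is bounded and
    Borel, so the Lebesgue integral has the same value.\<close>
  have "set_integrable lborel {0..t} (\<lambda>s. D (Xl \<omega> s, Zl \<omega> s) (Zl \<omega> s, 0))"
    unfolding set_integrable_def
  proof (rule integrableI_bounded_set_indicator[where B=K])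
    have "(\<lambda>s. D (Xl \<omega> s, Zl \<omega> s) (Zl \<omega> s, 0)) \<in> borel_measurable borel"
      by (intro drift_meas left_path_meas[OF sol_space])
    then show "(\<lambda>s. D (Xl \<omega> s, Zl \<omega> s) (Zl \<omega> s, 0)) \<in> borel_measurable lborel" by simp
  qed (use drift_bound in \<open>auto simp: emeasure_lborel_Icc_eq\<close>)
  from set_borel_integral_eq_integral(2)[OF this] integral_unique[OF ito'] show ?thesis by simp
qed

end

end

section \<open>Expectations and the weak formula\<close>

context boltzmann_system begin

text \<open>Almost surely no jump occurs at a prescribed time. The exceptional set depends on
  \<open>s\<close>, so this is used only under an expectation at fixed \<open>s\<close>.\<close>

lemma AE_left:
  assumes s: "0 < s" "s \<le> T"
  shows "AE \<omega> in M. Xl \<omega> s = X \<omega> s \<and> Zl \<omega> s = Z \<omega> s"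
proof -
  have "{p\<in>space borel. tm p = s} \<in> sets (borel :: noise_pt measure)" by measurable
  then have "{p. tm p = s} \<in> sets borel" by simp
  from PN.N_null[OF this nu_time_null] AE_solves show ?thesis
    by eventually_elim (simp add: sol_Xl no_fixed_jump s)
qed

lemma AE_pathwise:
  assumes t: "0 \<le> t" "t \<le> T"
  shows "AE \<omega> in M. \<psi> (X \<omega> t, Z \<omega> t) = \<psi> (X \<omega> 0, Z \<omega> 0)
    + (LINT s:{0..t}|lborel. D (Xl \<omega> s, Zl \<omega> s) (Zl \<omega> s, 0)) + (\<integral>p. H t (\<omega>, p) \<partial>PN.N' \<omega>)"
  using AE_solves PN.AE_good PN.one_atom_partition[OF t] PN.N'_eq
proof eventually_elim
  case (elim \<omega>)
  show ?case using pathwise[OF elim(1) t elim(2,3)] elim(4) by (simp add: H_def)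
qed

lemma moment_left:
  obtains m where "0 \<le> m" "\<And>C s. 0 \<le> C \<Longrightarrow> 0 < s \<Longrightarrow> s \<le> T \<Longrightarrow>
    (\<integral>\<^sup>+\<omega>. ennreal (C * (1 + (norm (Zl \<omega> s))\<^sup>2)) \<partial>M) \<le> ennreal (C * (1 + m))"
proof -
  define m where "m = enn2real (\<Squnion>t\<in>{0..T}. \<integral>\<^sup>+ \<omega>. ennreal ((norm (Z \<omega> t))\<^sup>2) \<partial>M)"
  have m: "(\<Squnion>t\<in>{0..T}. \<integral>\<^sup>+ \<omega>. ennreal ((norm (Z \<omega> t))\<^sup>2) \<partial>M) = ennreal m"
    unfolding m_def using moment by simp
  have m0: "0 \<le> m" unfolding m_def by simp
  show ?thesis
  proof (rule that[OF m0])
    fix C s :: real assume C: "0 \<le> C" and s: "0 < s" "s \<le> T"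
    then have s': "s \<in> {0..T}" by auto
    have "(\<integral>\<^sup>+\<omega>. ennreal (C * (1 + (norm (Zl \<omega> s))\<^sup>2)) \<partial>M) = (\<integral>\<^sup>+\<omega>. ennreal C + ennreal C * ennreal ((norm (Z \<omega> s))\<^sup>2) \<partial>M)"
    proof (rule nn_integral_cong_AE)
      show "AE \<omega> in M. ennreal (C * (1 + (norm (Zl \<omega> s))\<^sup>2)) = ennreal C + ennreal C * ennreal ((norm (Z \<omega> s))\<^sup>2)"
        using AE_left[OF s] by eventually_elim (use C in \<open>simp add: distrib_left ennreal_mult\<close>)
    qed
    also have "\<dots> = ennreal C + ennreal C * (\<integral>\<^sup>+\<omega>. ennreal ((norm (Z \<omega> s))\<^sup>2) \<partial>M)"
      using XZ_meas[OF s'] by (subst nn_integral_add) (auto simp: nn_integral_cmult PN.emeasure_space_1)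
    also have "\<dots> \<le> ennreal C + ennreal C * ennreal m"
      unfolding m[symmetric] by (intro add_left_mono mult_left_mono SUP_upper s') auto
    also have "\<dots> = ennreal (C * (1 + m))" using C m0 by (simp add: distrib_left ennreal_mult)
    finally show "(\<integral>\<^sup>+\<omega>. ennreal (C * (1 + (norm (Zl \<omega> s))\<^sup>2)) \<partial>M) \<le> ennreal (C * (1 + m))" .
  qed
qed

lemma total_moment_finite:
  assumes C: "0 \<le> C"
  shows "(\<integral>\<^sup>+\<omega>. \<integral>\<^sup>+s. ennreal (C * (1 + (norm (Zl \<omega> s))\<^sup>2)) \<partial>timeM \<partial>M) < \<infinity>"
proof -
  obtain m where m: "0 \<le> m" "\<And>C s. 0 \<le> C \<Longrightarrow> 0 < s \<Longrightarrow> s \<le> T \<Longrightarrow>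
    (\<integral>\<^sup>+\<omega>. ennreal (C * (1 + (norm (Zl \<omega> s))\<^sup>2)) \<partial>M) \<le> ennreal (C * (1 + m))"
    by (rule moment_left) blast
  interpret P: pair_sigma_finite M timeM by unfold_locales
  have "(\<lambda>(\<omega>, s). ennreal (C * (1 + (norm (Zl \<omega> s))\<^sup>2))) \<in> borel_measurable (M \<Otimes>\<^sub>M borel)"
    by measurable
  then have "(\<lambda>(\<omega>, s). ennreal (C * (1 + (norm (Zl \<omega> s))\<^sup>2))) \<in> borel_measurable (M \<Otimes>\<^sub>M timeM)"
    by (simp cong: measurable_cong_sets sets_pair_measure_cong)
  from P.Fubini'[OF this]
  have "(\<integral>\<^sup>+\<omega>. \<integral>\<^sup>+s. ennreal (C * (1 + (norm (Zl \<omega> s))\<^sup>2)) \<partial>timeM \<partial>M)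
    = (\<integral>\<^sup>+s. \<integral>\<^sup>+\<omega>. ennreal (C * (1 + (norm (Zl \<omega> s))\<^sup>2)) \<partial>M \<partial>timeM)" by simp
  also have "\<dots> \<le> (\<integral>\<^sup>+s. ennreal (C * (1 + m)) \<partial>timeM)"
  proof (rule nn_integral_mono_AE)
    show "AE s in timeM. (\<integral>\<^sup>+\<omega>. ennreal (C * (1 + (norm (Zl \<omega> s))\<^sup>2)) \<partial>M) \<le> ennreal (C * (1 + m))"
      using AE_timeM' by eventually_elim (use m(2)[OF C] in auto)
  qed
  also have "\<dots> = ennreal (C * (1 + m)) * emeasure timeM UNIV"
    using sets_eq_imp_space_eq[OF sets_timeM] by simp
  also have "emeasure timeM UNIV = ennreal T"
    unfolding timeM_def using T by (subst emeasure_density) auto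
  finally show ?thesis by (rule le_less_trans) (simp add: ennreal_mult_less_top)
qed

lemma H_finite: "(\<integral>\<^sup>+\<omega>. \<integral>\<^sup>+p. ennreal \<bar>H t (\<omega>, p)\<bar> \<partial>\<nu> \<partial>M) < \<infinity>"
proof -
  obtain C where C: "0 \<le> C" "\<And>t x z. x \<in> borel_measurable borel \<Longrightarrow> z \<in> borel_measurable borel \<Longrightarrow>
    (\<integral>\<^sup>+p. ennreal \<bar>Hf t x z p\<bar> \<partial>\<nu>) \<le> (\<integral>\<^sup>+s. ennreal (C * (1 + (norm (z s))\<^sup>2)) \<partial>timeM)"
    by (rule nn_abs_Hf_bound) blast
  have "(\<integral>\<^sup>+\<omega>. \<integral>\<^sup>+p. ennreal \<bar>H t (\<omega>, p)\<bar> \<partial>\<nu> \<partial>M) \<le> (\<integral>\<^sup>+\<omega>. \<integral>\<^sup>+s. ennreal (C * (1 + (norm (Zl \<omega> s))\<^sup>2)) \<partial>timeM \<partial>M)"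
    unfolding H_def fst_conv snd_conv by (intro nn_integral_mono C(2) left_path_meas)
  then show ?thesis using total_moment_finite[OF C(1)] by (rule le_less_trans)
qed

lemma collop_finite:
  assumes "t \<le> T"
  shows "(\<integral>\<^sup>+\<omega>. \<integral>\<^sup>+s. indicator {0..t} s * ennreal \<bar>collop s (Xl \<omega> s) (Zl \<omega> s)\<bar> \<partial>lborel \<partial>M) < \<infinity>"
proof -
  obtain C where C: "0 \<le> C" "\<And>s x z. s \<in> {0..T} \<Longrightarrow> \<bar>collop s x z\<bar> \<le> C * (1 + (norm z)\<^sup>2)"
    by (rule collop_bound) blast
  have "(\<integral>\<^sup>+\<omega>. \<integral>\<^sup>+s. indicator {0..t} s * ennreal \<bar>collop s (Xl \<omega> s) (Zl \<omega> s)\<bar> \<partial>lborel \<partial>M)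
    \<le> (\<integral>\<^sup>+\<omega>. \<integral>\<^sup>+s. ennreal (C * (1 + (norm (Zl \<omega> s))\<^sup>2)) \<partial>timeM \<partial>M)"
  proof (rule nn_integral_mono)
    fix \<omega> assume \<omega>: "\<omega> \<in> space M"
    note [measurable] = left_path_meas[OF \<omega>]
    have "(\<integral>\<^sup>+s. indicator {0..t} s * ennreal \<bar>collop s (Xl \<omega> s) (Zl \<omega> s)\<bar> \<partial>lborel)
      \<le> (\<integral>\<^sup>+s. indicator {0..T} s * ennreal (C * (1 + (norm (Zl \<omega> s))\<^sup>2)) \<partial>lborel)"
      using assms C(2) by (intro nn_integral_mono) (auto simp: indicator_def intro!: ennreal_leI)
    also have "\<dots> = (\<integral>\<^sup>+s. ennreal (C * (1 + (norm (Zl \<omega> s))\<^sup>2)) \<partial>timeM)"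
      unfolding timeM_def by (rule nn_integral_density[symmetric]) auto
    finally show "(\<integral>\<^sup>+s. indicator {0..t} s * ennreal \<bar>collop s (Xl \<omega> s) (Zl \<omega> s)\<bar> \<partial>lborel)
      \<le> (\<integral>\<^sup>+s. ennreal (C * (1 + (norm (Zl \<omega> s))\<^sup>2)) \<partial>timeM)" .
  qed
  then show ?thesis using total_moment_finite[OF C(1)] by (rule le_less_trans)
qed

lemma drift_finite:
  "(\<integral>\<^sup>+\<omega>. \<integral>\<^sup>+s. indicator {0..t} s * ennreal \<bar>D (Xl \<omega> s, Zl \<omega> s) (Zl \<omega> s, 0)\<bar> \<partial>lborel \<partial>M) < \<infinity>"
proof -
  have "(\<integral>\<^sup>+\<omega>. \<integral>\<^sup>+s. indicator {0..t} s * ennreal \<bar>D (Xl \<omega> s, Zl \<omega> s) (Zl \<omega> s, 0)\<bar> \<partial>lborel \<partial>M)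
    \<le> (\<integral>\<^sup>+\<omega>. \<integral>\<^sup>+s. ennreal K * indicator {0..t} s \<partial>lborel \<partial>M)"
    using drift_bound by (intro nn_integral_mono) (auto simp: indicator_def intro!: ennreal_leI)
  also have "\<dots> = ennreal K * emeasure lborel {0..t}"
    by (simp add: nn_integral_cmult_indicator PN.emeasure_space_1)
  also have "\<dots> < \<infinity>" by (simp add: ennreal_mult_less_top emeasure_lborel_Icc_eq)
  finally show ?thesis .
qed

text \<open>Returns from left limits to the process after expectation and time integral have been
  exchanged: at each positive time the two agree almost surely, and time 0 is a null set.\<close>

lemma set_integral_left:
  assumes t: "t \<le> T" and h: "\<And>s \<omega>. g s \<omega> = h s (Xl \<omega> s) (Zl \<omega> s)"
    and m: "\<And>s. s \<in> {0..T} \<Longrightarrow> (\<lambda>q. h s (fst q) (snd q)) \<in> borel_measurable borel"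
    and gm: "\<And>s. (\<lambda>\<omega>. g s \<omega>) \<in> borel_measurable M"
  shows "(LINT s:{0..t}|lborel. (\<integral>\<omega>. g s \<omega> \<partial>M)) = (LINT s:{0..t}|lborel. (\<integral>\<omega>. (h s (X \<omega> s) (Z \<omega> s) :: real) \<partial>M))"
  unfolding set_lebesgue_integral_def
proof (rule integral_discrete_difference[where X="{0}"])
  fix s assume "s \<notin> {0::real}"
  show "indicator {0..t} s *\<^sub>R (\<integral>\<omega>. g s \<omega> \<partial>M) = indicator {0..t} s *\<^sub>R (\<integral>\<omega>. h s (X \<omega> s) (Z \<omega> s) \<partial>M)"
  proof (cases "s \<in> {0..t}")
    case True
    then have s: "0 < s" "s \<le> T" "s \<in> {0..T}" using t \<open>s \<notin> {0}\<close> by auto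
    have "(\<lambda>\<omega>. h s (X \<omega> s) (Z \<omega> s)) \<in> borel_measurable M"
      using measurable_compose[OF borel_measurable_Pair[OF XZ_meas[OF s(3)]] m[OF s(3)]] by simp
    moreover have "AE \<omega> in M. g s \<omega> = h s (X \<omega> s) (Z \<omega> s)"
      using AE_left[OF s(1,2)] by eventually_elim (simp add: h)
    ultimately have "(\<integral>\<omega>. g s \<omega> \<partial>M) = (\<integral>\<omega>. h s (X \<omega> s) (Z \<omega> s) \<partial>M)"
      using gm by (intro integral_cong_AE)
    then show ?thesis by simp
  qed simp
qed auto

text \<open>Before the expectation of the pathwise formula can be distributed, each term must be
  integrable by itself: \<psi> and the drift are bounded, and the noise term is controlled by
  \<open>H_finite\<close>.\<close>

lemma weak_formula:
  assumes t: "0 \<le> t" "t \<le> T"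
  shows "(\<integral>\<omega>. \<psi> (X \<omega> t, Z \<omega> t) \<partial>M) = (\<integral>\<omega>. \<psi> (X \<omega> 0, Z \<omega> 0) \<partial>M)
    + (LINT s:{0..t}|lborel. (\<integral>\<omega>. D (X \<omega> s, Z \<omega> s) (Z \<omega> s, 0) \<partial>M))
    + (LINT s:{0..t}|lborel. (\<integral>\<omega>. collop s (X \<omega> s) (Z \<omega> s) \<partial>M))"
proof -
  have \<psi>m: "(\<lambda>\<omega>. \<psi> (X \<omega> s, Z \<omega> s)) \<in> borel_measurable M" if "s \<in> {0..T}" for s
    using XZ_meas[OF that] by measurable
  have iA: "integrable M (\<lambda>\<omega>. \<psi> (X \<omega> 0, Z \<omega> 0))"
    using \<psi>m[of 0] T \<psi>_bound by (intro PN.integrable_const_bound[where B=K]) auto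
  have mD: "(\<lambda>(\<omega>, s). D (Xl \<omega> s, Zl \<omega> s) (Zl \<omega> s, 0)) \<in> borel_measurable (M \<Otimes>\<^sub>M borel)" by measurable
  have mC: "(\<lambda>(\<omega>, s). collop s (Xl \<omega> s) (Zl \<omega> s)) \<in> borel_measurable (M \<Otimes>\<^sub>M borel)" by measurable
  note dr = expectation_set_integral[OF PN.prob_space_axioms mD drift_finite[of t]]
  note co = expectation_set_integral[OF PN.prob_space_axioms mC collop_finite[OF t(2)]]
  note Hint = PN.predictable_integral[OF H_predictable[OF t(2)] H_finite]
  have "(\<integral>\<omega>. \<psi> (X \<omega> t, Z \<omega> t) \<partial>M) = (\<integral>\<omega>. \<psi> (X \<omega> 0, Z \<omega> 0)
    + (LINT s:{0..t}|lborel. D (Xl \<omega> s, Zl \<omega> s) (Zl \<omega> s, 0)) + (\<integral>p. H t (\<omega>, p) \<partial>PN.N' \<omega>) \<partial>M)"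
    using AE_pathwise[OF t] \<psi>m[of t] t iA dr(2) Hint(2) by (intro integral_cong_AE) auto
  also have "\<dots> = (\<integral>\<omega>. \<psi> (X \<omega> 0, Z \<omega> 0) \<partial>M)
    + (\<integral>\<omega>. (LINT s:{0..t}|lborel. D (Xl \<omega> s, Zl \<omega> s) (Zl \<omega> s, 0)) \<partial>M) + (\<integral>\<omega>. (\<integral>p. H t (\<omega>, p) \<partial>PN.N' \<omega>) \<partial>M)"
    using iA dr(2) Hint(2) by simp
  \<comment> \<open>\<open>Hint(1)\<close> replaces the noise by its intensity. For almost every
    \<omega> the absolute intensity integral is finite, and there \<open>integral_Hf\<close>
    evaluates it.\<close>
  also have "(\<integral>\<omega>. (\<integral>p. H t (\<omega>, p) \<partial>PN.N' \<omega>) \<partial>M) = (\<integral>\<omega>. (LINT s:{0..t}|lborel. collop s (Xl \<omega> s) (Zl \<omega> s)) \<partial>M)"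
    unfolding Hint(1)
  proof (rule integral_cong_AE)
    have "(\<lambda>\<omega>. \<integral>\<^sup>+p. ennreal \<bar>H t (\<omega>, p)\<bar> \<partial>\<nu>) \<in> borel_measurable M"
      using PN.predictable_nn_integral'[of "\<lambda>q. ennreal \<bar>H t q\<bar>"] H_predictable[OF t(2)] by simp
    then have "AE \<omega> in M. (\<integral>\<^sup>+p. ennreal \<bar>H t (\<omega>, p)\<bar> \<partial>\<nu>) \<noteq> \<infinity>"
      by (rule nn_integral_noteq_infinite) (use H_finite[of t] in auto)
    then show "AE \<omega> in M. (\<integral>p. H t (\<omega>, p) \<partial>\<nu>) = (LINT s:{0..t}|lborel. collop s (Xl \<omega> s) (Zl \<omega> s))"
      using AE_space
    proof eventually_elim
      case (elim \<omega>)
      then show ?case unfolding H_def fst_conv snd_conv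
        by (intro integral_Hf t left_path_meas) (auto simp: less_top)
    qed
  qed (use Hint(3) co(2) in auto)
  also have "\<dots> = (LINT s:{0..t}|lborel. (\<integral>\<omega>. collop s (Xl \<omega> s) (Zl \<omega> s) \<partial>M))" by (rule co(1))
  also have "\<dots> = (LINT s:{0..t}|lborel. (\<integral>\<omega>. collop s (X \<omega> s) (Z \<omega> s) \<partial>M))"
    by (rule set_integral_left[OF t(2)]) measurable
  also have "(\<integral>\<omega>. (LINT s:{0..t}|lborel. D (Xl \<omega> s, Zl \<omega> s) (Zl \<omega> s, 0)) \<partial>M)
    = (LINT s:{0..t}|lborel. (\<integral>\<omega>. D (Xl \<omega> s, Zl \<omega> s) (Zl \<omega> s, 0) \<partial>M))" by (rule dr(1))
  also have "\<dots> = (LINT s:{0..t}|lborel. (\<integral>\<omega>. D (X \<omega> s, Z \<omega> s) (Z \<omega> s, 0) \<partial>M))"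
    by (rule set_integral_left[OF t(2), where h="\<lambda>s x z. D (x, z) (z, 0)"]) measurable
  finally show ?thesis .
qed

end

section \<open>Bounds for test functions and transfer to the laws\<close>

lemma C2_0_bounds:
  assumes "C2_0 \<psi>"
  obtains D L \<rho> K where "\<And>q. (\<psi> has_derivative blinfun_apply (D q)) (at q)" "continuous_on UNIV D"
    "\<And>q. norm (D q) \<le> L" "\<And>q. \<bar>\<psi> q\<bar> \<le> K" "\<And>x z. \<bar>D (x, z) (z, 0)\<bar> \<le> K"
    "\<And>x z. \<psi> (x, z) \<noteq> 0 \<Longrightarrow> norm x \<le> \<rho>"
proof -
  obtain D D2 where D: "\<And>p. (\<psi> has_derivative blinfun_apply (D p)) (at p)"
    and D2: "\<And>p. (D has_derivative blinfun_apply (D2 p)) (at p)"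
    using assms unfolding C2_0_def C2_def by auto
  have Dc: "continuous_on UNIV D" by (intro continuous_at_imp_continuous_on ballI has_derivative_continuous[OF D2])
  have \<psi>c: "continuous_on UNIV \<psi>" by (intro continuous_at_imp_continuous_on ballI has_derivative_continuous[OF D])
  have "bounded (closure {p. \<psi> p \<noteq> 0})" using assms unfolding C2_0_def by (auto intro: compact_imp_bounded)
  then obtain \<rho> where \<rho>: "0 < \<rho>" "\<forall>p\<in>closure {p. \<psi> p \<noteq> 0}. norm p \<le> \<rho>" unfolding bounded_pos by blast
  have s0: "\<psi> p = 0" if "\<rho> < norm p" for p
  proof (rule ccontr)
    assume "\<psi> p \<noteq> 0"
    then have "p \<in> closure {p. \<psi> p \<noteq> 0}" by (intro subsetD[OF closure_subset]) simp
    from bspec[OF \<rho>(2) this] show False using that by simp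
  qed
  \<comment> \<open>The exterior of the ball is open and \<psi> is 0 on it, so its derivative
    vanishes there as well and all bounds reduce to a compact ball.\<close>
  have D0: "D p = 0" if "\<rho> < norm p" for p
  proof -
    have "open {p :: vec3 \<times> vec3. \<rho> < norm p}" by (intro open_Collect_less continuous_intros)
    have "(\<psi> has_derivative blinfun_apply 0) (at p)"
    proof (rule has_derivative_transform_within_open[where f="\<lambda>_. 0"])
      show "((\<lambda>_. 0::real) has_derivative blinfun_apply 0) (at p)"
        by (simp add: zero_blinfun.rep_eq)
      show "open {p :: vec3 \<times> vec3. \<rho> < norm p}" by fact
    qed (use that s0 in auto)
    from has_derivative_unique[OF D this] show "D p = 0" by (simp add: blinfun_apply_inject)
  qed
  have "bounded (D ` cball 0 \<rho>)"
    by (intro compact_imp_bounded compact_continuous_image continuous_on_subset[OF Dc]) auto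
  then obtain L where L: "0 < L" "\<forall>y\<in>D ` cball 0 \<rho>. norm y \<le> L" unfolding bounded_pos by blast
  have DL: "norm (D q) \<le> L" for q
    using L D0[of q] by (cases "\<rho> < norm q") auto
  have "bounded (\<psi> ` cball 0 \<rho>)"
    by (intro compact_imp_bounded compact_continuous_image continuous_on_subset[OF \<psi>c]) auto
  then obtain K where K: "0 < K" "\<forall>y\<in>\<psi> ` cball 0 \<rho>. norm y \<le> K" unfolding bounded_pos by blast
  show ?thesis
  proof (rule that[OF D Dc DL])
    show "\<bar>\<psi> q\<bar> \<le> max K (L * \<rho>)" for q
    proof (cases "\<rho> < norm q")
      case True then show ?thesis using K s0 by auto
    next
      case False
      then have "q \<in> cball 0 \<rho>" by simp
      then have "norm (\<psi> q) \<le> K" using K(2) by blast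
      then show ?thesis by simp
    qed
    \<comment> \<open>The velocity \<open>z\<close> is unbounded, but \<open>D\<close> vanishes
      unless \<open>norm (x, z) \<le> \<rho>\<close>; this is the origin of
      \<open>L * \<rho>\<close>.\<close>
    show "\<bar>D (x, z) (z, 0)\<bar> \<le> max K (L * \<rho>)" for x z
    proof (cases "\<rho> < norm (x, z)")
      case True then show ?thesis using K D0 by (simp add: zero_blinfun.rep_eq)
    next
      case False
      have "norm z \<le> norm (x, z)" by (rule norm_snd_le)
      then have "norm z \<le> \<rho>" using False by linarith
      then have "norm (z, 0::vec3) \<le> \<rho>" by (simp add: norm_Pair)
      have "norm (D (x, z) (z, 0)) \<le> norm (D (x, z)) * norm (z, 0::vec3)" by (rule norm_blinfun)
      also have "\<dots> \<le> L * \<rho>" using DL L(1) \<open>norm (z, 0::vec3) \<le> \<rho>\<close> by (intro mult_mono) auto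
      finally show ?thesis by simp
    qed
    show "norm x \<le> \<rho>" if "\<psi> (x, z) \<noteq> 0" for x z
    proof -
      have "norm x \<le> norm (x, z)" by (rule norm_fst_le)
      then show ?thesis using s0[of "(x, z)"] that by linarith
    qed
  qed
qed

theorem theorem4p1:
  fixes I J :: "vec3 \<Rightarrow> vec3" and Q :: "real measure" and \<sigma> :: "real \<Rightarrow> real"
    and T :: real and f :: "real \<Rightarrow> vec3 \<Rightarrow> vec3 \<Rightarrow> real"
    and M :: "'w measure" and F :: "real \<Rightarrow> 'w measure"
    and N :: "'w \<Rightarrow> noise_pt measure" and X Z :: "'w \<Rightarrow> real \<Rightarrow> vec3"
  assumes IJ: "admissible_IJ I J"
    and A': "hypA' Q \<sigma>"
    and T: "T > 0"
    and strong: "strong_solution I J Q \<sigma> T f"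
    and cont: "continuous_on ({0..T} \<times> UNIV) (\<lambda>(t, x, v). f t x v)"
    and B2: "hypB2 T f"
    and basis: "stochastic_basis M F T"
    and PRM: "adapted_PRM M F T (intensity Q T (marg f)) N"
    and adapted: "\<forall>t\<in>{0..T}. (\<lambda>\<omega>. X \<omega> t) \<in> borel_measurable (F t) \<and> (\<lambda>\<omega>. Z \<omega> t) \<in> borel_measurable (F t)"
    and cadlag: "\<forall>\<omega>\<in>space M. cadlag_on T (X \<omega>) \<and> cadlag_on T (Z \<omega>)"
    and S: "AE \<omega> in M. system_S I J \<sigma> f T (N \<omega>) (X \<omega>) (Z \<omega>)"
    and moment: "(\<Squnion>t\<in>{0..T}. \<integral>\<^sup>+ \<omega>. ennreal ((norm (Z \<omega> t))\<^sup>2) \<partial>M) < \<infinity>"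
  shows "weak_bilinear_solution I J Q \<sigma> f T (\<lambda>t. distr M borel (\<lambda>\<omega>. (X \<omega> t, Z \<omega> t)))"
  unfolding weak_bilinear_solution_def
proof (intro conjI ballI allI impI)
  interpret M: prob_space M using basis unfolding stochastic_basis_def by simp
  have sub: "subalgebra M (F t)" if "t \<in> {0..T}" for t
    using basis that unfolding stochastic_basis_def by simp
  have XZ [measurable]: "(\<lambda>\<omega>. (X \<omega> t, Z \<omega> t)) \<in> borel_measurable M" if "t \<in> {0..T}" for t
    using adapted that measurable_from_subalg[OF sub[OF that]] by (intro borel_measurable_Pair) blast+
  fix t assume t: "t \<in> {0..T}"
  show "prob_space (distr M borel (\<lambda>\<omega>. (X \<omega> t, Z \<omega> t)))" by (rule M.prob_space_distr[OF XZ[OF t]])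
  show "sets (distr M borel (\<lambda>\<omega>. (X \<omega> t, Z \<omega> t))) = sets borel" by simp
next
  fix \<psi> D\<psi> t assume \<psi>: "C2_0 \<psi>" and D\<psi>: "\<forall>p. (\<psi> has_derivative D\<psi> p) (at p)" and t: "t \<in> {0..T}"
  have dens: "\<And>t. t \<in> {0..T} \<Longrightarrow> prob_density6 (f t)"
    using strong unfolding strong_solution_def by blast
  obtain D L \<rho> K where D: "\<And>q. (\<psi> has_derivative blinfun_apply (D q)) (at q)" "continuous_on UNIV D"
    "\<And>q. norm (D q) \<le> L" "\<And>q. \<bar>\<psi> q\<bar> \<le> K" "\<And>x z. \<bar>D (x, z) (z, 0)\<bar> \<le> K"
    "\<And>x z. \<psi> (x, z) \<noteq> 0 \<Longrightarrow> norm x \<le> \<rho>"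
    by (rule C2_0_bounds[OF \<psi>]) (rule that, assumption+)
  \<comment> \<open>The weak formulation speaks of any derivative of \<psi>; uniqueness identifies
    it with the continuous \<open>D\<close> obtained from \<open>C2_0\<close>.\<close>
  have DD: "D\<psi> p = blinfun_apply (D p)" for p using D\<psi> D(1) has_derivative_unique by blast
  have L: "0 \<le> L" by (rule order_trans[OF norm_ge_zero D(3)])
  have "continuous_on UNIV \<psi>" by (intro continuous_at_imp_continuous_on ballI has_derivative_continuous[OF D(1)])
  then have \<psi>m: "\<psi> \<in> borel_measurable borel" by (rule borel_measurable_continuous_onI)
  have lip: "\<bar>\<psi> a - \<psi> b\<bar> \<le> L * norm (a - b)" for a b
    using bounded_derivative_lipschitz[OF D(1,3)] by simp
  interpret k: kinetic I J Q \<sigma> T f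
    by (rule kinetic.intro[OF IJ A' T dens cont B2])
  interpret b: boltzmann_system I J Q \<sigma> T f \<psi> L \<rho> M F N X Z D K
    by (unfold_locales) (fact \<psi>m lip L D(6) basis PRM[folded k.\<nu>_def] adapted cadlag S moment D(1-5))+
  have XZ [measurable]: "(\<lambda>\<omega>. (X \<omega> s, Z \<omega> s)) \<in> borel_measurable M" if "s \<in> {0..T}" for s
    by (intro borel_measurable_Pair b.XZ_meas that)
  have e\<psi>: "(\<integral>p. \<psi> p \<partial>distr M borel (\<lambda>\<omega>. (X \<omega> s, Z \<omega> s))) = (\<integral>\<omega>. \<psi> (X \<omega> s, Z \<omega> s) \<partial>M)" if "s \<in> {0..T}" for s
    by (rule integral_distr[OF XZ[OF that] \<psi>m])
  have eD: "(\<integral>(x, z). D\<psi> (x, z) (z, 0) \<partial>distr M borel (\<lambda>\<omega>. (X \<omega> s, Z \<omega> s))) = (\<integral>\<omega>. D (X \<omega> s, Z \<omega> s) (Z \<omega> s, 0) \<partial>M)"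
    if "s \<in> {0..T}" for s
  proof -
    have "(\<lambda>p. D (fst p, snd p) (snd p, 0)) \<in> borel_measurable borel" by measurable
    then show ?thesis unfolding DD by (subst integral_distr[OF XZ[OF that]]) (auto simp: split_beta')
  qed
  have eL: "(\<integral>p. Lop I J Q \<sigma> f s \<psi> p \<partial>distr M borel (\<lambda>\<omega>. (X \<omega> s, Z \<omega> s))) = (\<integral>\<omega>. b.collop s (X \<omega> s) (Z \<omega> s) \<partial>M)"
    if "s \<in> {0..T}" for s
  proof -
    have eq: "Lop I J Q \<sigma> f s \<psi> = (\<lambda>p. b.collop s (fst p) (snd p))"
      using b.Lop_eq[OF that] by (auto simp: fun_eq_iff)
    have "(\<lambda>p. b.collop s (fst p) (snd p)) \<in> borel_measurable borel" by measurable
    then show ?thesis unfolding eq by (subst integral_distr[OF XZ[OF that]]) auto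
  qed
  \<comment> \<open>The identities \<open>eD\<close> and \<open>eL\<close> hold for times in
    \<open>[0,T]\<close> only, which contains the range of integration.\<close>
  have cong: "(LINT s:{0..t}|lborel. a s) = (LINT s:{0..t}|lborel. c s)" if "\<And>s. s \<in> {0..T} \<Longrightarrow> a s = c s" for a c :: "real \<Rightarrow> real"
    using that t by (intro set_lebesgue_integral_cong) auto
  show "(\<integral>p. \<psi> p \<partial>distr M borel (\<lambda>\<omega>. (X \<omega> t, Z \<omega> t))) = (\<integral>p. \<psi> p \<partial>distr M borel (\<lambda>\<omega>. (X \<omega> 0, Z \<omega> 0)))
     + (LINT s:{0..t}|lborel. (\<integral>(x, z). D\<psi> (x, z) (z, 0) \<partial>distr M borel (\<lambda>\<omega>. (X \<omega> s, Z \<omega> s))))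
     + (LINT s:{0..t}|lborel. (\<integral>p. Lop I J Q \<sigma> f s \<psi> p \<partial>distr M borel (\<lambda>\<omega>. (X \<omega> s, Z \<omega> s))))"
    using b.weak_formula[of t] t T cong[OF eD] cong[OF eL] e\<psi>[of t] e\<psi>[of 0] by simp
qed

end
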